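(* Let $J\subseteq\Delta^d_n$ be an M-convex set, let $U$ be either $\mathbb{P}\mathrm{L}_J$ or $\mathrm{Gr}_J(\mathbb{T}_q)$ for a fixed $0<q<\infty$, let $X=\overline U$, $G=\mathbb{R}^n_{>0}$, and $P=\mathrm{BP}_J$. For a regular polymatroid subdivision $\mathscr P$ of $P$ whose maximal cells have lattice point sets $J_1,\dots,J_s$, let $Y(\mathscr P)$ be the set of all $K\in X/_HG$ for which there exist $x_i\in U_{J_i}$ ($i=1,\dots,s$) with $K=\bigcup_{i=1}^s\overline{Gx_i}$. Then: (1) for every $x\in X$ there exists $K\in X/_HG$ with $x\in K$; (2) $X/_HG=\bigcup_{\mathscr P}Y(\mathscr P)$, the union over all regular polymatroid subdivisions $\mathscr P$ of $P$; (3) $Y(\mathscr P)\ne\emptyset$ for every regular polymatroid subdivision $\mathscr P$ of $P$.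
   Context: $\Delta^d_n=\{\alpha\in\mathbb{Z}^n_{\ge0}:\sum\alpha_i=d\}$; $J$ is M-convex if nonempty and for all $\alpha,\beta\in J$, $i$ with $\alpha_i<\beta_i$ there is $j$ with $\alpha_j>\beta_j$, $\alpha+e_i-e_j,\beta-e_i+e_j\in J$; $\delta^\pm_J$ coordinatewise max/min. $v\colon J\to\mathbb{R}$ is M-convex if for all $\alpha,\beta\in J$, $k$ with $\alpha_k>\beta_k$ there is $l$ with $\alpha_l<\beta_l$, $\alpha-e_k+e_l,\beta+e_k-e_l\in J$ and $v(\alpha)+v(\beta)\ge v(\alpha-e_k+e_l)+v(\beta+e_k-e_l)$. $\mathrm{BP}_J=\mathrm{conv}(J)$; a regular polymatroid subdivision of $\mathrm{BP}_J$ is the regular subdivision of the point configuration $J$ induced by an M-convex function $v\colon J\to\mathbb{R}$ (lower faces of the convex hull of the lifted points $(\alpha,v(\alpha))$ projected to $\mathbb{R}^n$). For any M-convex $J'$: $\mathbb{P}\mathrm{L}_{J'}$ is the set of Lorentzian polynomials (nonzero, homogeneous of degree $d$, nonnegative coefficients, M-convex support, each $\partial^\alpha f$ with $|\alpha|=d-2$ has Hessian with at most one positive eigenvalue) with support $J'$, modulo positive scalars; $\mathrm{Gr}_{J'}(\mathbb{T}_q)$ is the set modulo positive scalars of $\rho\colon\Delta^d_n\to\mathbb{R}_{\ge0}$ with support $J'$ such that for all $2\le s\le d$, $\alpha\in\Delta^{d-s}_n$ with $\delta^-_{J'}\le\alpha$, $i_0\le\dots\le i_s$, $j_2\le\dots\le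 j_s$ with $\alpha+\sum e_{i_m}+\sum e_{j_m}\le\delta^+_{J'}$, the numbers $b_k=\rho(\alpha+\sum_{m\ne k}e_{i_m})\rho(\alpha+e_{i_k}+e_{j_2}+\dots+e_{j_s})$ satisfy $b_k^{1/q}\le\sum_{m\ne k}b_m^{1/q}$ for all $k$; $\rho$ is identified with $\sum\rho(\alpha)x^\alpha/\alpha!$. $U_{J'}$ denotes $\mathbb{P}\mathrm{L}_{J'}$ or $\mathrm{Gr}_{J'}(\mathbb{T}_q)$ correspondingly. All are regarded inside the set of degree-$d$ homogeneous polynomials with nonnegative coefficients summing to $1$ (Euclidean metric); $X$ is the closure of $U$ there. $G=\mathbb{R}^n_{>0}$ acts by rescaling variables (then renormalizing). $\mathrm{H}(X)$ is the space of compact subsets of $X$ with the Hausdorff metric; $e(x)=\overline{Gx}$; $X/_HG=\bigcap_{U'}\overline{e(U')}\subseteq\mathrm{H}(X)$, the intersection over all open dense $G$-invariant $U'\subseteq X$. *)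

theory Defs
  imports "HOL-Analysis.Analysis"
begin

section \<open>M-convexity\<close>

text \<open>
  Exponents live in \<open>nat^'n\<close>, with unit vectors \<open>evec i\<close>. Subtraction on \<open>nat\<close> is truncated, so we
  always add a unit vector before removing one; wherever these expressions occur below the removed
  coordinate is positive, and the result agrees with subtraction in the integers.
\<close>

abbreviation evec :: "'n::finite \<Rightarrow> nat^'n" where
  "evec i \<equiv> axis i 1"

definition degree_vec :: "nat^'n::finite \<Rightarrow> nat" where
  "degree_vec \<alpha> = (\<Sum>i\<in>UNIV. \<alpha> $ i)"

definition Delta :: "nat \<Rightarrow> (nat^'n::finite) set" where
  "Delta d = {\<alpha>. degree_vec \<alpha> = d}"

definition M_convex :: "(nat^'n::finite) set \<Rightarrow> bool" where
  "M_convex J \<longleftrightarrow> J \<noteq> {} \<and>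
     (\<forall>\<alpha>\<in>J. \<forall>\<beta>\<in>J. \<forall>i. \<alpha> $ i < \<beta> $ i \<longrightarrow>
        (\<exists>j. \<alpha> $ j > \<beta> $ j \<and> \<alpha> + evec i - evec j \<in> J \<and> \<beta> + evec j - evec i \<in> J))"

text \<open>Only the values of \<open>v\<close> on \<open>J\<close> matter.\<close>

definition M_convex_fun :: "(nat^'n::finite) set \<Rightarrow> (nat^'n \<Rightarrow> real) \<Rightarrow> bool" where
  "M_convex_fun J v \<longleftrightarrow>
     (\<forall>\<alpha>\<in>J. \<forall>\<beta>\<in>J. \<forall>k. \<alpha> $ k > \<beta> $ k \<longrightarrow>
        (\<exists>l. \<alpha> $ l < \<beta> $ l \<and> \<alpha> + evec l - evec k \<in> J \<and> \<beta> + evec k - evec l \<in> J \<and>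
             v \<alpha> + v \<beta> \<ge> v (\<alpha> + evec l - evec k) + v (\<beta> + evec k - evec l)))"

definition delta_plus :: "(nat^'n::finite) set \<Rightarrow> nat^'n" where
  "delta_plus J = (\<chi> i. Max ((\<lambda>\<alpha>. \<alpha> $ i) ` J))"

definition delta_minus :: "(nat^'n::finite) set \<Rightarrow> nat^'n" where
  "delta_minus J = (\<chi> i. Min ((\<lambda>\<alpha>. \<alpha> $ i) ` J))"


section \<open>Regular polymatroid subdivisions\<close>

definition real_vec :: "nat^'n::finite \<Rightarrow> real^'n" where
  "real_vec \<alpha> = (\<chi> i. real (\<alpha> $ i))"

definition lifted_polytope :: "(nat^'n::finite) set \<Rightarrow> (nat^'n \<Rightarrow> real) \<Rightarrow> ((real^'n) \<times> real) set" where
  "lifted_polytope J v = convex hull ((\<lambda>\<alpha>. (real_vec \<alpha>, v \<alpha>)) ` J)"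

text \<open>
  A lower face is a nonempty face on which a linear functional with positive last coefficient
  attains its minimum.
\<close>

definition lower_face :: "((real^'n::finite) \<times> real) set \<Rightarrow> ((real^'n) \<times> real) set \<Rightarrow> bool" where
  "lower_face Q F \<longleftrightarrow> F \<noteq> {} \<and>
     (\<exists>a b. snd a > 0 \<and> Q \<subseteq> {p. b \<le> a \<bullet> p} \<and> F = Q \<inter> {p. a \<bullet> p = b})"

definition regular_subdivision :: "(nat^'n::finite) set \<Rightarrow> (nat^'n \<Rightarrow> real) \<Rightarrow> (real^'n) set set" where
  "regular_subdivision J v = {fst ` F | F. lower_face (lifted_polytope J v) F}"

definition regular_polymatroid_subdivision :: "(nat^'n::finite) set \<Rightarrow> (real^'n) set set \<Rightarrow> bool" where
  "regular_polymatroid_subdivision J \<P> \<longleftrightarrow>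
     (\<exists>v. M_convex_fun J v \<and> \<P> = regular_subdivision J v)"

definition maximal_cells :: "(real^'n::finite) set set \<Rightarrow> (real^'n) set set" where
  "maximal_cells \<P> = {C \<in> \<P>. \<forall>D\<in>\<P>. C \<subseteq> D \<longrightarrow> C = D}"

text \<open>
  All cells lie in the nonnegative orthant, so their lattice points are given by natural numbers.
\<close>

definition lattice_points :: "(real^'n::finite) set \<Rightarrow> (nat^'n) set" where
  "lattice_points C = {\<alpha>. real_vec \<alpha> \<in> C}"


section \<open>Homogeneous polynomials\<close>

text \<open>
  A polynomial in variables indexed by \<open>'n\<close> is represented by its coefficient function; it is
  homogeneous of degree \<open>d\<close> if the coefficients vanish outside \<open>Delta d\<close>.
\<close>

type_synonym 'n polyn = "nat^'n \<Rightarrow> real"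

definition supp :: "('n::finite) polyn \<Rightarrow> (nat^'n) set" where
  "supp f = {\<alpha>. f \<alpha> \<noteq> 0}"

definition fact_vec :: "nat^'n::finite \<Rightarrow> real" where
  "fact_vec \<alpha> = (\<Prod>i\<in>UNIV. fact (\<alpha> $ i))"

text \<open>
  The formal derivative \<open>\<partial>\<^sup>\<alpha>\<close>: the coefficient of \<open>x\<^sup>\<beta>\<close> in \<open>\<partial>\<^sup>\<alpha> x\<^sup>\<beta>\<^sup>+\<^sup>\<alpha>\<close> is
  \<open>(\<beta> + \<alpha>)! / \<beta>!\<close>.
\<close>

definition pderivs :: "nat^'n::finite \<Rightarrow> 'n polyn \<Rightarrow> 'n polyn" where
  "pderivs \<alpha> f = (\<lambda>\<beta>. fact_vec (\<beta> + \<alpha>) / fact_vec \<beta> * f (\<beta> + \<alpha>))"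

text \<open>
  The Hessian of a quadratic form: its second derivatives are constants, read off at exponent \<open>0\<close>.
\<close>

definition hessian :: "('n::finite) polyn \<Rightarrow> real^'n^'n" where
  "hessian g = (\<chi> i j. pderivs (evec i) (pderivs (evec j) g) 0)"

text \<open>
  The number of positive eigenvalues counted with multiplicity. This is used for symmetric matrices
  only, where the geometric multiplicity is the algebraic one.
\<close>

definition num_pos_eigenvalues :: "real^'n^'n::finite \<Rightarrow> nat" where
  "num_pos_eigenvalues A =
     (\<Sum>l \<in> {l. 0 < l \<and> (\<exists>w. w \<noteq> 0 \<and> A *v w = l *\<^sub>R w)}. dim {w. A *v w = l *\<^sub>R w})"

definition Lorentzian :: "nat \<Rightarrow> ('n::finite) polyn \<Rightarrow> bool" where
  "Lorentzian d f \<longleftrightarrow>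
     (\<exists>\<alpha>. f \<alpha> \<noteq> 0) \<and> supp f \<subseteq> Delta d \<and> (\<forall>\<alpha>. 0 \<le> f \<alpha>) \<and> M_convex (supp f) \<and>
     (\<forall>\<alpha>. degree_vec \<alpha> + 2 = d \<longrightarrow> num_pos_eigenvalues (hessian (pderivs \<alpha> f)) \<le> 1)"

definition Tq_representation ::
    "nat \<Rightarrow> real \<Rightarrow> (nat^'n::{finite,linorder}) set \<Rightarrow> 'n polyn \<Rightarrow> bool" where
  "Tq_representation d q J \<rho> \<longleftrightarrow>
     (\<forall>\<alpha>. 0 \<le> \<rho> \<alpha>) \<and> supp \<rho> = J \<and> J \<subseteq> Delta d \<and>
     (\<forall>s \<alpha> i j.
        2 \<le> s \<and> s \<le> d \<and> \<alpha> \<in> Delta (d - s) \<and> delta_minus J \<le> \<alpha> \<and>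
        mono_on {0..s} i \<and> mono_on {2..s} j \<and>
        \<alpha> + (\<Sum>m=0..s. evec (i m)) + (\<Sum>m=2..s. evec (j m)) \<le> delta_plus J \<longrightarrow>
        (let b = (\<lambda>k. \<rho> (\<alpha> + (\<Sum>m\<in>{0..s} - {k}. evec (i m))) *
                      \<rho> (\<alpha> + evec (i k) + (\<Sum>m=2..s. evec (j m))))
         in \<forall>k\<in>{0..s}. b k powr (1 / q) \<le> (\<Sum>m\<in>{0..s} - {k}. b m powr (1 / q))))"

text \<open>
  Polynomials modulo positive scalars are represented by the unique multiple whose coefficients sum
  to \<open>1\<close>.
\<close>

definition normalize_poly :: "nat \<Rightarrow> ('n::finite) polyn \<Rightarrow> 'n polyn" where
  "normalize_poly d f = (\<lambda>\<alpha>. f \<alpha> / (\<Sum>\<beta>\<in>Delta d. f \<beta>))"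

definition PL :: "nat \<Rightarrow> (nat^'n::finite) set \<Rightarrow> 'n polyn set" where
  "PL d J = normalize_poly d ` {f. Lorentzian d f \<and> supp f = J}"

definition Gr :: "nat \<Rightarrow> real \<Rightarrow> (nat^'n::{finite,linorder}) set \<Rightarrow> 'n polyn set" where
  "Gr d q J = normalize_poly d ` ((\<lambda>\<rho> \<alpha>. \<rho> \<alpha> / fact_vec \<alpha>) ` {\<rho>. Tq_representation d q J \<rho>})"


section \<open>The ambient metric space\<close>

definition poly_simplex :: "nat \<Rightarrow> ('n::finite) polyn set" where
  "poly_simplex d = {f. supp f \<subseteq> Delta d \<and> (\<forall>\<alpha>. 0 \<le> f \<alpha>) \<and> (\<Sum>\<alpha>\<in>Delta d. f \<alpha>) = 1}"

definition poly_dist :: "nat \<Rightarrow> ('n::finite) polyn \<Rightarrow> 'n polyn \<Rightarrow> real" where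
  "poly_dist d f g = L2_set (\<lambda>\<alpha>. f \<alpha> - g \<alpha>) (Delta d)"

definition poly_metric :: "nat \<Rightarrow> ('n::finite) polyn metric" where
  "poly_metric d = metric (poly_simplex d, poly_dist d)"

lemma finite_Delta [simp]: "finite (Delta d :: (nat^'n::finite) set)"
proof -
  have "Delta d \<subseteq> (vec_lambda ` {f. range f \<subseteq> {..d}} :: (nat^'n) set)"
  proof
    fix \<alpha> :: "nat^'n" assume "\<alpha> \<in> Delta d"
    then have "\<alpha> $ i \<le> d" for i
      using member_le_sum[of i UNIV "\<lambda>i. \<alpha> $ i"] by (auto simp: Delta_def degree_vec_def)
    then show "\<alpha> \<in> vec_lambda ` {f. range f \<subseteq> {..d}}"
      by (intro image_eqI[where x = "vec_nth \<alpha>"]) (auto simp: vec_nth_inverse)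
  qed
  moreover have "finite {f :: 'n \<Rightarrow> nat. range f \<subseteq> {..d}}"
    using finite_PiE[of "UNIV :: 'n set" "\<lambda>_. {..d}"]
    by (simp add: PiE_UNIV_domain image_subset_iff Pi_def)
  ultimately show ?thesis
    by (meson finite_imageI finite_subset)
qed

lemma Metric_space_poly: "Metric_space (poly_simplex d) (poly_dist d)"
proof
  fix x y z :: "'n::finite polyn"
  show "0 \<le> poly_dist d x y"
    by (simp add: poly_dist_def)
  show "poly_dist d x y = poly_dist d y x"
    by (simp add: poly_dist_def L2_set_def power2_commute)
  show "poly_dist d x y = 0 \<longleftrightarrow> x = y" if "x \<in> poly_simplex d" "y \<in> poly_simplex d"
  proof
    assume "poly_dist d x y = 0"
    then have on: "\<forall>\<alpha>\<in>Delta d. x \<alpha> = y \<alpha>"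
      by (simp add: poly_dist_def L2_set_eq_0_iff)
    have "x \<alpha> = 0" "y \<alpha> = 0" if "\<alpha> \<notin> Delta d" for \<alpha>
      using \<open>x \<in> poly_simplex d\<close> \<open>y \<in> poly_simplex d\<close> that
      by (auto simp: poly_simplex_def supp_def)
    with on show "x = y"
      by (metis ext)
  qed (simp add: poly_dist_def L2_set_def)
  show "poly_dist d x z \<le> poly_dist d x y + poly_dist d y z"
    using L2_set_triangle_ineq[of "\<lambda>\<alpha>. x \<alpha> - y \<alpha>" "\<lambda>\<alpha>. y \<alpha> - z \<alpha>" "Delta d"]
    by (simp add: poly_dist_def)
qed

lemma mspace_poly_metric [simp]: "mspace (poly_metric d) = poly_simplex d"
  and mdist_poly_metric [simp]: "mdist (poly_metric d) = poly_dist d"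
  by (simp_all add: poly_metric_def Metric_space_poly Metric_space.mspace_metric
      Metric_space.mdist_metric)


section \<open>The Hausdorff metric\<close>

definition hyperspace :: "'a metric \<Rightarrow> 'a set set" where
  "hyperspace m = {K. K \<noteq> {} \<and> compactin (mtopology_of m) K}"

text \<open>
  The library's metric spaces ask the distance to be nonnegative and symmetric for all
  arguments, hence the default value \<open>0\<close> outside the hyperspace.
\<close>

definition hausdorff_dist :: "'a metric \<Rightarrow> 'a set \<Rightarrow> 'a set \<Rightarrow> real" where
  "hausdorff_dist m K L =
     (if K \<in> hyperspace m \<and> L \<in> hyperspace m
      then max (SUP x\<in>K. INF y\<in>L. mdist m x y) (SUP y\<in>L. INF x\<in>K. mdist m x y)
      else 0)"

definition hausdorff_metric :: "'a metric \<Rightarrow> 'a set metric" where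
  "hausdorff_metric m = metric (hyperspace m, hausdorff_dist m)"

locale hausdorff_facts =
  fixes m :: "'a metric"
begin

abbreviation "I \<equiv> \<lambda>x L. INF y\<in>L. mdist m x y"
abbreviation "D \<equiv> \<lambda>K L. SUP x\<in>K. I x L"

lemma bounded:
  assumes "K \<in> hyperspace m" "L \<in> hyperspace m"
  obtains B where "\<And>x y. \<lbrakk>x \<in> K; y \<in> L\<rbrakk> \<Longrightarrow> mdist m x y \<le> B"
proof -
  have "compactin (mtopology_of m) (K \<union> L)"
    using assms by (simp add: hyperspace_def compactin_Un)
  then obtain c B where "K \<union> L \<subseteq> Metric_space.mcball (mspace m) (mdist m) c B"
    using Metric_space.compactin_imp_mbounded[OF Metric_space_mspace_mdist, of m "K \<union> L"]
    by (auto simp: mtopology_of_def Metric_space.mbounded_def)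
  then have *: "c \<in> mspace m \<and> x \<in> mspace m \<and> mdist m c x \<le> B" if "x \<in> K \<union> L" for x
    using that Metric_space.in_mcball[OF Metric_space_mspace_mdist, of x m c B] by blast
  have "mdist m x y \<le> B + B" if "x \<in> K" "y \<in> L" for x y
    using *[of x] *[of y] that mdist_triangle[of x m c y] mdist_commute[of m x c] by auto
  then show thesis
    by (rule that)
qed

lemma in_mspace: "\<lbrakk>K \<in> hyperspace m; x \<in> K\<rbrakk> \<Longrightarrow> x \<in> mspace m"
  by (auto simp: hyperspace_def dest!: compactin_subset_topspace)

lemma I_le: "y \<in> L \<Longrightarrow> I x L \<le> mdist m x y"
  by (rule cINF_lower) (auto intro: bdd_belowI[of _ 0])

lemma I_nonneg: "L \<noteq> {} \<Longrightarrow> 0 \<le> I x L"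
  by (rule cINF_greatest) auto

lemma I_le_D:
  assumes "K \<in> hyperspace m" "L \<in> hyperspace m" "x \<in> K"
  shows "I x L \<le> D K L"
proof -
  obtain B where B: "\<And>x y. \<lbrakk>x \<in> K; y \<in> L\<rbrakk> \<Longrightarrow> mdist m x y \<le> B"
    using bounded assms by blast
  obtain y where "y \<in> L"
    using assms by (auto simp: hyperspace_def)
  then have "bdd_above ((\<lambda>x. I x L) ` K)"
    by (intro bdd_aboveI[of _ B]) (auto intro: order_trans[OF I_le] B)
  with assms show ?thesis
    by (intro cSUP_upper)
qed

lemma D_nonneg:
  assumes "K \<in> hyperspace m" "L \<in> hyperspace m"
  shows "0 \<le> D K L"
  using assms I_le_D[OF assms] I_nonneg[of L] unfolding hyperspace_def
  by (smt (verit) ex_in_conv mem_Collect_eq)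

lemma D_triangle:
  assumes "K \<in> hyperspace m" "L \<in> hyperspace m" "N \<in> hyperspace m"
  shows "D K N \<le> D K L + D L N"
proof (rule cSUP_least)
  show "K \<noteq> {}" using assms by (simp add: hyperspace_def)
  fix x assume x: "x \<in> K"
  have "I x N - D L N \<le> mdist m x y" if y: "y \<in> L" for y
  proof -
    have "I x N - mdist m x y \<le> I y N"
    proof (rule cINF_greatest)
      show "N \<noteq> {}" using assms by (simp add: hyperspace_def)
      fix z assume z: "z \<in> N"
      have "mdist m x z \<le> mdist m x y + mdist m y z"
        using assms x y z by (intro mdist_triangle) (auto intro: in_mspace)
      with I_le[OF z, of x] show "I x N - mdist m x y \<le> mdist m y z"
        by linarith
    qed
    with I_le_D[OF assms(2,3) y] show ?thesis by linarith
  qed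
  then have "I x N - D L N \<le> I x L"
    using assms by (intro cINF_greatest) (auto simp: hyperspace_def)
  with I_le_D[OF assms(1,2) x] show "I x N \<le> D K L + D L N"
    by linarith
qed

lemma D_zero:
  assumes "K \<in> hyperspace m" "L \<in> hyperspace m" "D K L \<le> 0"
  shows "K \<subseteq> L"
proof
  fix x assume x: "x \<in> K"
  have "\<exists>y\<in>L. mdist m x y < r" if "r > 0" for r
  proof (rule ccontr)
    assume "\<not> ?thesis"
    then have "r \<le> I x L"
      using assms by (intro cINF_greatest) (auto simp: hyperspace_def not_less)
    with I_le_D[OF assms(1,2) x] assms(3) that show False by linarith
  qed
  then have "x \<in> mtopology_of m closure_of L"
    using assms x in_mspace
    by (auto simp: mtopology_of_def Metric_space.metric_closure_of
        Metric_space.in_mball[OF Metric_space_mspace_mdist] hyperspace_def)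
  moreover have "closedin (mtopology_of m) L"
    using assms compactin_imp_closedin[of "mtopology_of m" L]
    by (simp add: hyperspace_def mtopology_of_def Metric_space.Hausdorff_space_mtopology)
  ultimately show "x \<in> L"
    by (simp add: closure_of_closedin)
qed

lemma D_self:
  assumes "K \<in> hyperspace m"
  shows "D K K \<le> 0"
proof (rule cSUP_least)
  show "K \<noteq> {}" using assms by (simp add: hyperspace_def)
  show "I x K \<le> 0" if "x \<in> K" for x
    using I_le[OF that, of x] in_mspace[OF assms that]
      Metric_space.mdist_zero[OF Metric_space_mspace_mdist, of x m] by simp
qed

lemma Metric_space_hausdorff: "Metric_space (hyperspace m) (hausdorff_dist m)"
proof
  fix K L N
  show "0 \<le> hausdorff_dist m K L"
    using D_nonneg[of K L] by (auto simp: hausdorff_dist_def)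
  have sym: "(INF x\<in>K. mdist m x y) = I y K" for K y
    by (simp only: mdist_commute[of m y])
  show "hausdorff_dist m K L = hausdorff_dist m L K"
    by (simp only: hausdorff_dist_def sym max.commute conj_commute)
  show "hausdorff_dist m K L = 0 \<longleftrightarrow> K = L" if "K \<in> hyperspace m" "L \<in> hyperspace m"
    using that D_zero[of K L] D_zero[of L K] D_self[of K] D_nonneg[of K K]
    by (auto simp: hausdorff_dist_def sym max_def split: if_splits)
  show "hausdorff_dist m K N \<le> hausdorff_dist m K L + hausdorff_dist m L N"
    if "K \<in> hyperspace m" "L \<in> hyperspace m" "N \<in> hyperspace m"
    using that D_triangle[of K L N] D_triangle[of N L K]
    by (auto simp: hausdorff_dist_def sym)
qed

end

lemma mspace_hausdorff_metric [simp]: "mspace (hausdorff_metric m) = hyperspace m"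
  and mdist_hausdorff_metric [simp]: "mdist (hausdorff_metric m) = hausdorff_dist m"
  by (simp_all add: hausdorff_metric_def hausdorff_facts.Metric_space_hausdorff
      Metric_space.mspace_metric Metric_space.mdist_metric)


section \<open>The torus action and the quotient\<close>

definition pos_torus :: "(real^'n::finite) set" where
  "pos_torus = {t. \<forall>i. 0 < t $ i}"

definition rescale :: "real^'n::finite \<Rightarrow> 'n polyn \<Rightarrow> 'n polyn" where
  "rescale t f = (\<lambda>\<alpha>. (\<Prod>i\<in>UNIV. (t $ i) ^ (\<alpha> $ i)) * f \<alpha>)"

definition orbit :: "nat \<Rightarrow> ('n::finite) polyn \<Rightarrow> 'n polyn set" where
  "orbit d f = (\<lambda>t. normalize_poly d (rescale t f)) ` pos_torus"

definition orbit_closure :: "nat \<Rightarrow> ('n::finite) polyn \<Rightarrow> 'n polyn set" where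
  "orbit_closure d f = mtopology_of (poly_metric d) closure_of (orbit d f)"

definition open_dense_invariant :: "nat \<Rightarrow> ('n::finite) polyn set \<Rightarrow> 'n polyn set \<Rightarrow> bool" where
  "open_dense_invariant d X V \<longleftrightarrow>
     openin (mtopology_of (submetric (poly_metric d) X)) V \<and>
     mtopology_of (submetric (poly_metric d) X) closure_of V = X \<and>
     (\<forall>f\<in>V. orbit d f \<subseteq> V)"

definition hausdorff_quotient :: "nat \<Rightarrow> ('n::finite) polyn set \<Rightarrow> 'n polyn set set" where
  "hausdorff_quotient d X =
     (\<Inter>V\<in>{V. open_dense_invariant d X V}.
        mtopology_of (hausdorff_metric (submetric (poly_metric d) X)) closure_of (orbit_closure d ` V))"

text \<open>
  \<open>Y d U X \<P>\<close> for a stratum assignment \<open>U\<close> sending an M-convex set \<open>J'\<close> to \<open>U\<^sub>J\<^sub>'\<close>.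
\<close>

definition Y ::
    "nat \<Rightarrow> ((nat^'n::finite) set \<Rightarrow> 'n polyn set) \<Rightarrow> 'n polyn set \<Rightarrow> (real^'n) set set \<Rightarrow> 'n polyn set set" where
  "Y d U X \<P> = {K \<in> hausdorff_quotient d X.
     \<exists>x. (\<forall>C\<in>maximal_cells \<P>. x C \<in> U (lattice_points C)) \<and>
         K = (\<Union>C\<in>maximal_cells \<P>. orbit_closure d (x C))}"

end

(*
The closure of an orbit depends continuously on the polynomial as long as the support does not
change, and the stratum of J is open, dense and invariant in its closure; hence the quotient is the
closure of the set of orbit closures of polynomials f with support J.

Let f_n be a sequence of such polynomials. The functions -log f_n satisfy the local exchange
inequality of an M-convex function up to a bounded error: for Lorentzian polynomials because a
Hessian with at most one positive eigenvalue satisfies a reversed Cauchy-Schwarz inequality.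
Passing to a subsequence, every functional from a finite list (the exchange functionals, and the
errors of affine interpolation from affine bases contained in J) is bounded or tends to plus or
minus infinity along -log f_n. Moving a late member of the sequence by a bounded amount gives w
with the limiting signs on these functionals. Local exchange implies exchange, so w is M-convex,
and on each maximal cell of its regular subdivision f_n converges after a rescaling by the torus,
while the other coefficients tend to 0. The orbit closures of these limits cover the limit of the
orbit closures of f_n: the barycentre of the support of a limit point lies in some maximal cell,
and comparing averages of logarithms shows that this cell contains the whole support.

Conversely, an M-convex w gives polynomials with coefficients exp (-n w(alpha)) / alpha!, whose
orbit closures degenerate to the regular subdivision defined by w. They are Lorentzian because the
four-point condition makes the rescaled Hessians ultrametric.
*)
theory Submission
  imports Defs
begin

text \<open>The sequence -log f_n may grow at several incomparable rates, and a single rescaled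
  limit would forget the slower ones; only the signs of finitely many functionals are kept.
  Correcting a late member, instead of taking a limit, turns "bounded" into "exactly zero" and keeps
  every unbounded sign strict, which is what contact with and separation from a supporting affine
  function require. The interpolation errors run over all subsets B of J because the cells of w are
  known only after w is chosen, while the subsequence has to be extracted before. Both choices of U
  enter through the locale \<open>strata\<close> alone. The exchange error is log 2^q over T_q,
  since x^(1/q) <= y^(1/q) + z^(1/q) gives x <= 2^q max(y, z); the reversed Cauchy-Schwarz
  inequality yields the case q = 2, hence the constant 4. M-convexity of the cells is what allows
  supports to be recovered: \<open>Y\<close> speaks of lattice points of polytopes, and these form
  the support of the limit only because an M-convex set contains every lattice point of its convex
  hull.\<close>

section \<open>Symmetric matrices with at most one positive eigenvalue\<close>

text \<open>For symmetric matrices this inequality is equivalent to having at most one positive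
  eigenvalue (\<open>num_pos_eigenvalues_le_1_iff\<close>), and unlike the eigenvalue count it
  visibly survives limits and diagonal congruences.\<close>

definition reverse_CS :: "real^'n^'n::finite \<Rightarrow> bool" where
  "reverse_CS A \<longleftrightarrow> (\<forall>x y. x \<bullet> (A *v x) > 0 \<longrightarrow> (x \<bullet> (A *v x)) * (y \<bullet> (A *v y)) \<le> (x \<bullet> (A *v y))\<^sup>2)"

lemma symmetric_form:
  fixes A :: "real^'n::finite^'n"
  assumes "transpose A = A"
  shows "x \<bullet> (A *v y) = y \<bullet> (A *v x)"
  by (metis assms dot_lmul_matrix inner_commute transpose_matrix_vector)

lemma symmetric_eigenvectors_orthogonal:
  fixes A :: "real^'n::finite^'n"
  assumes "transpose A = A" "A *v x = l *\<^sub>R x" "A *v y = m *\<^sub>R y" "l \<noteq> m"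
  shows "x \<bullet> y = 0"
proof -
  have "m * (x \<bullet> y) = l * (x \<bullet> y)"
    using symmetric_form[OF assms(1), of x y] assms(2,3) by (simp add: inner_commute)
  then show ?thesis using assms(4) by auto
qed

lemma subspace_eigenspace: "subspace {w. (A :: real^'n::finite^'n) *v w = l *\<^sub>R w}"
  by (auto simp: subspace_def matrix_vector_right_distrib matrix_vector_mult_scaleR scaleR_add_right)

text \<open>Eigenvectors for distinct eigenvalues are orthogonal, hence independent. Finiteness
  matters because a sum over an infinite set is 0, which would make the count in
  \<open>num_pos_eigenvalues\<close> meaningless.\<close>

lemma finite_eigenvalues:
  fixes A :: "real^'n::finite^'n"
  assumes "transpose A = A"
  shows "finite {l. \<exists>w. w \<noteq> 0 \<and> A *v w = l *\<^sub>R w}"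
proof -
  let ?L = "{l. \<exists>w. w \<noteq> 0 \<and> A *v w = l *\<^sub>R w}"
  obtain e where e: "\<And>l. l \<in> ?L \<Longrightarrow> e l \<noteq> 0 \<and> A *v e l = l *\<^sub>R e l"
    using bchoice[of ?L "\<lambda>l w. w \<noteq> 0 \<and> A *v w = l *\<^sub>R w"] by auto
  have orth: "e l \<bullet> e m = 0" if "l \<in> ?L" "m \<in> ?L" "l \<noteq> m" for l m
    using symmetric_eigenvectors_orthogonal[OF assms] e that by blast
  have inj: "inj_on e ?L"
  proof (rule inj_onI)
    fix l m assume "l \<in> ?L" "m \<in> ?L" "e l = e m"
    then show "l = m" using orth[of l m] e[of l] by force
  qed
  have "pairwise orthogonal (e ` ?L)"
    using orth by (fastforce simp: pairwise_def orthogonal_def)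
  then have "independent (e ` ?L)"
    using e by (intro pairwise_orthogonal_independent) force+
  then have "finite (e ` ?L)" by (rule independent_imp_finite)
  with inj show ?thesis by (rule finite_imageD[rotated])
qed

text \<open>The form is maximised over the unit sphere of \<open>W\<close>; the first variation
  vanishes there, so the maximiser is an eigenvector. Working in an invariant subspace allows a
  second application, orthogonally to the eigenvector found first.\<close>

lemma rayleigh_maximum:
  fixes A :: "real^'n::finite^'n"
  assumes sym: "transpose A = A" and W: "subspace W" and inv: "\<And>w. w \<in> W \<Longrightarrow> A *v w \<in> W"
    and x: "x \<in> W" "x \<bullet> (A *v x) > 0"
  obtains u l where "u \<in> W" "u \<noteq> 0" "l > 0" "A *v u = l *\<^sub>R u"
proof -
  let ?S = "sphere 0 1 \<inter> W"
  let ?Q = "\<lambda>z. z \<bullet> (A *v z)"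
  have x0: "x \<noteq> 0" using x by auto
  have "compact ?S" using closed_subspace[OF W] by (simp add: compact_Int_closed)
  moreover have "sgn x \<in> ?S"
    using x0 x(1) W by (simp add: norm_sgn sgn_div_norm subspace_scale)
  moreover have "continuous_on ?S ?Q"
    by (intro continuous_intros matrix_vector_mult_linear_continuous_on)
  ultimately obtain u where u: "u \<in> ?S" and mx: "\<And>z. z \<in> ?S \<Longrightarrow> ?Q z \<le> ?Q u"
    using continuous_attains_sup[of ?S ?Q] by blast
  define l where "l = ?Q u"
  have le: "?Q z \<le> l * (z \<bullet> z)" if "z \<in> W" for z
  proof (cases "z = 0")
    case False
    have "?Q (sgn z) \<le> l"
      using False that W mx[of "sgn z"] by (simp add: l_def norm_sgn sgn_div_norm subspace_scale)
    moreover have "?Q (sgn z) = ?Q z / (z \<bullet> z)"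
      by (simp add: sgn_div_norm matrix_vector_mult_scaleR power2_norm_eq_inner[symmetric] power2_eq_square field_simps)
    ultimately show ?thesis using False by (simp add: field_simps)
  qed simp
  have l: "l > 0"
  proof -
    have "0 < l * (x \<bullet> x)" using le[OF x(1)] x(2) by linarith
    moreover have "x \<bullet> x > 0" using x0 by simp
    ultimately show ?thesis by (metis zero_less_mult_pos2)
  qed
  have uu: "u \<bullet> u = 1" using u by (simp add: power2_norm_eq_inner[symmetric])
  \<comment> \<open>\<open>z\<close> measures the failure of the eigenvector equation. By invariance
    it is a direction inside \<open>W\<close>, and moving \<open>u\<close> along it would raise the
    form above \<open>l\<close> times the squared norm, to first order by
    \<open>2 * (z \<bullet> z)\<close>.\<close>
  define z where "z = A *v u - l *\<^sub>R u"
  have zW: "z \<in> W" using u inv W by (simp add: z_def subspace_diff subspace_scale)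
  have "z \<bullet> z = 0"
  proof (rule ccontr)
    assume nz: "z \<bullet> z \<noteq> 0"
    then have zz: "z \<bullet> z > 0" by simp
    define K where "K = ?Q z - l * (z \<bullet> z)"
    have step: "2 * t * (z \<bullet> z) + t\<^sup>2 * K \<le> 0" for t
    proof -
      have "u + t *\<^sub>R z \<in> W" using u zW W by (simp add: subspace_add subspace_scale)
      from le[OF this] have "?Q u + 2 * t * (z \<bullet> (A *v u)) + t\<^sup>2 * ?Q z
            \<le> l * (u \<bullet> u + 2 * t * (z \<bullet> u) + t\<^sup>2 * (z \<bullet> z))"
        using symmetric_form[OF sym, of u z]
        by (simp add: algebra_simps inner_add_left inner_add_right matrix_vector_right_distrib
            matrix_vector_mult_scaleR inner_commute power2_eq_square)
      moreover have zu: "z \<bullet> (A *v u) = z \<bullet> z + l * (z \<bullet> u)"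
        by (subst (2) z_def) (simp add: inner_diff_right)
      ultimately have "l + 2 * t * (z \<bullet> z + l * (z \<bullet> u)) + t\<^sup>2 * ?Q z
            \<le> l * (1 + 2 * t * (z \<bullet> u) + t\<^sup>2 * (z \<bullet> z))"
        using uu by (simp only: zu flip: l_def)
      then show ?thesis
        unfolding K_def by (simp add: algebra_simps)
    qed
    \<comment> \<open>Small enough for \<open>t * K\<close> to stay above
      \<open>- (z \<bullet> z)\<close>, so that the linear term dominates.\<close>
    define t where "t = (z \<bullet> z) / (\<bar>K\<bar> + 1)"
    have t: "t > 0" using zz by (simp add: t_def)
    have "t * \<bar>K\<bar> \<le> z \<bullet> z" using zz by (simp add: t_def field_simps)
    then have "t * K \<ge> - (z \<bullet> z)" using t by (smt (verit) mult_minus_right mult_left_mono abs_ge_minus_self)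
    then have "t * (2 * (z \<bullet> z) + t * K) > 0" using t zz by (intro mult_pos_pos) linarith+
    with step[of t] show False by (simp add: algebra_simps power2_eq_square)
  qed
  then have "A *v u = l *\<^sub>R u" by (simp add: z_def)
  with u l uu show ?thesis by (intro that[of u l]) auto
qed

lemma num_pos_eigenvalues_le_1_iff:
  fixes A :: "real^'n::finite^'n"
  assumes sym: "transpose A = A"
  shows "num_pos_eigenvalues A \<le> 1 \<longleftrightarrow> reverse_CS A"
proof
  let ?L = "{l. 0 < l \<and> (\<exists>w. w \<noteq> 0 \<and> A *v w = l *\<^sub>R w)}"
  let ?E = "\<lambda>l. {w. A *v w = l *\<^sub>R w}"
  have fin: "finite ?L" by (rule finite_subset[OF _ finite_eigenvalues[OF sym]]) auto
  {
    assume le: "num_pos_eigenvalues A \<le> 1"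
    show "reverse_CS A"
      unfolding reverse_CS_def
    proof (intro allI impI, rule ccontr)
      fix x y assume Qx: "x \<bullet> (A *v x) > 0"
        and "\<not> (x \<bullet> (A *v x)) * (y \<bullet> (A *v y)) \<le> (x \<bullet> (A *v y))\<^sup>2"
      then have gt: "(x \<bullet> (A *v x)) * (y \<bullet> (A *v y)) > (x \<bullet> (A *v y))\<^sup>2" by simp
      obtain u l where u: "u \<noteq> 0" "l > 0" "A *v u = l *\<^sub>R u"
        using rayleigh_maximum[OF sym subspace_UNIV _ _ Qx] by auto
      let ?W = "{w. u \<bullet> w = 0}"
      have W: "subspace ?W" by (rule subspace_hyperplane)
      have inv: "A *v w \<in> ?W" if "w \<in> ?W" for w
        using symmetric_form[OF sym, of u w] u that by (simp add: inner_commute)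
      \<comment> \<open>A nontrivial combination of \<open>x\<close> and \<open>y\<close> orthogonal
        to \<open>u\<close>. The form is positive definite on the span of \<open>x\<close> and
        \<open>y\<close>, so it is positive at \<open>z\<close> and yields a second
        eigenvector.\<close>
      define s t where "s = (if u \<bullet> x = 0 then 1 else u \<bullet> y)" and "t = (if u \<bullet> x = 0 then 0 else - (u \<bullet> x))"
      define z where "z = s *\<^sub>R x + t *\<^sub>R y"
      have st: "s \<noteq> 0 \<or> t \<noteq> 0" by (auto simp: s_def t_def)
      have zW: "z \<in> ?W" by (auto simp: z_def s_def t_def inner_add_right)
      have "z \<bullet> (A *v z) > 0"
      proof -
        define a b c where "a = x \<bullet> (A *v x)" and "b = x \<bullet> (A *v y)" and "c = y \<bullet> (A *v y)"
        have "z \<bullet> (A *v z) = s\<^sup>2 * a + 2 * s * t * b + t\<^sup>2 * c"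
          using symmetric_form[OF sym, of x y] unfolding z_def a_def b_def c_def
          by (simp add: algebra_simps inner_add_left inner_add_right matrix_vector_right_distrib
            matrix_vector_mult_scaleR power2_eq_square)
        \<comment> \<open>Completing the square; the failed inequality says that the determinant
          \<open>a * c - b\<^sup>2\<close> is positive.\<close>
        then have "a * (z \<bullet> (A *v z)) = (s * a + t * b)\<^sup>2 + t\<^sup>2 * (a * c - b\<^sup>2)"
          by (simp add: algebra_simps power2_eq_square)
        also have "\<dots> > 0"
        proof (cases "t = 0")
          case True
          with st Qx show ?thesis by (simp add: a_def)
        next
          case False
          have "a * c - b\<^sup>2 > 0" using gt by (simp add: a_def b_def c_def)
          with False have "t\<^sup>2 * (a * c - b\<^sup>2) > 0" by simp
          then show ?thesis by (smt (verit) zero_le_power2)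
        qed
        finally show ?thesis using Qx by (simp add: a_def zero_less_mult_iff)
      qed
      then obtain u' l' where u': "u' \<in> ?W" "u' \<noteq> 0" "l' > 0" "A *v u' = l' *\<^sub>R u'"
        using rayleigh_maximum[OF sym W inv zW] by blast
      have dim1: "dim (?E l) \<ge> 1" if "w \<noteq> 0" "A *v w = l *\<^sub>R w" for w l
      proof -
        have "dim (?E l) \<noteq> 0"
          using that dim_eq_0[of "?E l"] by blast
        then show ?thesis by linarith
      qed
      \<comment> \<open>Equal eigenvalues are counted by the dimension of one eigenspace, distinct
        ones by two terms of the sum.\<close>
      show False
      proof (cases "l = l'")
        case True
        have ind: "independent {u, u'}"
          using u u' by (intro pairwise_orthogonal_independent) (auto simp: pairwise_insert orthogonal_def inner_commute)
        have "u \<noteq> u'" using u u' by auto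
        then have "2 = card {u, u'}" by simp
        also have "\<dots> \<le> dim (?E l)"
          using ind u u' True by (intro independent_card_le_dim) auto
        also have "\<dots> \<le> (\<Sum>l\<in>?L. dim (?E l))"
          using u fin by (intro member_le_sum) auto
        finally show False using le by (simp add: num_pos_eigenvalues_def)
      next
        case False
        have "2 \<le> dim (?E l) + dim (?E l')"
          using dim1[of u l] dim1[of u' l'] u u' by simp
        also have "\<dots> = (\<Sum>l\<in>{l, l'}. dim (?E l))" using False by simp
        also have "\<dots> \<le> (\<Sum>l\<in>?L. dim (?E l))"
          using fin u u' by (intro sum_mono2) auto
        finally show False using le by (simp add: num_pos_eigenvalues_def)
      qed
    qed
  }
  {
    assume CS: "reverse_CS A"
    have no: False if "A *v x = l *\<^sub>R x" "A *v y = m *\<^sub>R y" "l > 0" "m > 0" "x \<bullet> y = 0" "x \<noteq> 0" "y \<noteq> 0" for x y l m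
    proof -
      have "x \<bullet> (A *v x) > 0" "y \<bullet> (A *v y) > 0" "x \<bullet> (A *v y) = 0" using that by auto
      with CS show False unfolding reverse_CS_def
        by (metis mult_pos_pos not_less power_zero_numeral)
    qed
    have dim1: "dim (?E l) \<le> 1" if "l > 0" for l
    proof (rule ccontr)
      assume d: "\<not> dim (?E l) \<le> 1"
      obtain B where B: "B \<subseteq> ?E l" "pairwise orthogonal B" "independent B" "card B = dim (?E l)"
        by (rule orthonormal_basis_subspace[OF subspace_eigenspace[of A l]]) (rule that)
      have "finite B" using B(4) d by (metis card.infinite le0)
      then obtain x y where xy: "x \<in> B" "y \<in> B" "x \<noteq> y"
        using d B(4) card_le_Suc0_iff_eq[of B] by auto
      then have "x \<bullet> y = 0" using B(2) by (auto simp: pairwise_def orthogonal_def)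
      moreover have "x \<noteq> 0" "y \<noteq> 0" using B(3) xy dependent_zero by blast+
      ultimately show False
        using B(1) xy that no[of x l y l] by blast
    qed
    have "l = m" if lm: "l \<in> ?L" "m \<in> ?L" for l m
    proof (rule ccontr)
      assume ne: "l \<noteq> m"
      obtain x y where "x \<noteq> 0" "A *v x = l *\<^sub>R x" "y \<noteq> 0" "A *v y = m *\<^sub>R y"
        using lm by blast
      with no[of x l y m] symmetric_eigenvectors_orthogonal[OF sym, of x l y m] ne lm show False
        by auto
    qed
    then have "card ?L \<le> 1" using fin by (simp add: card_le_Suc0_iff_eq)
    have "num_pos_eigenvalues A \<le> (\<Sum>l\<in>?L. 1)"
      unfolding num_pos_eigenvalues_def by (intro sum_mono dim1) auto
    also have "\<dots> \<le> 1" using \<open>card ?L \<le> 1\<close> by simp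
    finally show "num_pos_eigenvalues A \<le> 1" .
  }
qed

text \<open>A form that is nonpositive on a hyperplane leaves room for only one positive direction.
  Subtracting a multiple of \<open>x\<close> moves \<open>y\<close> into the hyperplane, and the
  resulting correction is a square.\<close>

lemma reverse_CS_hyperplane:
  fixes A :: "real^'n::finite^'n"
  assumes sym: "transpose A = A" and hyp: "\<And>z. r \<bullet> z = 0 \<Longrightarrow> z \<bullet> (A *v z) \<le> 0"
  shows "reverse_CS A"
  unfolding reverse_CS_def
proof (intro allI impI)
  fix x y assume Q: "x \<bullet> (A *v x) > 0"
  then have rx: "r \<bullet> x \<noteq> 0" using hyp[of x] by auto
  define c where "c = (r \<bullet> y) / (r \<bullet> x)"
  define z where "z = y - c *\<^sub>R x"
  have "r \<bullet> z = 0" using rx by (simp add: z_def c_def inner_diff_right)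
  then have "(x \<bullet> (A *v x)) * (z \<bullet> (A *v z)) \<le> 0"
    using hyp Q by (simp add: mult_nonneg_nonpos)
  moreover have "(x \<bullet> (A *v x)) * (z \<bullet> (A *v z)) =
     (x \<bullet> (A *v x)) * (y \<bullet> (A *v y)) - (x \<bullet> (A *v y))\<^sup>2 + (x \<bullet> (A *v y) - c * (x \<bullet> (A *v x)))\<^sup>2"
    using symmetric_form[OF sym, of y x] unfolding z_def
    by (simp add: algebra_simps inner_diff_left inner_diff_right matrix_vector_mult_diff_distrib
         matrix_vector_mult_scaleR power2_eq_square)
  ultimately show "(x \<bullet> (A *v x)) * (y \<bullet> (A *v y)) \<le> (x \<bullet> (A *v y))\<^sup>2"
    using zero_le_power2[of "x \<bullet> (A *v y) - c * (x \<bullet> (A *v x))"] by linarith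
qed

text \<open>
  Merging two points at minimal distance reduces the number of points: they have equal
  distances to all others.
\<close>

lemma ultrametric_conditionally_negative:
  fixes D :: "'a \<Rightarrow> 'a \<Rightarrow> real"
  assumes "finite N" "\<And>i j. D i j = D j i"
    and "\<And>i j l. \<lbrakk>i \<in> N; j \<in> N; l \<in> N; i \<noteq> j; i \<noteq> l; j \<noteq> l\<rbrakk> \<Longrightarrow> D i j \<le> max (D i l) (D j l)"
    and "\<And>i l. \<lbrakk>i \<in> N; l \<in> N\<rbrakk> \<Longrightarrow> D i i \<le> D i l"
    and "(\<Sum>i\<in>N. y i) = 0"
  shows "(\<Sum>i\<in>N. \<Sum>j\<in>N. D i j * y i * y j) \<le> 0"
  using assms
proof (induction "card N" arbitrary: N D y rule: less_induct)
  case less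
  note sym = less.prems(2) and um = less.prems(3) and diag = less.prems(4)
  show ?case
  proof (cases "card N \<le> 1")
    case True
    then consider "N = {}" | i where "N = {i}"
      using \<open>finite N\<close> by (metis One_nat_def card_0_eq card_1_singletonE le_Suc_eq le_zero_eq)
    then show ?thesis using less.prems(5) by cases auto
  next
    case False
    let ?P = "{(i, j). i \<in> N \<and> j \<in> N \<and> i \<noteq> j}"
    have "finite ?P" by (rule finite_subset[of _ "N \<times> N"]) (use \<open>finite N\<close> in auto)
    moreover have "?P \<noteq> {}"
      using False \<open>finite N\<close> card_le_Suc0_iff_eq[of N] by auto
    ultimately obtain p where p: "p \<in> ?P" and pmin: "\<And>q. q \<in> ?P \<Longrightarrow> D (fst p) (snd p) \<le> D (fst q) (snd q)"
      using arg_min_if_finite[of ?P "\<lambda>p. D (fst p) (snd p)"] by (metis (no_types, lifting) not_less)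
    obtain i j where ij: "i \<in> N" "j \<in> N" "i \<noteq> j" and p_eq: "p = (i, j)"
      using p by auto
    have mn: "D i j \<le> D k l" if "k \<in> N" "l \<in> N" "k \<noteq> l" for k l
      using pmin[of "(k, l)"] that p_eq by simp
    have eq: "D i l = D j l" if "l \<in> N" "l \<noteq> i" "l \<noteq> j" for l
      using um[of i l j] um[of j l i] mn[of j l] mn[of i l] ij that sym[of l j] sym[of l i] sym[of j i]
      by (simp add: max_def split: if_splits)
    define M where "M = N - {i, j}"
    have M: "finite M" "i \<notin> M" "j \<notin> M" "N = insert i (insert j M)" "N - {i} = insert j M"
      using ij \<open>finite N\<close> by (auto simp: M_def)
    \<comment> \<open>Point \<open>i\<close> is merged into \<open>j\<close>, which receives the sum
      of both weights. The diagonal entry of \<open>j\<close> is raised to the minimal distance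
      \<open>D i j\<close>; this can only increase the form and is still at most every distance from
      \<open>j\<close>.\<close>
    define D' where "D' = (\<lambda>k l. if k = j \<and> l = j then D i j else D k l)"
    define y' where "y' = (\<lambda>k. if k = j then y i + y j else y k)"
    have less': "card (N - {i}) < card N" using ij \<open>finite N\<close> by (intro psubset_card_mono) auto
    have IH: "(\<Sum>k\<in>N - {i}. \<Sum>l\<in>N - {i}. D' k l * y' k * y' l) \<le> 0"
    proof (rule less.hyps[OF less'])
      show "D' k l = D' l k" for k l using sym[of k l] by (auto simp: D'_def)
      show "D' k l \<le> max (D' k m) (D' l m)"
        if "k \<in> N - {i}" "l \<in> N - {i}" "m \<in> N - {i}" "k \<noteq> l" "k \<noteq> m" "l \<noteq> m" for k l m
        using um[of k l m] that by (auto simp: D'_def)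
      show "D' k k \<le> D' k l" if "k \<in> N - {i}" "l \<in> N - {i}" for k l
        using diag[of k l] mn[of k l] that by (auto simp: D'_def)
      have "(\<Sum>k\<in>N - {i}. y' k) = y i + y j + (\<Sum>k\<in>M. y k)"
        unfolding M(5) using M(1-3) by (simp add: y'_def) (intro sum.cong; auto simp: M_def)
      also have "\<dots> = 0" using less.prems(5) M(1-3) ij unfolding M(4) by simp
      finally show "(\<Sum>k\<in>N - {i}. y' k) = 0" .
    qed (use \<open>finite N\<close> in auto)
    have y'M: "y' k = y k" if "k \<in> M" for k using that M by (auto simp: y'_def)
    have D'M: "D' k l = D k l" if "k \<in> M \<or> l \<in> M" for k l using that M by (auto simp: D'_def)
    define R where "R = (\<Sum>k\<in>M. \<Sum>l\<in>M. D k l * y k * y l)"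
    define T where "T = (\<Sum>l\<in>M. D j l * y l)"
    have Ti: "(\<Sum>l\<in>M. D i l * y l) = T"
      unfolding T_def by (intro sum.cong) (auto simp: M_def eq)
    have "(\<Sum>k\<in>N - {i}. \<Sum>l\<in>N - {i}. D' k l * y' k * y' l)
        = D i j * (y i + y j)\<^sup>2 + 2 * (y i + y j) * T + R"
    proof -
      have 1: "(\<Sum>l\<in>M. D' j l * y' j * y' l) = (y i + y j) * T"
        unfolding T_def sum_distrib_left
      proof (intro sum.cong refl)
        fix l assume l: "l \<in> M"
        then have "l \<noteq> j" "y' l = y l" using M(3) y'M by auto
        then show "D' j l * y' j * y' l = (y i + y j) * (D j l * y l)"
          by (simp add: D'_def y'_def)
      qed
      have 2: "(\<Sum>k\<in>M. D' k j * y' k * y' j) = (y i + y j) * T"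
        unfolding T_def sum_distrib_left
      proof (intro sum.cong refl)
        fix l assume l: "l \<in> M"
        then have "l \<noteq> j" "y' l = y l" using M(3) y'M by auto
        then show "D' l j * y' l * y' j = (y i + y j) * (D j l * y l)"
          using sym[of l j] by (simp add: D'_def y'_def)
      qed
      have 3: "(\<Sum>k\<in>M. \<Sum>l\<in>M. D' k l * y' k * y' l) = R"
        unfolding R_def by (intro sum.cong refl) (simp add: D'M y'M)
      have 4: "D' j j * y' j * y' j = D i j * (y i + y j)\<^sup>2"
        by (simp add: D'_def y'_def power2_eq_square)
      show ?thesis
        unfolding M(5) using M(1-3) by (simp add: sum.distrib 1 2 3 4)
    qed
    moreover have "(\<Sum>k\<in>N. \<Sum>l\<in>N. D k l * y k * y l)
        = D i i * (y i)\<^sup>2 + D j j * (y j)\<^sup>2 + 2 * D i j * y i * y j + 2 * (y i + y j) * T + R"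
    proof -
      have 1: "(\<Sum>l\<in>M. D j l * y j * y l) = y j * T" "(\<Sum>k\<in>M. D k j * y k * y j) = y j * T"
        
        unfolding T_def sum_distrib_left by (rule sum.cong; use sym in simp)+
      have 2: "(\<Sum>l\<in>M. D i l * y i * y l) = y i * T" "(\<Sum>k\<in>M. D k i * y k * y i) = y i * T"
        
        unfolding Ti[symmetric] sum_distrib_left by (rule sum.cong; use sym in simp)+
      show ?thesis
        unfolding M(4) using M(1-3) ij(3) sym[of j i]
        by (simp add: sum.distrib 1 2 R_def[symmetric]) (simp add: power2_eq_square algebra_simps)
    qed
    moreover have "D i i * (y i)\<^sup>2 \<le> D i j * (y i)\<^sup>2" "D j j * (y j)\<^sup>2 \<le> D i j * (y j)\<^sup>2"
      using diag[of i j] diag[of j i] ij sym[of j i] by (auto intro: mult_right_mono)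
    ultimately show ?thesis using IH by (simp add: power2_eq_square algebra_simps)
  qed
qed

text \<open>Dividing by the row of a base point \<open>o'\<close> turns the four-point condition
  into the ultrametric inequality on the indices where that row is positive; the rows of the other
  indices are proportional to it. On the hyperplane orthogonal to this row only the ultrametric
  block remains.\<close>

lemma four_point_reverse_CS:
  fixes A :: "real^'n::finite^'n"
  assumes sym: "\<And>i j. A $ i $ j = A $ j $ i" and nonneg: "\<And>i j. 0 \<le> A $ i $ j"
    and fp: "\<And>i j k l. A $ i $ j * A $ k $ l \<le> max (A $ i $ k * A $ j $ l) (A $ i $ l * A $ j $ k)"
  shows "reverse_CS A"
proof (cases "\<exists>o'. \<exists>k. A $ o' $ k > 0")
  case False
  then have "A = 0" using nonneg by (simp add: vec_eq_iff not_less order_antisym)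
  then show ?thesis by (simp add: reverse_CS_def)
next
  case True
  then obtain o' k0 where k0: "A $ o' $ k0 > 0" by blast
  have tr: "transpose A = A" using sym by (simp add: transpose_def vec_eq_iff)
  let ?s = "\<lambda>i. A $ o' $ i"
  define N where "N = {i. ?s i > 0}"
  have s0: "?s i = 0" if "i \<notin> N" for i using that nonneg[of o' i] by (auto simp: N_def)
  \<comment> \<open>The four-point condition for \<open>o'\<close>, \<open>k0\<close>,
    \<open>i\<close>, \<open>j\<close> in two arrangements: since \<open>?s i\<close> vanishes, only
    one product survives on the right each time.\<close>
  have row: "A $ i $ j = A $ i $ k0 / ?s k0 * ?s j" if "i \<notin> N" for i j
  proof -
    have "?s k0 * A $ i $ j \<le> ?s j * A $ i $ k0"
      using fp[of o' k0 i j] s0[OF that] sym[of k0 i] nonneg[of o' j] nonneg[of i k0] by simp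
    moreover have "?s j * A $ i $ k0 \<le> ?s k0 * A $ i $ j"
      using fp[of o' j i k0] s0[OF that] sym[of j i] nonneg[of i j] k0 by simp
    ultimately show ?thesis using k0 by (simp add: field_simps)
  qed
  show ?thesis
  proof (rule reverse_CS_hyperplane[OF tr, of "A $ o'"])
    fix x :: "real^'n" assume "A $ o' \<bullet> x = 0"
    then have h: "(\<Sum>j\<in>UNIV. ?s j * x $ j) = 0" by (simp add: inner_vec_def)
    have Ax: "(\<Sum>j\<in>UNIV. A $ i $ j * x $ j) = 0" if "i \<notin> N" for i
    proof -
      have "(\<Sum>j\<in>UNIV. A $ i $ j * x $ j) = A $ i $ k0 / ?s k0 * (\<Sum>j\<in>UNIV. ?s j * x $ j)"
        unfolding sum_distrib_left by (intro sum.cong refl) (subst row[OF that], simp)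
      then show ?thesis using h by simp
    qed
    define D where "D = (\<lambda>i j. A $ i $ j / (?s i * ?s j))"
    define y where "y = (\<lambda>i. ?s i * x $ i)"
    have Nz: "(\<Sum>j\<in>N. A $ i $ j * x $ j) = - (\<Sum>j\<in>-N. A $ i $ j * x $ j) + (\<Sum>j\<in>UNIV. A $ i $ j * x $ j)" for i
      using sum.subset_diff[of N UNIV "\<lambda>j. A $ i $ j * x $ j"] by (simp add: Compl_eq_Diff_UNIV)
    have "x \<bullet> (A *v x) = (\<Sum>i\<in>UNIV. x $ i * (\<Sum>j\<in>UNIV. A $ i $ j * x $ j))"
      by (simp add: inner_vec_def matrix_vector_mult_def)
    also have "\<dots> = (\<Sum>i\<in>N. x $ i * (\<Sum>j\<in>UNIV. A $ i $ j * x $ j))"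
      by (rule sum.mono_neutral_right) (auto simp: Ax)
    also have "\<dots> = (\<Sum>i\<in>N. x $ i * (\<Sum>j\<in>N. A $ i $ j * x $ j)) + (\<Sum>i\<in>N. \<Sum>j\<in>-N. x $ i * A $ i $ j * x $ j)"
    proof -
      have "(\<Sum>j\<in>UNIV. A $ i $ j * x $ j) = (\<Sum>j\<in>N. A $ i $ j * x $ j) + (\<Sum>j\<in>-N. A $ i $ j * x $ j)" for i
        using Nz[of i] by simp
      then show ?thesis
        by (simp only: distrib_left sum.distrib sum_distrib_left mult.assoc)
    qed
    \<comment> \<open>Rows outside \<open>N\<close> annihilate \<open>x\<close>, and the block with
      both indices outside \<open>N\<close> is zero, so the mixed block contributes nothing.\<close>
    also have "(\<Sum>i\<in>N. \<Sum>j\<in>-N. x $ i * A $ i $ j * x $ j) = 0"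
    proof -
      have "(\<Sum>i\<in>N. \<Sum>j\<in>-N. x $ i * A $ i $ j * x $ j) = (\<Sum>j\<in>-N. x $ j * (\<Sum>i\<in>N. A $ j $ i * x $ i))"
        unfolding sum_distrib_left
      proof (subst sum.swap, intro sum.cong refl)
        show "x $ i * A $ i $ j * x $ j = x $ j * (A $ j $ i * x $ i)" for i j
          using sym[of i j] by simp
      qed
      also have "\<dots> = 0"
      proof (intro sum.neutral ballI)
        fix j assume j: "j \<in> -N"
        have "A $ j $ i = 0" if "i \<in> -N" for i
          using j that by (subst row) (simp_all add: s0)
        then have "(\<Sum>i\<in>-N. A $ j $ i * x $ i) = 0"
          by (intro sum.neutral ballI) simp
        with j show "x $ j * (\<Sum>i\<in>N. A $ j $ i * x $ i) = 0"
          using Nz[of j] Ax[of j] by simp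
      qed
      finally show ?thesis .
    qed
    also have "(\<Sum>i\<in>N. x $ i * (\<Sum>j\<in>N. A $ i $ j * x $ j)) + 0 = (\<Sum>i\<in>N. \<Sum>j\<in>N. D i j * y i * y j)"
      by (simp add: sum_distrib_left) (intro sum.cong refl, simp add: D_def y_def N_def)
    also have "\<dots> \<le> 0"
    proof (rule ultrametric_conditionally_negative)
      show "D i j = D j i" for i j using sym[of i j] by (simp add: D_def mult.commute)
      have um: "D i j \<le> max (D i l) (D j l)" if "i \<in> N" "j \<in> N" "l \<in> N" for i j l
      proof -
        have pos: "?s i > 0" "?s j > 0" "?s l > 0" using that by (auto simp: N_def)
        have "A $ i $ j * ?s l \<le> max (?s i * A $ j $ l) (?s j * A $ i $ l)"
          using fp[of i j o' l] sym by (simp add: mult.commute)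
        then show ?thesis using pos
          by (auto simp: D_def le_max_iff_disj field_simps)
      qed
      show "D i i \<le> D i l" if "i \<in> N" "l \<in> N" for i l
        using um[of i i l] that by simp
      show "D i j \<le> max (D i l) (D j l)" if "i \<in> N" "j \<in> N" "l \<in> N" for i j l
        using um that by blast
      have "(\<Sum>i\<in>UNIV. y i) = (\<Sum>i\<in>N. y i)"
        by (rule sum.mono_neutral_right) (auto simp: y_def s0)
      then show "(\<Sum>i\<in>N. y i) = 0" using h by (simp add: y_def)
    qed simp
    finally show "x \<bullet> (A *v x) \<le> 0" .
  qed
qed

text \<open>Positivity at \<open>x\<close> is an open condition, so it holds for all late
  \<open>A n\<close>, where the closed inequality is available.\<close>

lemma reverse_CS_limit:
  fixes A :: "nat \<Rightarrow> real^'n::finite^'n"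
  assumes "\<And>n. reverse_CS (A n)" and lim: "\<And>i j. (\<lambda>n. A n $ i $ j) \<longlonglongrightarrow> L $ i $ j"
  shows "reverse_CS L"
  unfolding reverse_CS_def
proof (intro allI impI)
  fix x y assume Q: "x \<bullet> (L *v x) > 0"
  have conv: "(\<lambda>n. z \<bullet> (A n *v w)) \<longlonglongrightarrow> z \<bullet> (L *v w)" for z w
    unfolding inner_vec_def matrix_vector_mult_def by (auto intro!: tendsto_intros lim)
  have "\<forall>\<^sub>F n in sequentially. x \<bullet> (A n *v x) > 0"
    using conv Q by (rule order_tendstoD)
  then have "\<forall>\<^sub>F n in sequentially. (x \<bullet> (A n *v x)) * (y \<bullet> (A n *v y)) \<le> (x \<bullet> (A n *v y))\<^sup>2"
    using assms(1) by (auto elim!: eventually_mono simp: reverse_CS_def)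
  then show "(x \<bullet> (L *v x)) * (y \<bullet> (L *v y)) \<le> (x \<bullet> (L *v y))\<^sup>2"
    by (rule tendsto_le[OF sequentially_bot _ _, rotated 2]) (auto intro!: tendsto_intros conv)
qed

lemma reverse_CS_congruence:
  fixes A B :: "real^'n::finite^'n"
  assumes "reverse_CS A" and B: "\<And>i j. B $ i $ j = c * t i * t j * A $ i $ j" and "c > 0"
  shows "reverse_CS B"
proof -
  have eq: "x \<bullet> (B *v y) = c * ((\<chi> i. t i * x $ i) \<bullet> (A *v (\<chi> i. t i * y $ i)))" for x y
    by (simp add: inner_vec_def matrix_vector_mult_def B sum_distrib_left algebra_simps)
  show ?thesis
    unfolding reverse_CS_def eq
  proof (intro allI impI)
    fix x y :: "real^'n"
    let ?x = "\<chi> i. t i * x $ i" and ?y = "\<chi> i. t i * y $ i"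
    assume "0 < c * (?x \<bullet> (A *v ?x))"
    then have "(?x \<bullet> (A *v ?x)) * (?y \<bullet> (A *v ?y)) \<le> (?x \<bullet> (A *v ?y))\<^sup>2"
      using assms(1) \<open>c > 0\<close> by (simp add: reverse_CS_def zero_less_mult_iff)
    then have "c\<^sup>2 * ((?x \<bullet> (A *v ?x)) * (?y \<bullet> (A *v ?y))) \<le> c\<^sup>2 * (?x \<bullet> (A *v ?y))\<^sup>2"
      by (rule mult_left_mono) simp
    then show "c * (?x \<bullet> (A *v ?x)) * (c * (?y \<bullet> (A *v ?y))) \<le> (c * (?x \<bullet> (A *v ?y)))\<^sup>2"
      by (simp add: power_mult_distrib power2_eq_square algebra_simps)
  qed
qed

section \<open>Three-term Pluecker inequality from the reversed Cauchy-Schwarz inequality\<close>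

lemma AM_GM_infimum:
  fixes p q :: real
  assumes "0 \<le> p" "0 \<le> q" "e > 0"
  obtains a where "a > 0" "a * p + q / a \<le> 2 * sqrt (p * q) + e"
proof -
  \<comment> \<open>The infimum over \<open>a\<close> is \<open>2 * sqrt (p * q)\<close>, but it is
    not attained when exactly one of \<open>p\<close> and \<open>q\<close> vanishes; the slack
    \<open>e\<close> covers these cases.\<close>
  consider "p = 0" | "q = 0" "p > 0" | "p > 0" "q > 0" using assms by linarith
  then show ?thesis
  proof cases
    case 1
    have "q / (q / e + 1) \<le> e" using assms by (simp add: field_simps)
    with 1 assms show ?thesis by (intro that[of "q / e + 1"]) (auto intro: add_nonneg_pos)
  next
    case 2
    with assms show ?thesis by (intro that[of "e / p"]) auto
  next
    case 3
    have "sqrt (q / p) * p + q / sqrt (q / p) = 2 * sqrt (p * q)"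
      using 3 by (simp add: real_sqrt_divide real_sqrt_mult field_simps)
    with 3 assms show ?thesis by (intro that[of "sqrt (q / p)"]) auto
  qed
qed

text \<open>This is the three-term relation over T_q at q = 2. The inequality is tested on vectors
  supported on {i, j} and on {k, l}; diagonal entries only enlarge the left side, and the scaling of
  the vectors is optimised by the inequality between arithmetic and geometric means.\<close>

lemma reverse_CS_plucker:
  fixes A :: "real^'n::finite^'n"
  assumes CS: "reverse_CS A" and sym: "\<And>i j. A $ i $ j = A $ j $ i" and nonneg: "\<And>i j. 0 \<le> A $ i $ j"
  shows "sqrt (A $ i $ j * A $ k $ l) \<le> sqrt (A $ i $ k * A $ j $ l) + sqrt (A $ i $ l * A $ j $ k)"
proof (rule field_le_epsilon)
  fix e :: real assume e: "e > 0"
  obtain a where a: "a > 0" "a * A $ i $ k + A $ j $ l / a \<le> 2 * sqrt (A $ i $ k * A $ j $ l) + e"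
    using AM_GM_infimum[OF nonneg nonneg e] .
  obtain b where b: "b > 0" "b * A $ i $ l + A $ j $ k / b \<le> 2 * sqrt (A $ i $ l * A $ j $ k) + e"
    using AM_GM_infimum[OF nonneg nonneg e] .
  \<comment> \<open>With \<open>s * s = a * b\<close> the mixed form has the coefficients a, b, 1/b,
    1/a at the entries ik, il, jk, jl, while the entries ij and kl get the coefficient 2 in the two
    quadratic forms.\<close>
  define s where "s = sqrt (a * b)"
  have s: "s > 0" "s * s = a * b" using a b by (auto simp: s_def)
  define x :: "real^'n" where "x = s *\<^sub>R axis i 1 + (1 / s) *\<^sub>R axis j 1"
  define y :: "real^'n" where "y = (a / s) *\<^sub>R axis k 1 + (b / s) *\<^sub>R axis l 1"
  have ax: "axis p 1 \<bullet> (A *v axis q 1) = A $ p $ q" for p q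
    by (simp add: inner_axis' matrix_vector_mult_basis column_def)
  have Qx: "x \<bullet> (A *v x) = s\<^sup>2 * A $ i $ i + 2 * A $ i $ j + (1 / s)\<^sup>2 * A $ j $ j"
  proof -
    have "s * (1 / s) = 1" using s by simp
    moreover have "x \<bullet> (A *v x) = s\<^sup>2 * A $ i $ i + 2 * (s * (1 / s)) * A $ i $ j + (1 / s)\<^sup>2 * A $ j $ j"
      using sym[of j i] unfolding x_def
      by (simp only: inner_add_left inner_add_right matrix_vector_right_distrib matrix_vector_mult_scaleR ax
        power2_eq_square inner_scaleR_left inner_scaleR_right) (simp add: algebra_simps)
    ultimately show ?thesis by simp
  qed
  have Qy: "y \<bullet> (A *v y) = (a / s)\<^sup>2 * A $ k $ k + 2 * A $ k $ l + (b / s)\<^sup>2 * A $ l $ l"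
  proof -
    have "a / s * (b / s) = 1" using s a b by (simp add: field_simps)
    moreover have "y \<bullet> (A *v y) = (a / s)\<^sup>2 * A $ k $ k + 2 * (a / s * (b / s)) * A $ k $ l + (b / s)\<^sup>2 * A $ l $ l"
      using sym[of l k] unfolding y_def
      by (simp add: inner_add_left inner_add_right matrix_vector_right_distrib matrix_vector_mult_scaleR ax
        power2_eq_square algebra_simps)
    ultimately show ?thesis by (simp only: mult_1_right)
  qed
  have Bxy: "x \<bullet> (A *v y) = (a * A $ i $ k + A $ j $ l / a) + (b * A $ i $ l + A $ j $ k / b)"
  proof -
    have "1 / s * (a / s) = 1 / b" "1 / s * (b / s) = 1 / a" using s a b by (auto simp: field_simps)
    moreover have "x \<bullet> (A *v y) = a * A $ i $ k + b * A $ i $ l + (1 / s * (a / s)) * A $ j $ k + (1 / s * (b / s)) * A $ j $ l"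
      using s unfolding x_def y_def
      by (simp add: inner_add_left inner_add_right matrix_vector_right_distrib matrix_vector_mult_scaleR ax
        algebra_simps)
    ultimately show ?thesis by simp
  qed
  have lx: "2 * A $ i $ j \<le> x \<bullet> (A *v x)" and ly: "2 * A $ k $ l \<le> y \<bullet> (A *v y)"
    unfolding Qx Qy using nonneg by auto
  let ?R = "sqrt (A $ i $ k * A $ j $ l) + sqrt (A $ i $ l * A $ j $ k)"
  have R: "?R \<ge> 0" using nonneg by simp
  have "4 * (A $ i $ j * A $ k $ l) \<le> (2 * (?R + e))\<^sup>2"
  proof (cases "A $ i $ j = 0")
    case False
    then have pos: "x \<bullet> (A *v x) > 0" using lx nonneg[of i j] by linarith
    have "(2 * A $ i $ j) * (2 * A $ k $ l) \<le> (x \<bullet> (A *v x)) * (y \<bullet> (A *v y))"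
      using lx ly nonneg[of i j] nonneg[of k l] pos by (intro mult_mono) auto
    also have "\<dots> \<le> (x \<bullet> (A *v y))\<^sup>2" using CS pos by (simp add: reverse_CS_def)
    also have "\<dots> \<le> (2 * (?R + e))\<^sup>2"
      unfolding Bxy using a b nonneg by (intro power_mono) auto
    finally show ?thesis by simp
  qed (simp)
  then have "A $ i $ j * A $ k $ l \<le> (?R + e)\<^sup>2" unfolding power_mult_distrib by simp
  then show "sqrt (A $ i $ j * A $ k $ l) \<le> ?R + e"
    using R e by (intro real_le_lsqrt) auto
qed

section \<open>Exponent vectors\<close>

text \<open>This rule would rewrite the \<open>1\<close> hidden in \<open>evec\<close>.\<close>
declare One_nat_def [simp del]

lemma degree_vec_add [simp]: "degree_vec (\<alpha> + \<beta>) = degree_vec \<alpha> + degree_vec \<beta>"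
  by (simp add: degree_vec_def sum.distrib)

lemma degree_vec_evec [simp]: "degree_vec (evec i) = 1"
  by (simp add: degree_vec_def axis_def)

lemma inj_real_vec [simp]: "inj real_vec"
  by (auto simp: inj_on_def real_vec_def vec_eq_iff)

lemma real_vec_add: "real_vec (\<alpha> + \<beta>) = real_vec \<alpha> + real_vec \<beta>"
  by (simp add: real_vec_def vec_eq_iff)

lemma real_vec_swap:
  assumes "\<alpha> $ l > 0 \<or> k = l"
  shows "real_vec (\<alpha> + evec k - evec l) = real_vec \<alpha> + axis k 1 - axis l 1"
  using assms by (auto simp: real_vec_def vec_eq_iff axis_def)

lemma real_vec_swap_sum:
  assumes "\<alpha> $ l > 0" "\<beta> $ k > 0"
  shows "real_vec (\<alpha> + evec k - evec l) + real_vec (\<beta> + evec l - evec k) = real_vec \<alpha> + real_vec \<beta>"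
  using assms by (simp add: real_vec_swap)

section \<open>Local exchange\<close>

text \<open>The exchange inequality of an M-convex function, demanded only for pairs whose
  difference is e_i + e_j - e_k - e_l; \<open>i = j\<close> and \<open>k = l\<close> are
  allowed.\<close>

definition local_exchange :: "(nat^'n::finite) set \<Rightarrow> (nat^'n \<Rightarrow> real) \<Rightarrow> bool" where
  "local_exchange J w \<longleftrightarrow> (\<forall>\<alpha> i j k l. i \<noteq> k \<and> i \<noteq> l \<and> j \<noteq> k \<and> j \<noteq> l \<and>
     \<alpha> + evec i + evec j \<in> J \<and> \<alpha> + evec k + evec l \<in> J \<longrightarrow>
     (\<alpha> + evec i + evec k \<in> J \<and> \<alpha> + evec j + evec l \<in> J \<and>
        w (\<alpha> + evec i + evec j) + w (\<alpha> + evec k + evec l) \<ge> w (\<alpha> + evec i + evec k) + w (\<alpha> + evec j + evec l)) \<or>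
     (\<alpha> + evec i + evec l \<in> J \<and> \<alpha> + evec j + evec k \<in> J \<and>
        w (\<alpha> + evec i + evec j) + w (\<alpha> + evec k + evec l) \<ge> w (\<alpha> + evec i + evec l) + w (\<alpha> + evec j + evec k)))"

text \<open>Subtraction is truncated, so for vectors of equal degree this is half of the
  l1-distance.\<close>

definition excess :: "nat^'n::finite \<Rightarrow> nat^'n \<Rightarrow> nat" where
  "excess x y = degree_vec (x - y)"

lemma excess_swap:
  assumes "y $ u < x $ u" "x $ v < y $ v"
  shows "excess x (y + evec u - evec v) < excess x y"
proof -
  have "(x - (y + evec u - evec v)) $ i \<le> (x - y) $ i" for i
    using assms by (auto simp: axis_def)
  moreover have "(x - (y + evec u - evec v)) $ u < (x - y) $ u"
    using assms by (auto simp: axis_def)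
  ultimately show ?thesis
    unfolding excess_def degree_vec_def by (intro sum_strict_mono_ex1) (simp, blast+)
qed

text \<open>
  Murota's argument: in a counterexample \<open>x\<close>, \<open>y\<close>, \<open>a\<close> at minimal distance, a linear price \<open>p\<close> makes every exchange \<open>x - a + v\<close> free and every exchange
  \<open>y + a - v\<close> strictly costly; moving \<open>y\<close> towards \<open>x\<close> in the cheapest way then contradicts the
  local exchange property.
\<close>

lemma local_exchange_imp_M_convex_fun:
  assumes J: "J \<subseteq> Delta d" "M_convex J" and loc: "local_exchange J w"
  shows "M_convex_fun J w"
proof -
  have "\<exists>v. x $ v < y $ v \<and> x + evec v - evec a \<in> J \<and> y + evec a - evec v \<in> J \<and>
          w x + w y \<ge> w (x + evec v - evec a) + w (y + evec a - evec v)"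
    if "x \<in> J" "y \<in> J" "x $ a > y $ a" for x y a
    using that
  proof (induction "excess x y" arbitrary: x y rule: less_induct)
    case less
    note xJ = less.prems(1) and yJ = less.prems(2) and a = less.prems(3)
    show ?case
    proof (rule ccontr)
      assume no: "\<not> ?case"
      have exch: "\<exists>v. x $ v < y $ v \<and> x + evec v - evec u \<in> J \<and> y + evec u - evec v \<in> J"
        if "x $ u > y $ u" for u
        using J(2) xJ yJ that unfolding M_convex_def by blast
      have fail: "w x + w y < w (x + evec v - evec a) + w (y + evec a - evec v)"
        if "x $ v < y $ v" "x + evec v - evec a \<in> J" "y + evec a - evec v \<in> J" for v
        using no that by fastforce
      \<comment> \<open>A move of \<open>y\<close> towards \<open>x\<close> that leaves coordinate
        \<open>a\<close> in surplus, so that the induction hypothesis still applies to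
        \<open>a\<close>. If there is none, \<open>x\<close> and \<open>y\<close> differ by a single
        exchange, which merely swaps them and cannot fail.\<close>
      have ex_u: "\<exists>u. y $ u < x $ u \<and> (y + evec u) $ a < x $ a"
      proof (rule ccontr)
        assume non: "\<not> ?thesis"
        then have x_a: "x $ a = y $ a + 1" using a by (force simp: axis_def)
        have x_le: "x $ u \<le> y $ u" if "u \<noteq> a" for u
          using non a that by (auto simp: axis_def not_less split: if_splits)
        obtain v where v: "x $ v < y $ v" "x + evec v - evec a \<in> J" "y + evec a - evec v \<in> J"
          using exch[OF a] by blast
        have va: "v \<noteq> a" using v a by auto
        define z where "z = y + evec a - evec v"
        have le: "x $ i \<le> z $ i" for i
          using x_a x_le[of i] v va by (auto simp: z_def axis_def)
        moreover have "(\<Sum>i\<in>UNIV. x $ i) = (\<Sum>i\<in>UNIV. z $ i)"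
          using J(1) xJ v(3) by (auto simp: z_def Delta_def degree_vec_def subset_iff)
        ultimately have "x $ i = z $ i" for i
          using sum_mono_inv[of "\<lambda>i. x $ i" UNIV "\<lambda>i. z $ i" i] by auto
        then have xz: "x = y + evec a - evec v" by (simp add: z_def vec_eq_iff)
        have "x + evec v - evec a = y"
          using v(1) va by (subst xz) (auto simp: vec_eq_iff axis_def xz)
        then show False using fail[OF v] xz by simp
      qed
      \<comment> \<open>The price of \<open>v\<close> is fixed from the side of \<open>x\<close> if
        that exchange stays in \<open>J\<close>. Otherwise only the exchange at \<open>y\<close>
        restricts it, and the summand 1 makes that exchange strictly costly.\<close>
      define p where "p = (\<lambda>v. if \<not> x $ v < y $ v then 0
         else if x + evec v - evec a \<in> J then w x - w (x + evec v - evec a)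
         else w (y + evec a - evec v) - w y - 1)"
      define f where "f = (\<lambda>z. w z + (\<Sum>i\<in>UNIV. p i * real (z $ i)))"
      have f_swap: "f (z + evec k - evec l) = w (z + evec k - evec l) + (f z - w z) + p k - p l"
        if "z $ l > 0" for z k l
      proof -
        have "p i * real ((z + evec k - evec l) $ i) = p i * real (z $ i) + (if i = k then p k else 0) - (if i = l then p l else 0)" for i
          using that by (auto simp: axis_def of_nat_diff algebra_simps)
        then show ?thesis by (simp add: f_def sum.distrib sum_subtractf)
      qed
      have pa: "p a = 0" using a by (simp add: p_def)
      have fx: "f (x + evec v - evec a) = f x" if "x $ v < y $ v" "x + evec v - evec a \<in> J" for v
        using that a by (subst f_swap) (auto simp: pa, simp add: p_def)
      have fy: "f y < f (y + evec a - evec v)" if v: "x $ v < y $ v" "y + evec a - evec v \<in> J" for v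
      proof -
        have "f (y + evec a - evec v) = w (y + evec a - evec v) + (f y - w y) - p v"
          using v by (subst f_swap) (auto simp: pa)
        moreover have "p v < w (y + evec a - evec v) - w y"
          using v fail[of v] by (auto simp: p_def)
        ultimately show ?thesis by simp
      qed
      obtain u where u: "y $ u < x $ u" "(y + evec u) $ a < x $ a" using ex_u by blast
      let ?V = "{v. x $ v < y $ v \<and> y + evec u - evec v \<in> J}"
      have "?V \<noteq> {}" using exch[OF u(1)] by blast
      then obtain v0 where v0: "v0 \<in> ?V" and min: "\<And>v. v \<in> ?V \<Longrightarrow> f (y + evec u - evec v0) \<le> f (y + evec u - evec v)"
        using ex_is_arg_min_if_finite[of ?V "\<lambda>v. f (y + evec u - evec v)"] by (auto simp: is_arg_min_linorder)
      define y' where "y' = y + evec u - evec v0"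
      have uv0: "u \<noteq> v0" using u v0 by auto
      have y'J: "y' \<in> J" using v0 by (simp add: y'_def)
      have "excess x y' < excess x y"
        unfolding y'_def using u v0 by (intro excess_swap) auto
      moreover have y'a: "y' $ a < x $ a" using u v0 a by (auto simp: y'_def axis_def split: if_splits)
      ultimately obtain v where v: "x $ v < y' $ v" "x + evec v - evec a \<in> J" "y' + evec a - evec v \<in> J"
          "w x + w y' \<ge> w (x + evec v - evec a) + w (y' + evec a - evec v)"
        using less.hyps[of x y'] xJ y'J by blast
      define y'' where "y'' = y' + evec a - evec v"
      \<comment> \<open>If \<open>v = v0\<close>, this coordinate is reduced twice; the bound
        \<open>1 < y $ v\<close> keeps the truncated subtraction in \<open>\<alpha>\<close>
        exact.\<close>
      have vy: "x $ v < y $ v" "v = v0 \<Longrightarrow> 1 < y $ v"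
        using v(1) u v0 uv0 by (auto simp: y'_def axis_def split: if_splits)
      have va: "v \<noteq> a" "v \<noteq> u" "v0 \<noteq> a" using vy a u v0 by auto
      have "f (x + evec v - evec a) + f y'' \<le> f x + f y'"
        using v(1,4) a unfolding y''_def by (subst (1 2) f_swap) (auto simp: pa)
      then have f'': "f y'' \<le> f y'" using fx[OF vy(1) v(2)] by simp
      define \<alpha> where "\<alpha> = y - evec v0 - evec v"
      have y_eq: "y = \<alpha> + evec v0 + evec v" and y''_eq: "y'' = \<alpha> + evec u + evec a"
        and eqs: "\<alpha> + evec v0 + evec u = y + evec u - evec v" "\<alpha> + evec v + evec a = y + evec a - evec v0"
          "\<alpha> + evec v0 + evec a = y + evec a - evec v" "\<alpha> + evec v + evec u = y'"
        using vy v0 va uv0 by (auto simp: \<alpha>_def y''_def y'_def vec_eq_iff axis_def)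
      have f_add: "f z1 + f z2 - (w z1 + w z2) = f z3 + f z4 - (w z3 + w z4)" if "z1 + z2 = z3 + z4" for z1 z2 z3 z4
      proof -
        have "real (z1 $ i) + real (z2 $ i) = real (z3 $ i) + real (z4 $ i)" for i
          using that by (metis of_nat_add vector_add_component)
        then have "(\<Sum>i\<in>UNIV. p i * (real (z1 $ i) + real (z2 $ i))) = (\<Sum>i\<in>UNIV. p i * (real (z3 $ i) + real (z4 $ i)))"
          by simp
        then show ?thesis by (simp add: f_def distrib_left sum.distrib)
      qed
      have "y \<in> J" "y'' \<in> J" using yJ v(3) by (auto simp: y''_def)
      \<comment> \<open>Local exchange replaces \<open>y\<close> and \<open>y''\<close> by one of
        two pairs. In both, one member costs at least \<open>f y'\<close> and the other more than
        \<open>f y\<close>, which contradicts \<open>f y'' \<le> f y'\<close>.\<close>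
      then consider
        "\<alpha> + evec v0 + evec u \<in> J" "\<alpha> + evec v + evec a \<in> J" "w y + w y'' \<ge> w (\<alpha> + evec v0 + evec u) + w (\<alpha> + evec v + evec a)"
      | "\<alpha> + evec v0 + evec a \<in> J" "\<alpha> + evec v + evec u \<in> J" "w y + w y'' \<ge> w (\<alpha> + evec v0 + evec a) + w (\<alpha> + evec v + evec u)"
        using loc va uv0 unfolding local_exchange_def y_eq y''_eq by metis
      then show False
      proof cases
        case 1
        have "f y + f y'' \<ge> f (\<alpha> + evec v0 + evec u) + f (\<alpha> + evec v + evec a)"
          using 1(3) f_add[of y y'' "\<alpha> + evec v0 + evec u" "\<alpha> + evec v + evec a"]
          by (simp add: y_eq y''_eq algebra_simps)
        moreover have "f y' \<le> f (\<alpha> + evec v0 + evec u)"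
          using min[of v] 1(1) vy(1) unfolding y'_def eqs(1) by auto
        moreover have "f y < f (\<alpha> + evec v + evec a)"
          using fy[of v0] 1(2) v0 unfolding eqs(2) by auto
        ultimately show False using f'' by linarith
      next
        case 2
        have "f y + f y'' \<ge> f (\<alpha> + evec v0 + evec a) + f (\<alpha> + evec v + evec u)"
          using 2(3) f_add[of y y'' "\<alpha> + evec v0 + evec a" "\<alpha> + evec v + evec u"]
          by (simp add: y_eq y''_eq algebra_simps)
        moreover have "f y < f (\<alpha> + evec v0 + evec a)"
          using fy[of v] 2(1) vy unfolding eqs(3) by auto
        ultimately show False using f'' eqs(4) by simp
      qed
    qed
  qed
  then show ?thesis unfolding M_convex_fun_def by blast
qed

lemma convex_hull_image_combination:
  assumes "finite T" "inj_on g T" "x \<in> convex hull (g ` T)"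
  obtains u where "\<And>t. t \<in> T \<Longrightarrow> 0 \<le> u t" "sum u T = 1" "(\<Sum>t\<in>T. u t *\<^sub>R g t) = x"
proof -
  obtain u where "\<forall>y\<in>g ` T. 0 \<le> u y" "sum u (g ` T) = 1" "(\<Sum>y\<in>g ` T. u y *\<^sub>R y) = x"
    using assms by (auto simp: convex_hull_finite)
  with assms that[of "u \<circ> g"] show thesis by (simp add: sum.reindex)
qed

section \<open>Lattice points of M-convex sets\<close>

text \<open>\<open>Y\<close> names the supports of limits through the lattice points of cells, so
  these must give back the contact sets. If a lattice point \<open>x\<close> of the hull were
  missing from \<open>T\<close>, a convex representation of \<open>x\<close> with minimal mean
  squared distance to \<open>x\<close> could be improved by an exchange between two points on
  opposite sides of \<open>x\<close>.\<close>

lemma M_convex_lattice_points: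
  assumes T: "finite T" "M_convex T"
  shows "lattice_points (convex hull (real_vec ` T)) = T"
proof
  show "T \<subseteq> lattice_points (convex hull (real_vec ` T))"
    by (auto simp: lattice_points_def hull_inc)
  show "lattice_points (convex hull (real_vec ` T)) \<subseteq> T"
  proof
    fix x assume "x \<in> lattice_points (convex hull (real_vec ` T))"
    then have x: "real_vec x \<in> convex hull (real_vec ` T)" by (simp add: lattice_points_def)
    define N where "N = (\<lambda>\<beta>. (norm (real_vec \<beta> - real_vec x))\<^sup>2)"
    let ?Q = "convex hull ((\<lambda>\<beta>. (real_vec \<beta>, N \<beta>)) ` T)"
    let ?F = "?Q \<inter> {z. fst z = real_vec x}"
    have cQ: "compact ?Q" using T by (simp add: finite_imp_compact compact_convex_hull)
    have "closed {z :: (real^'a) \<times> real. fst z = real_vec x}"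
      by (intro closed_Collect_eq continuous_intros)
    then have "compact ?F" using cQ by (rule compact_Int_closed[rotated])
    moreover have "?F \<noteq> {}"
    proof -
      have "convex hull (real_vec ` T) = fst ` ?Q"
        using convex_hull_linear_image[OF linear_fst, of "(\<lambda>\<beta>. (real_vec \<beta>, N \<beta>)) ` T"]
        by (simp add: image_image)
      then show ?thesis using x by (auto simp: image_iff)
    qed
    ultimately obtain z where z: "z \<in> ?F" and zmin: "\<And>z'. z' \<in> ?F \<Longrightarrow> snd z \<le> snd z'"
      using continuous_attains_inf[of ?F snd] continuous_on_snd[OF continuous_on_id, of ?F] by blast
    have "z \<in> ?Q" using z by blast
    then obtain u where u0: "\<And>\<beta>. \<beta> \<in> T \<Longrightarrow> 0 \<le> u \<beta>" and u1: "sum u T = 1"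
        and uz: "(\<Sum>\<beta>\<in>T. u \<beta> *\<^sub>R (real_vec \<beta>, N \<beta>)) = z"
      by (rule convex_hull_image_combination[OF T(1), rotated])
        (auto simp: inj_on_def real_vec_def vec_eq_iff)
    have ux: "(\<Sum>\<beta>\<in>T. u \<beta> *\<^sub>R real_vec \<beta>) = real_vec x"
      using z uz by (auto simp: fst_sum dest!: arg_cong[of _ z fst])
    have uN: "(\<Sum>\<beta>\<in>T. u \<beta> * N \<beta>) = snd z"
      using uz by (auto simp: snd_sum dest!: arg_cong[of _ z snd])
    have ge: "snd z \<le> (\<Sum>\<beta>\<in>T. u' \<beta> * N \<beta>)"
      if "\<And>\<beta>. \<beta> \<in> T \<Longrightarrow> 0 \<le> u' \<beta>" "sum u' T = 1" "(\<Sum>\<beta>\<in>T. u' \<beta> *\<^sub>R real_vec \<beta>) = real_vec x" for u'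
    proof -
      have "(\<Sum>\<beta>\<in>T. u' \<beta> *\<^sub>R (real_vec \<beta>, N \<beta>)) \<in> ?Q"
        using that T(1) by (intro convex_sum[OF _ convex_convex_hull]) (auto intro: hull_inc)
      moreover have "(\<Sum>\<beta>\<in>T. u' \<beta> *\<^sub>R (real_vec \<beta>, N \<beta>)) = (real_vec x, \<Sum>\<beta>\<in>T. u' \<beta> * N \<beta>)"
        using that(3) by (simp add: prod_eq_iff fst_sum snd_sum)
      ultimately show ?thesis using zmin[of "(real_vec x, \<Sum>\<beta>\<in>T. u' \<beta> * N \<beta>)"] by simp
    qed
    have coord: "(\<Sum>\<beta>\<in>T. u \<beta> * (real (\<beta> $ i) - real (x $ i))) = 0" for i
    proof -
      have "(\<Sum>\<beta>\<in>T. u \<beta> * real (\<beta> $ i)) = real (x $ i)"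
        using arg_cong[OF ux, of "\<lambda>v. v $ i"] by (simp add: real_vec_def)
      then show ?thesis using u1 by (simp add: right_diff_distrib sum_subtractf flip: sum_distrib_right)
    qed
    show "x \<in> T"
    proof (rule ccontr)
      assume "x \<notin> T"
      obtain \<alpha> where \<alpha>: "\<alpha> \<in> T" "u \<alpha> > 0"
        using u0 u1 by (metis less_eq_real_def sum.neutral zero_neq_one)
      then have "\<alpha> \<noteq> x" using \<open>x \<notin> T\<close> by auto
      then obtain i where i: "\<alpha> $ i \<noteq> x $ i" by (auto simp: vec_eq_iff)
      \<comment> \<open>Coordinate \<open>i\<close> has mean \<open>x $ i\<close>, so a point on one
        side is balanced by one on the other; \<open>s\<close> encodes the side.\<close>
      have opp: "\<exists>\<beta>\<in>T. u \<beta> > 0 \<and> s * (real (\<beta> $ i) - real (x $ i)) < 0"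
        if "s * (real (\<alpha> $ i) - real (x $ i)) > 0" for s
      proof (rule ccontr)
        assume neg: "\<not> ?thesis"
        have nn: "0 \<le> u \<beta> * (s * (real (\<beta> $ i) - real (x $ i)))" if "\<beta> \<in> T" for \<beta>
        proof (cases "u \<beta> = 0")
          case False
          then have "u \<beta> > 0" using u0[OF that] by simp
          with neg that show ?thesis by (meson less_imp_le mult_nonneg_nonneg not_less)
        qed simp
        have "(\<Sum>\<beta>\<in>T. u \<beta> * (s * (real (\<beta> $ i) - real (x $ i)))) = 0"
          using coord[of i] by (simp add: mult.left_commute flip: sum_distrib_left)
        then have "u \<alpha> * (s * (real (\<alpha> $ i) - real (x $ i))) = 0"
          using sum_nonneg_eq_0_iff[of T "\<lambda>\<beta>. u \<beta> * (s * (real (\<beta> $ i) - real (x $ i)))"] T(1) nn \<alpha>(1) by blast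
        then show False using that \<alpha>(2) by (metis mult_pos_pos order_less_irrefl)
      qed
      have "\<exists>\<alpha>\<in>T. \<exists>\<beta>\<in>T. 0 < u \<alpha> \<and> 0 < u \<beta> \<and> \<alpha> $ i < x $ i \<and> x $ i < \<beta> $ i"
      proof (cases "\<alpha> $ i < x $ i")
        case True
        then obtain \<beta> where "\<beta> \<in> T" "u \<beta> > 0" "- 1 * (real (\<beta> $ i) - real (x $ i)) < 0"
          using opp[of "- 1"] by auto
        with True \<alpha> show ?thesis by (intro bexI[of _ \<alpha>] bexI[of _ \<beta>]) auto
      next
        case False
        then obtain \<beta> where "\<beta> \<in> T" "u \<beta> > 0" "1 * (real (\<beta> $ i) - real (x $ i)) < 0"
          using i opp[of 1] by auto
        with False i \<alpha> show ?thesis by (intro bexI[of _ \<beta>] bexI[of _ \<alpha>]) auto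
      qed
      then obtain \<alpha> \<beta> where ab: "\<alpha> \<in> T" "u \<alpha> > 0" "\<beta> \<in> T" "u \<beta> > 0" "\<alpha> $ i < x $ i" "x $ i < \<beta> $ i"
        by blast
      then obtain j where j: "\<alpha> $ j > \<beta> $ j" "\<alpha> + evec i - evec j \<in> T" "\<beta> + evec j - evec i \<in> T"
        using T(2) order_less_trans[OF ab(5,6)] unfolding M_convex_def by blast
      define \<alpha>' \<beta>' where "\<alpha>' = \<alpha> + evec i - evec j" and "\<beta>' = \<beta> + evec j - evec i"
      define e where "e = min (u \<alpha>) (u \<beta>)"
      have e: "e > 0" using ab by (simp add: e_def)
      have ij: "i \<noteq> j" using ab j by auto
      have ne: "\<alpha> \<noteq> \<beta>" "\<alpha> \<noteq> \<alpha>'" "\<beta> \<noteq> \<beta>'"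
      proof -
        show "\<alpha> \<noteq> \<beta>" using ab by auto
        have "\<alpha>' $ i = \<alpha> $ i + 1" "\<beta>' $ j = \<beta> $ j + 1"
          using ij by (auto simp: \<alpha>'_def \<beta>'_def axis_def)
        then show "\<alpha> \<noteq> \<alpha>'" "\<beta> \<noteq> \<beta>'" by (metis add_cancel_left_right zero_neq_one)+
      qed
      \<comment> \<open>Mass \<open>e\<close> moves from \<alpha> and \<beta> to the exchanged pair.
        The pair has the same sum, so mean and total mass are unchanged.\<close>
      define u' where "u' = (\<lambda>\<gamma>. u \<gamma> - (if \<gamma> = \<alpha> then e else 0) - (if \<gamma> = \<beta> then e else 0)
           + (if \<gamma> = \<alpha>' then e else 0) + (if \<gamma> = \<beta>' then e else 0))"
      have sum_u': "(\<Sum>\<gamma>\<in>T. u' \<gamma> * g \<gamma>) = (\<Sum>\<gamma>\<in>T. u \<gamma> * g \<gamma>) + e * (g \<alpha>' + g \<beta>' - g \<alpha> - g \<beta>)" for g :: "nat^'a \<Rightarrow> real"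
      proof -
        have eq: "u' \<gamma> * g \<gamma> = u \<gamma> * g \<gamma> - (if \<gamma> = \<alpha> then e * g \<alpha> else 0) - (if \<gamma> = \<beta> then e * g \<beta> else 0)
           + (if \<gamma> = \<alpha>' then e * g \<alpha>' else 0) + (if \<gamma> = \<beta>' then e * g \<beta>' else 0)" for \<gamma>
          by (simp add: u'_def algebra_simps)
        show ?thesis
          unfolding eq using T(1) ab j by (simp add: sum.distrib sum_subtractf \<alpha>'_def \<beta>'_def algebra_simps)
      qed
      have "snd z \<le> (\<Sum>\<gamma>\<in>T. u' \<gamma> * N \<gamma>)"
      proof (rule ge)
        show "0 \<le> u' \<gamma>" if "\<gamma> \<in> T" for \<gamma>
          using u0[OF that] e ne by (auto simp: u'_def e_def)
        show "sum u' T = 1" using sum_u'[of "\<lambda>_. 1"] u1 by simp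
        show "(\<Sum>\<gamma>\<in>T. u' \<gamma> *\<^sub>R real_vec \<gamma>) = real_vec x"
        proof (subst vec_eq_iff, intro allI)
          fix k
          have "real (\<alpha>' $ k) + real (\<beta>' $ k) - real (\<alpha> $ k) - real (\<beta> $ k) = 0"
            using ab j ij by (auto simp: \<alpha>'_def \<beta>'_def axis_def)
          then show "(\<Sum>\<gamma>\<in>T. u' \<gamma> *\<^sub>R real_vec \<gamma>) $ k = real_vec x $ k"
            using sum_u'[of "\<lambda>\<gamma>. real (\<gamma> $ k)"] arg_cong[OF ux, of "\<lambda>v. v $ k"]
            by (simp add: real_vec_def)
        qed
      qed
      \<comment> \<open>The coordinates at \<open>i\<close> differ by at least 2, with
        \<open>x $ i\<close> strictly between them, and those at \<open>j\<close> by at least 1.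
        Hence the change is at most 2 (-3) + 4 = -2.\<close>
      moreover have "N \<alpha>' + N \<beta>' - N \<alpha> - N \<beta> < 0"
      proof -
        let ?a = "real_vec \<alpha> - real_vec x" and ?b = "real_vec \<beta> - real_vec x"
        have a': "real_vec \<alpha>' - real_vec x = ?a + (axis i 1 - axis j 1)"
          unfolding \<alpha>'_def using j by (subst real_vec_swap) auto
        have b': "real_vec \<beta>' - real_vec x = ?b - (axis i 1 - axis j 1)"
          unfolding \<beta>'_def using ab by (subst real_vec_swap) auto
        have "N \<alpha>' + N \<beta>' - N \<alpha> - N \<beta> = 2 * ((?a - ?b) \<bullet> (axis i 1 - axis j 1)) + 2 * (norm (axis i 1 - axis j 1 :: real^'a))\<^sup>2"
          unfolding N_def a' b' by (simp add: power2_norm_eq_inner inner_add_left inner_add_right inner_diff_left inner_diff_right inner_commute)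
        moreover have "(?a - ?b) \<bullet> (axis i 1 - axis j 1) = (real (\<alpha> $ i) - real (\<beta> $ i)) - (real (\<alpha> $ j) - real (\<beta> $ j))"
          by (simp add: inner_diff_right inner_axis real_vec_def)
        moreover have "(norm (axis i 1 - axis j 1 :: real^'a))\<^sup>2 = 2"
          using ij by (simp add: power2_norm_eq_inner inner_diff_left inner_diff_right inner_axis_axis)
        ultimately show ?thesis using ab j by simp
      qed
      ultimately show False
        using sum_u'[of N] uN e mult_pos_neg[of e "N \<alpha>' + N \<beta>' - N \<alpha> - N \<beta>"] by simp
    qed
  qed
qed

section \<open>Cells\<close>

definition is_cell :: "(nat^'n::finite) set \<Rightarrow> (nat^'n \<Rightarrow> real) \<Rightarrow> real^'n \<Rightarrow> real \<Rightarrow> (nat^'n) set \<Rightarrow> bool" where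
  "is_cell J w a c T \<longleftrightarrow> (\<forall>\<alpha>\<in>J. a \<bullet> real_vec \<alpha> + c \<le> w \<alpha>) \<and> T = {\<alpha>\<in>J. a \<bullet> real_vec \<alpha> + c = w \<alpha>}"

text \<open>These turn out to be the maximal cells
  (\<open>maximal_cells_regular_subdivision\<close>). The criterion looks at one cell only, and it
  makes the contact set determine the affine function on all of \<open>J\<close>.\<close>

definition spanning_cell :: "(nat^'n::finite) set \<Rightarrow> (nat^'n \<Rightarrow> real) \<Rightarrow> real^'n \<Rightarrow> real \<Rightarrow> (nat^'n) set \<Rightarrow> bool" where
  "spanning_cell J w a c T \<longleftrightarrow> is_cell J w a c T \<and> real_vec ` J \<subseteq> affine hull (real_vec ` T)"

lemma affine_functional_hull:
  fixes a :: "real^'n::finite"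
  assumes "x \<in> affine hull S" "\<And>s. s \<in> S \<Longrightarrow> a \<bullet> s + c = a' \<bullet> s + c'"
  shows "a \<bullet> x + c = a' \<bullet> x + c'"
proof -
  have "affine {x. (a - a') \<bullet> x = c' - c}" by (rule affine_hyperplane)
  moreover have "S \<subseteq> {x. (a - a') \<bullet> x = c' - c}"
    using assms(2) by (auto simp: inner_diff_left algebra_simps)
  ultimately have "affine hull S \<subseteq> {x. (a - a') \<bullet> x = c' - c}" by (simp add: hull_minimal)
  with assms(1) show ?thesis by (auto simp: inner_diff_left algebra_simps)
qed

lemma affine_functional_separates:
  fixes x :: "real^'n::finite"
  assumes "x \<notin> affine hull S"
  obtains a c where "\<And>s. s \<in> S \<Longrightarrow> a \<bullet> s + c = 0" "a \<bullet> x + c \<noteq> 0"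
proof (cases "S = {}")
  case True
  then show ?thesis using that[of 0 1] by simp
next
  case False
  then obtain b where b: "b \<in> S" by blast
  let ?W = "(\<lambda>s. - b + s) ` S"
  obtain y z where y: "y \<in> span ?W" and z: "\<And>w. w \<in> span ?W \<Longrightarrow> orthogonal z w" and x: "x - b = y + z"
    using orthogonal_subspace_decomp_exists[of ?W "x - b"] by metis
  have "z \<noteq> 0"
  proof
    assume "z = 0"
    then have "x - b \<in> span ?W" using x y by simp
    then have "x \<in> affine hull S"
      using affine_hull_span_gen[OF hull_inc[OF b, of affine]] by (force simp: image_iff)
    with assms show False ..
  qed
  moreover have "z \<bullet> s - z \<bullet> b = 0" if "s \<in> S" for s
  proof -
    have "orthogonal z (- b + s)" using that by (intro z span_base) auto
    then show ?thesis by (simp add: orthogonal_def inner_diff_right inner_add_right)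
  qed
  moreover have "z \<bullet> x - z \<bullet> b = z \<bullet> z"
    using z[OF y] x by (simp add: orthogonal_def inner_add_right flip: inner_diff_right)
  ultimately show ?thesis using that[of z "- (z \<bullet> b)"] by simp
qed

lemma finite_minimizer:
  fixes f :: "'a \<Rightarrow> real"
  assumes "finite S" "S \<noteq> {}"
  obtains x where "x \<in> S" "\<And>y. y \<in> S \<Longrightarrow> f x \<le> f y"
  using ex_is_arg_min_if_finite[OF assms, of f] by (auto simp: is_arg_min_linorder)

lemma affine_functional_combination:
  assumes "sum u T = 1"
  shows "a \<bullet> (\<Sum>t\<in>T. u t *\<^sub>R g t) + c = (\<Sum>t\<in>T. u t * (a \<bullet> g t + c))"
proof -
  have "(\<Sum>t\<in>T. u t * c) = c" using assms by (simp flip: sum_distrib_right)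
  then show ?thesis by (simp add: inner_sum_right distrib_left sum.distrib)
qed

lemma inj_on_real_vec [simp]: "inj_on real_vec A"
  using inj_real_vec by (rule inj_on_subset) simp

lemma affine_functional_convex_le:
  assumes "x \<in> convex hull S" "\<And>s. s \<in> S \<Longrightarrow> a \<bullet> s + c \<le> (0::real)"
  shows "a \<bullet> x + c \<le> 0"
proof -
  have "convex {x. a \<bullet> x \<le> - c}" by (rule convex_halfspace_le)
  moreover have "S \<subseteq> {x. a \<bullet> x \<le> - c}" using assms(2) by fastforce
  ultimately have "convex hull S \<subseteq> {x. a \<bullet> x \<le> - c}" by (simp add: hull_minimal)
  with assms(1) show ?thesis by auto
qed

text \<open>
  An affine minorant whose contact set does not span can be tilted, without decreasing its value
  at \<open>p\<close>, until it touches at a new point.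
\<close>

lemma spanning_cell_above:
  fixes J :: "(nat^'n::finite) set"
  assumes J: "finite J" and le: "\<And>\<alpha>. \<alpha> \<in> J \<Longrightarrow> a \<bullet> real_vec \<alpha> + c \<le> w \<alpha>"
    and p: "p \<in> convex hull (real_vec ` J)"
  obtains a' c' T where "spanning_cell J w a' c' T" "{\<alpha>\<in>J. a \<bullet> real_vec \<alpha> + c = w \<alpha>} \<subseteq> T"
    "a \<bullet> p + c \<le> a' \<bullet> p + c'"
proof -
  have "\<exists>a' c' T. spanning_cell J w a' c' T \<and> {\<alpha>\<in>J. a \<bullet> real_vec \<alpha> + c = w \<alpha>} \<subseteq> T \<and> a \<bullet> p + c \<le> a' \<bullet> p + c'"
    using le
  proof (induction "card (J - {\<alpha>\<in>J. a \<bullet> real_vec \<alpha> + c = w \<alpha>})" arbitrary: a c rule: less_induct)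
    case less
    let ?T = "{\<alpha>\<in>J. a \<bullet> real_vec \<alpha> + c = w \<alpha>}"
    show ?case
    proof (cases "real_vec ` J \<subseteq> affine hull (real_vec ` ?T)")
      case True
      then have "spanning_cell J w a c ?T"
        using less.prems by (simp add: spanning_cell_def is_cell_def)
      then show ?thesis by blast
    next
      case False
      then obtain \<alpha>0 where \<alpha>0: "\<alpha>0 \<in> J" "real_vec \<alpha>0 \<notin> affine hull (real_vec ` ?T)" by blast
      obtain m k where mT: "\<And>s. s \<in> real_vec ` ?T \<Longrightarrow> m \<bullet> s + k = 0" and m0: "m \<bullet> real_vec \<alpha>0 + k \<noteq> 0"
        by (rule affine_functional_separates[OF \<alpha>0(2)]) (rule that)
      \<comment> \<open>The tilting direction may be negated: if it is negative at \<open>p\<close>,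
        its negative is positive at \<open>p\<close> and hence at some point of \<open>J\<close>,
        because \<open>p\<close> lies in the hull.\<close>
      have "\<exists>m k \<beta>. (\<forall>s\<in>?T. m \<bullet> real_vec s + k = 0) \<and> \<beta> \<in> J \<and> 0 < m \<bullet> real_vec \<beta> + k \<and> 0 \<le> m \<bullet> p + k"
      proof -
        have *: ?thesis if "\<forall>s\<in>?T. m \<bullet> real_vec s + k = 0" "0 < m \<bullet> real_vec \<alpha>0 + k" for m k
        proof (cases "0 \<le> m \<bullet> p + k")
          case True
          with that \<alpha>0(1) show ?thesis by blast
        next
          case False
          have "\<exists>\<beta>\<in>J. 0 < (- m) \<bullet> real_vec \<beta> + (- k)"
          proof (rule ccontr)
            assume "\<not> ?thesis"
            then have "(- m) \<bullet> p + (- k) \<le> 0"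
              by (intro affine_functional_convex_le[OF p]) (auto simp: not_less)
            with False show False by simp
          qed
          with False that(1) show ?thesis by (intro exI[of _ "- m"] exI[of _ "- k"]) auto
        qed
        show ?thesis
        proof (cases "0 < m \<bullet> real_vec \<alpha>0 + k")
          case True
          then show ?thesis using mT by (intro *[of m k]) auto
        next
          case False
          have "(- m) \<bullet> real_vec s + (- k) = 0" if "s \<in> ?T" for s
            using mT[of "real_vec s"] that by simp
          then show ?thesis using False m0 by (intro *[of "- m" "- k"]) auto
        qed
      qed
      then obtain m k \<beta>0 where m: "\<And>s. s \<in> ?T \<Longrightarrow> m \<bullet> real_vec s + k = 0" "\<beta>0 \<in> J" "0 < m \<bullet> real_vec \<beta>0 + k" "0 \<le> m \<bullet> p + k"
        by blast
      let ?P = "{\<beta>\<in>J. 0 < m \<bullet> real_vec \<beta> + k}"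
      let ?r = "\<lambda>\<beta>. (w \<beta> - (a \<bullet> real_vec \<beta> + c)) / (m \<bullet> real_vec \<beta> + k)"
      have "finite ?P" "?P \<noteq> {}" using J m by auto
      then obtain \<beta> where \<beta>: "\<beta> \<in> ?P" and \<beta>min: "\<And>\<gamma>. \<gamma> \<in> ?P \<Longrightarrow> ?r \<beta> \<le> ?r \<gamma>"
        by (rule finite_minimizer[of ?P ?r]) (rule that)
      \<comment> \<open>The largest tilt that keeps the affine function below \<open>w\<close>; it
        creates the new contact \<beta>.\<close>
      define \<theta> where "\<theta> = ?r \<beta>"
      have \<theta>0: "0 \<le> \<theta>" using \<beta> less.prems[of \<beta>] by (simp add: \<theta>_def)
      define a' c' where "a' = a + \<theta> *\<^sub>R m" and "c' = c + \<theta> * k"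
      have ac: "a' \<bullet> x + c' = a \<bullet> x + c + \<theta> * (m \<bullet> x + k)" for x
        by (simp add: a'_def c'_def inner_add_left algebra_simps)
      have le': "a' \<bullet> real_vec \<gamma> + c' \<le> w \<gamma>" if "\<gamma> \<in> J" for \<gamma>
      proof (cases "0 < m \<bullet> real_vec \<gamma> + k")
        case True
        then have "\<theta> \<le> ?r \<gamma>" using \<beta>min that by (simp add: \<theta>_def)
        then have "\<theta> * (m \<bullet> real_vec \<gamma> + k) \<le> w \<gamma> - (a \<bullet> real_vec \<gamma> + c)"
          by (simp only: pos_le_divide_eq[OF True])
        then show ?thesis by (simp add: ac)
      next
        case False
        then have "\<theta> * (m \<bullet> real_vec \<gamma> + k) \<le> 0" using \<theta>0 by (simp add: mult_nonneg_nonpos)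
        with less.prems[OF that] show ?thesis by (simp add: ac)
      qed
      let ?T' = "{\<alpha>\<in>J. a' \<bullet> real_vec \<alpha> + c' = w \<alpha>}"
      have sub: "?T \<subseteq> ?T'"
      proof
        fix s assume "s \<in> ?T"
        with m(1)[of s] show "s \<in> ?T'" by (simp add: ac)
      qed
      have "\<beta> \<in> ?T'" using \<beta> by (simp add: ac \<theta>_def)
      moreover have "\<beta> \<notin> ?T" using \<beta> m(1)[of \<beta>] by force
      ultimately have "card (J - ?T') < card (J - ?T)"
        using sub J \<beta> by (intro psubset_card_mono) auto
      from less.hyps[OF this le'] obtain a'' c'' T
        where *: "spanning_cell J w a'' c'' T" "?T' \<subseteq> T" "a' \<bullet> p + c' \<le> a'' \<bullet> p + c''" by blast
      have "0 \<le> \<theta> * (m \<bullet> p + k)" using \<theta>0 m(4) by simp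
      then have "a \<bullet> p + c \<le> a'' \<bullet> p + c''" using *(3) ac[of p] by linarith
      with * sub show ?thesis by blast
    qed
  qed
  with that show thesis by blast
qed

section \<open>Maximal cells: uniqueness, covering, M-convexity\<close>

lemma is_cell_eq_on_span:
  assumes "is_cell J w a c T" "is_cell J w a' c' T'" "T \<subseteq> T'" "x \<in> affine hull (real_vec ` T)"
  shows "a \<bullet> x + c = a' \<bullet> x + c'"
  using assms by (intro affine_functional_hull[OF assms(4)]) (auto simp: is_cell_def)

text \<open>The two affine functions agree on \<open>T\<close>, hence on its affine hull, which
  contains all of \<open>J\<close>.\<close>

lemma spanning_cell_maximal:
  assumes "spanning_cell J w a c T" "is_cell J w a' c' T'" "T \<subseteq> T'"
  shows "T' = T"
proof -
  have "a \<bullet> real_vec \<alpha> + c = a' \<bullet> real_vec \<alpha> + c'" if "\<alpha> \<in> J" for \<alpha>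
    using assms that by (intro is_cell_eq_on_span[of J w a c T a' c' T']) (auto simp: spanning_cell_def)
  then show ?thesis using assms by (auto simp: spanning_cell_def is_cell_def)
qed

text \<open>The spanning cell whose affine function is highest at \<open>p\<close> contains
  \<open>p\<close>: otherwise a hyperplane separating \<open>p\<close> from it gives a tilt with a
  larger value at \<open>p\<close>, and \<open>spanning_cell_above\<close> completes the tilted
  function to a higher spanning cell.\<close>

lemma spanning_cells_cover:
  fixes J :: "(nat^'n::finite) set"
  assumes J: "finite J" and p: "p \<in> convex hull (real_vec ` J)"
  obtains a c T where "spanning_cell J w a c T" "p \<in> convex hull (real_vec ` T)"
proof -
  \<comment> \<open>\<open>a\<close> and \<open>c\<close> need not be unique, since \<open>J\<close>
    may lie in a hyperplane. The value at \<open>p\<close> is determined by \<open>T\<close>, so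
    pairing values with contact sets gives a finite set.\<close>
  define V where "V = {(T, a \<bullet> p + c) | T a c. spanning_cell J w a c T}"
  have pa: "p \<in> affine hull (real_vec ` T)" if "spanning_cell J w a c T" for a c T
  proof -
    have "convex hull (real_vec ` J) \<subseteq> affine hull (real_vec ` T)"
      using that by (intro hull_minimal) (auto simp: spanning_cell_def affine_imp_convex)
    with p show ?thesis by blast
  qed
  have "v = v'" if V: "v \<in> V" "v' \<in> V" "fst v = fst v'" for v v'
  proof -
    obtain T a c where T: "v = (T, a \<bullet> p + c)" "spanning_cell J w a c T"
      using V(1) by (auto simp: V_def)
    moreover obtain T' a' c' where "v' = (T', a' \<bullet> p + c')" "spanning_cell J w a' c' T'"
      using V(2) by (auto simp: V_def)
    ultimately have "v' = (T, a' \<bullet> p + c')" "spanning_cell J w a' c' T"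
      using V(3) by auto
    with T    show ?thesis
      using is_cell_eq_on_span[of J w a c T a' c' T p] pa by (auto simp: spanning_cell_def)
  qed
  then have "inj_on fst V" by (intro inj_onI)
  moreover have "fst ` V \<subseteq> Pow J"
    by (auto simp: V_def spanning_cell_def is_cell_def)
  ultimately have finV: "finite V"
    using J by (meson finite_Pow_iff finite_imageD finite_subset)
  have J0: "J \<noteq> {}" using p by auto
  define c0 where "c0 = Min (w ` J)"
  have "(0 :: real^'n) \<bullet> real_vec \<alpha> + c0 \<le> w \<alpha>" if "\<alpha> \<in> J" for \<alpha>
    using J that by (simp add: c0_def)
  from spanning_cell_above[OF J this p] obtain a c T where "spanning_cell J w a c T" by blast
  then have "V \<noteq> {}" by (auto simp: V_def)
  then obtain v where v: "v \<in> V" "\<And>v'. v' \<in> V \<Longrightarrow> snd v' \<le> snd v"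
    using finite_minimizer[OF finV, of "\<lambda>v. - snd v"] by (metis neg_le_iff_le)
  then obtain a c T where T: "spanning_cell J w a c T" "snd v = a \<bullet> p + c" by (auto simp: V_def)
  have "p \<in> convex hull (real_vec ` T)"
  proof (rule ccontr)
    assume np: "p \<notin> convex hull (real_vec ` T)"
    have finT: "finite T" using T J by (auto simp: spanning_cell_def is_cell_def)
    then have "closed (convex hull (real_vec ` T))"
      by (simp add: finite_imp_compact_convex_hull compact_imp_closed)
    then obtain m k where mk: "m \<bullet> p < k" "\<And>x. x \<in> convex hull (real_vec ` T) \<Longrightarrow> k < m \<bullet> x"
      using separating_hyperplane_closed_point[OF convex_convex_hull _ np] by metis
    have mT: "k < m \<bullet> real_vec \<alpha>" if "\<alpha> \<in> T" for \<alpha> using mk(2) that by (simp add: hull_inc)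
    \<comment> \<open>The tilt lowers the function on \<open>T\<close>, and off \<open>T\<close>
      there is slack; since \<open>J\<close> is finite, a small tilt stays below
      \<open>w\<close>.\<close>
    have "\<exists>e>0. \<forall>\<alpha>\<in>J. a \<bullet> real_vec \<alpha> + c + e * (k - m \<bullet> real_vec \<alpha>) \<le> w \<alpha>"
    proof -
      have "\<forall>\<^sub>F e in at_right 0. a \<bullet> real_vec \<alpha> + c + e * (k - m \<bullet> real_vec \<alpha>) \<le> w \<alpha>" if \<alpha>: "\<alpha> \<in> J" for \<alpha>
      proof (cases "\<alpha> \<in> T")
        case True
        have "e * (k - m \<bullet> real_vec \<alpha>) \<le> 0" if "e > 0" for e
          using mT[OF True] that by (simp add: mult_nonneg_nonpos)
        moreover have "a \<bullet> real_vec \<alpha> + c = w \<alpha>"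
          using True T by (simp add: spanning_cell_def is_cell_def)
        ultimately show ?thesis
          by (auto simp: eventually_at_right_field intro: exI[of _ 1])
      next
        case False
        then have lt: "a \<bullet> real_vec \<alpha> + c + 0 * (k - m \<bullet> real_vec \<alpha>) < w \<alpha>"
          using \<alpha> T by (force simp: spanning_cell_def is_cell_def order_less_le)
        have "((\<lambda>e. a \<bullet> real_vec \<alpha> + c + e * (k - m \<bullet> real_vec \<alpha>)) \<longlongrightarrow> a \<bullet> real_vec \<alpha> + c + 0 * (k - m \<bullet> real_vec \<alpha>)) (at_right 0)"
          by (intro tendsto_intros)
        from order_tendstoD(2)[OF this lt] show ?thesis by (auto elim: eventually_mono)
      qed
      then have "\<forall>\<^sub>F e in at_right 0. \<forall>\<alpha>\<in>J. a \<bullet> real_vec \<alpha> + c + e * (k - m \<bullet> real_vec \<alpha>) \<le> w \<alpha>"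
        using J by (simp add: eventually_ball_finite_distrib)
      moreover have "\<forall>\<^sub>F e in at_right 0. (0::real) < e" by (simp add: eventually_at_right_less)
      ultimately have "\<forall>\<^sub>F e in at_right 0. (0::real) < e \<and> (\<forall>\<alpha>\<in>J. a \<bullet> real_vec \<alpha> + c + e * (k - m \<bullet> real_vec \<alpha>) \<le> w \<alpha>)"
        by eventually_elim blast
      then show ?thesis using eventually_happens'[of "at_right (0::real)"] by (auto simp: trivial_limit_at_right_real)
    qed
    then obtain e where e: "e > 0" "\<And>\<alpha>. \<alpha> \<in> J \<Longrightarrow> a \<bullet> real_vec \<alpha> + c + e * (k - m \<bullet> real_vec \<alpha>) \<le> w \<alpha>" by blast
    define a1 c1 where "a1 = a - e *\<^sub>R m" and "c1 = c + e * k"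
    have ac1: "a1 \<bullet> x + c1 = a \<bullet> x + c + e * (k - m \<bullet> x)" for x
      by (simp add: a1_def c1_def inner_diff_left algebra_simps)
    obtain a' c' T' where T': "spanning_cell J w a' c' T'" "a1 \<bullet> p + c1 \<le> a' \<bullet> p + c'"
      using spanning_cell_above[OF J _ p, of a1 c1 w] e(2) ac1 by metis
    have "(T', a' \<bullet> p + c') \<in> V" using T'(1) by (auto simp: V_def)
    from v(2)[OF this] T(2) T'(2) ac1[of p] have "e * (k - m \<bullet> p) \<le> 0" by simp
    moreover have "0 < e * (k - m \<bullet> p)" using e mk by simp
    ultimately show False by simp
  qed
  with T(1) that show thesis by blast
qed

text \<open>An exchange preserves the sum of the two points and so the sum of their affine values.
  The exchange inequality then squeezes both new points onto the supporting affine function.\<close>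

lemma M_convex_cell:
  assumes "M_convex_fun J w" "is_cell J w a c T" "T \<noteq> {}"
  shows "M_convex T"
  unfolding M_convex_def
proof (intro conjI ballI allI impI)
  fix \<alpha> \<beta> i assume ab: "\<alpha> \<in> T" "\<beta> \<in> T" "\<alpha> $ i < \<beta> $ i"
  then have J: "\<alpha> \<in> J" "\<beta> \<in> J" using assms(2) by (auto simp: is_cell_def)
  then obtain l where l: "\<beta> $ l < \<alpha> $ l" "\<beta> + evec l - evec i \<in> J" "\<alpha> + evec i - evec l \<in> J"
     "w \<beta> + w \<alpha> \<ge> w (\<beta> + evec l - evec i) + w (\<alpha> + evec i - evec l)"
    using assms(1) ab unfolding M_convex_fun_def by metis
  let ?\<alpha> = "\<alpha> + evec i - evec l" and ?\<beta> = "\<beta> + evec l - evec i"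
  have "real_vec ?\<alpha> + real_vec ?\<beta> = real_vec \<alpha> + real_vec \<beta>"
    using ab l by (intro real_vec_swap_sum) auto
  then have "a \<bullet> real_vec ?\<alpha> + a \<bullet> real_vec ?\<beta> = a \<bullet> real_vec \<alpha> + a \<bullet> real_vec \<beta>"
    by (metis inner_add_right)
  moreover have "a \<bullet> real_vec ?\<alpha> + c \<le> w ?\<alpha>" "a \<bullet> real_vec ?\<beta> + c \<le> w ?\<beta>"
    using assms(2) l by (auto simp: is_cell_def)
  moreover have "a \<bullet> real_vec \<alpha> + c = w \<alpha>" "a \<bullet> real_vec \<beta> + c = w \<beta>"
    using assms(2) ab by (auto simp: is_cell_def)
  ultimately have "a \<bullet> real_vec ?\<alpha> + c = w ?\<alpha>" "a \<bullet> real_vec ?\<beta> + c = w ?\<beta>"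
    using l(4) by linarith+
  then have "?\<alpha> \<in> T" "?\<beta> \<in> T" using assms(2) l by (auto simp: is_cell_def)
  with l show "\<exists>j. \<beta> $ j < \<alpha> $ j \<and> \<alpha> + evec i - evec j \<in> T \<and> \<beta> + evec j - evec i \<in> T" by blast
qed (fact assms(3))

text \<open>A lower face is cut out by a functional (a, h) with h > 0; dividing by h turns it into a
  supporting affine function of the exponents.\<close>

lemma regular_subdivision_cells:
  fixes J :: "(nat^'n::finite) set"
  assumes J: "finite J"
  shows "regular_subdivision J w = {convex hull (real_vec ` T) | T. T \<noteq> {} \<and> (\<exists>a c. is_cell J w a c T)}"
    (is "_ = ?R")
proof -
  let ?L = "\<lambda>\<alpha>. (real_vec \<alpha>, w \<alpha>)"
  have inj: "inj_on ?L J" by (auto simp: inj_on_def real_vec_def vec_eq_iff)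
  have face: "fst ` (lifted_polytope J w \<inter> {p. (a, h) \<bullet> p = b}) = convex hull (real_vec ` {\<alpha>\<in>J. a \<bullet> real_vec \<alpha> + h * w \<alpha> = b})"
    if ge: "\<And>\<alpha>. \<alpha> \<in> J \<Longrightarrow> b \<le> a \<bullet> real_vec \<alpha> + h * w \<alpha>" for a h b
  proof -
    let ?T = "{\<alpha>\<in>J. a \<bullet> real_vec \<alpha> + h * w \<alpha> = b}"
    have "lifted_polytope J w \<inter> {p. (a, h) \<bullet> p = b} = convex hull (?L ` ?T)"
    proof
      show "lifted_polytope J w \<inter> {p. (a, h) \<bullet> p = b} \<subseteq> convex hull (?L ` ?T)"
      proof
        fix z assume z: "z \<in> lifted_polytope J w \<inter> {p. (a, h) \<bullet> p = b}"
        then have "z \<in> convex hull (?L ` J)" by (simp add: lifted_polytope_def)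
        then obtain u where u: "\<And>t. t \<in> J \<Longrightarrow> 0 \<le> u t" "sum u J = 1" "(\<Sum>t\<in>J. u t *\<^sub>R ?L t) = z"
          by (rule convex_hull_image_combination[OF J inj]) (rule that)
        have "(\<Sum>t\<in>J. u t * ((a, h) \<bullet> ?L t)) = b"
        proof -
          have "(a, h) \<bullet> z = b" using z by simp
          then show ?thesis unfolding u(3)[symmetric] inner_sum_right by (simp add: distrib_left mult.left_commute)
        qed
        \<comment> \<open>The weighted excesses over \<open>b\<close> are nonnegative with sum 0, so
          only contact points carry weight.\<close>
        then have s0: "(\<Sum>t\<in>J. u t * ((a, h) \<bullet> ?L t - b)) = 0"
          using u(2) by (simp add: right_diff_distrib sum_subtractf flip: sum_distrib_right)
        have nn: "0 \<le> u t * ((a, h) \<bullet> ?L t - b)" if "t \<in> J" for t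
          using u(1) ge that by (intro mult_nonneg_nonneg) auto
        have "u t * ((a, h) \<bullet> ?L t - b) = 0" if "t \<in> J" for t
          using sum_nonneg_eq_0_iff[of J "\<lambda>t. u t * ((a, h) \<bullet> ?L t - b)"] J nn s0 that by blast
        then have u0: "u t = 0" if "t \<in> J - ?T" for t using that by fastforce
        have "z = (\<Sum>t\<in>?T. u t *\<^sub>R ?L t)"
          unfolding u(3)[symmetric] by (rule sum.mono_neutral_right) (use J u0 in \<open>auto simp: zero_prod_def\<close>)
        moreover have "sum u ?T = 1"
          unfolding u(2)[symmetric] by (rule sum.mono_neutral_left) (use J u0 in auto)
        moreover have "?L t \<in> convex hull (?L ` ?T)" if "t \<in> ?T" for t
          using that by (intro hull_inc imageI)
        ultimately show "z \<in> convex hull (?L ` ?T)"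
          using convex_sum[of ?T "convex hull (?L ` ?T)" u ?L] J u(1) by auto
      qed
      have "convex hull (?L ` ?T) \<subseteq> lifted_polytope J w"
        unfolding lifted_polytope_def by (intro hull_mono) auto
      moreover have "convex hull (?L ` ?T) \<subseteq> {p. (a, h) \<bullet> p = b}"
        by (intro hull_minimal convex_hyperplane) auto
      ultimately show "convex hull (?L ` ?T) \<subseteq> lifted_polytope J w \<inter> {p. (a, h) \<bullet> p = b}" by blast
    qed
    moreover have "fst ` (convex hull (?L ` ?T)) = convex hull (real_vec ` ?T)"
      using convex_hull_linear_image[OF linear_fst, of "?L ` ?T"] by (simp add: image_image)
    ultimately show ?thesis by simp
  qed
  have ge_iff: "lifted_polytope J w \<subseteq> {p. b \<le> z \<bullet> p} \<longleftrightarrow> (\<forall>\<alpha>\<in>J. b \<le> z \<bullet> ?L \<alpha>)" for b z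
  proof
    assume "\<forall>\<alpha>\<in>J. b \<le> z \<bullet> ?L \<alpha>"
    then show "lifted_polytope J w \<subseteq> {p. b \<le> z \<bullet> p}"
      unfolding lifted_polytope_def
      by (intro hull_minimal convex_halfspace_ge image_subsetI CollectI) (rule bspec)
  next
    assume sub: "lifted_polytope J w \<subseteq> {p. b \<le> z \<bullet> p}"
    show "\<forall>\<alpha>\<in>J. b \<le> z \<bullet> ?L \<alpha>"
    proof
      fix \<alpha> assume "\<alpha> \<in> J"
      then have "?L \<alpha> \<in> lifted_polytope J w"
        unfolding lifted_polytope_def by (intro hull_inc imageI)
      with sub show "b \<le> z \<bullet> ?L \<alpha>" by blast
    qed
  qed
  show ?thesis
  proof (intro set_eqI iffI)
    fix C assume "C \<in> regular_subdivision J w"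
    then obtain F where F: "lower_face (lifted_polytope J w) F" "C = fst ` F"
      by (auto simp: regular_subdivision_def)
    then obtain z b where z: "snd z > 0" "\<forall>\<alpha>\<in>J. b \<le> z \<bullet> ?L \<alpha>" "F = lifted_polytope J w \<inter> {p. z \<bullet> p = b}" "F \<noteq> {}"
      unfolding lower_face_def ge_iff by blast
    obtain a h where zah: "z = (a, h)" by (cases z)
    note ahb = z[unfolded zah snd_conv]
    let ?T = "{\<alpha>\<in>J. a \<bullet> real_vec \<alpha> + h * w \<alpha> = b}"
    have C: "C = convex hull (real_vec ` ?T)"
      using F(2) ahb by (simp add: face)
    have "is_cell J w (- (1 / h) *\<^sub>R a) (b / h) ?T"
      using ahb(1,2) by (auto simp: is_cell_def field_simps)
    moreover have "?T \<noteq> {}"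
    proof
      assume "?T = {}"
      then have "C = {}" unfolding C by simp
      then show False using F(2) ahb(4) by simp
    qed
    ultimately show "C \<in> ?R" using C by blast
  next
    fix C assume "C \<in> ?R"
    then obtain T a c where T: "C = convex hull (real_vec ` T)" "T \<noteq> {}" "is_cell J w a c T" by blast
    have eq: "T = {\<alpha>\<in>J. (- a) \<bullet> real_vec \<alpha> + 1 * w \<alpha> = c}" and ge: "\<And>\<alpha>. \<alpha> \<in> J \<Longrightarrow> c \<le> (- a) \<bullet> real_vec \<alpha> + 1 * w \<alpha>"
      using T(3) by (auto simp: is_cell_def algebra_simps)
    let ?F = "lifted_polytope J w \<inter> {p. (- a, 1) \<bullet> p = c}"
    have CF: "C = fst ` ?F" unfolding T(1) by (subst eq) (rule face[OF ge, symmetric])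
    have "C \<noteq> {}" using T(1,2) by simp
    then have "?F \<noteq> {}" unfolding CF by blast
    moreover have "lifted_polytope J w \<subseteq> {p. c \<le> (- a, 1) \<bullet> p}"
      unfolding ge_iff using ge by simp
    ultimately have "lower_face (lifted_polytope J w) ?F"
      unfolding lower_face_def by (intro conjI exI[of _ "(- a, 1)"] exI[of _ c]) simp_all
    then show "C \<in> regular_subdivision J w" using CF by (auto simp: regular_subdivision_def)
  qed
qed

text \<open>M-convexity enters through \<open>M_convex_lattice_points\<close>: a contact set can be
  read off from its hull, so inclusion of polytopes amounts to inclusion of contact sets.\<close>

lemma maximal_cells_regular_subdivision:
  fixes J :: "(nat^'n::finite) set"
  assumes J: "finite J" "J \<noteq> {}" and w: "M_convex_fun J w"
  shows "maximal_cells (regular_subdivision J w) = (\<lambda>T. convex hull (real_vec ` T)) ` {T. \<exists>a c. spanning_cell J w a c T}"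
    (is "_ = ?h ` _")
proof -
  have lat: "lattice_points (?h T) = T" if "T \<noteq> {}" "is_cell J w a c T" for T a c
    using M_convex_cell[OF w that(2,1)] that J by (intro M_convex_lattice_points) (auto simp: is_cell_def)
  have mono: "T \<subseteq> T'" if "?h T \<subseteq> ?h T'" "T \<noteq> {}" "is_cell J w a c T" "T' \<noteq> {}" "is_cell J w a' c' T'" for T T' a c a' c'
    using that lat[of T a c] lat[of T' a' c'] by (auto simp: lattice_points_def)
  have ne: "T \<noteq> {}" if "spanning_cell J w a c T" for a c T
    using that J(2) by (auto simp: spanning_cell_def)
  show ?thesis
  proof (intro set_eqI iffI)
    fix C assume C: "C \<in> maximal_cells (regular_subdivision J w)"
    then obtain T a c where T: "C = ?h T" "T \<noteq> {}" "is_cell J w a c T"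
      by (auto simp: maximal_cells_def regular_subdivision_cells[OF J(1)])
    obtain \<alpha> where "\<alpha> \<in> J" using J(2) by blast
    then have "real_vec \<alpha> \<in> convex hull (real_vec ` J)" by (simp add: hull_inc)
    then obtain a' c' T' where T': "spanning_cell J w a' c' T'" "T \<subseteq> T'"
      using spanning_cell_above[OF J(1), of a c w "real_vec \<alpha>"] T(3) unfolding is_cell_def by metis
    then have "?h T' \<in> regular_subdivision J w"
      using ne[OF T'(1)] T'(1) unfolding regular_subdivision_cells[OF J(1)] spanning_cell_def by blast
    moreover have "?h T \<subseteq> ?h T'" using T'(2) by (intro hull_mono) auto
    ultimately have "C = ?h T'" using C T(1) by (auto simp: maximal_cells_def)
    then show "C \<in> ?h ` {T. \<exists>a c. spanning_cell J w a c T}" using T'(1) by blast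
  next
    fix C assume "C \<in> ?h ` {T. \<exists>a c. spanning_cell J w a c T}"
    then obtain T a c where T: "C = ?h T" "spanning_cell J w a c T" by blast
    have "C \<in> regular_subdivision J w"
      using T ne[OF T(2)] unfolding regular_subdivision_cells[OF J(1)] spanning_cell_def by blast
    moreover have "C = D" if D: "D \<in> regular_subdivision J w" "C \<subseteq> D" for D
    proof -
      obtain T' a' c' where T': "D = ?h T'" "T' \<noteq> {}" "is_cell J w a' c' T'"
        using D(1) by (auto simp: regular_subdivision_cells[OF J(1)])
      have "T \<subseteq> T'" using mono[of T T' a c a' c'] D(2) T T' ne[OF T(2)] by (simp add: spanning_cell_def)
      then have "T' = T" using spanning_cell_maximal[OF T(2) T'(3)] by blast
      with T T' show ?thesis by simp
    qed
    ultimately show "C \<in> maximal_cells (regular_subdivision J w)" by (auto simp: maximal_cells_def)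
  qed
qed

section \<open>The simplex of polynomials\<close>

lemma poly_simplexD:
  assumes "f \<in> poly_simplex d"
  shows "0 \<le> f \<alpha>" "\<alpha> \<notin> Delta d \<Longrightarrow> f \<alpha> = 0" "(\<Sum>\<alpha>\<in>Delta d. f \<alpha>) = 1" "f \<alpha> \<le> 1"
proof -
  show 1: "0 \<le> f \<alpha>" and 2: "\<alpha> \<notin> Delta d \<Longrightarrow> f \<alpha> = 0" and 3: "(\<Sum>\<alpha>\<in>Delta d. f \<alpha>) = 1"
    using assms by (auto simp: poly_simplex_def supp_def)
  have "f \<alpha> \<le> (\<Sum>\<alpha>\<in>Delta d. f \<alpha>)" if "\<alpha> \<in> Delta d"
    using assms that by (intro member_le_sum) (auto simp: poly_simplex_def)
  with 2 3 show "f \<alpha> \<le> 1" by fastforce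
qed

lemma sum_pos_of_nonzero:
  fixes f :: "'n::finite polyn"
  assumes "\<And>\<alpha>. 0 \<le> f \<alpha>" "supp f \<subseteq> Delta d" "f \<noteq> (\<lambda>_. 0)"
  shows "0 < (\<Sum>\<alpha>\<in>Delta d. f \<alpha>)"
proof -
  obtain \<alpha> where "f \<alpha> \<noteq> 0" using assms(3) by auto
  then have "\<alpha> \<in> Delta d" "0 < f \<alpha>" using assms(1)[of \<alpha>] assms(2) by (auto simp: supp_def)
  then show ?thesis using assms(1) by (intro sum_pos2[of _ \<alpha>]) auto
qed

lemma normalize_poly_in_simplex:
  fixes f :: "'n::finite polyn"
  assumes "\<And>\<alpha>. 0 \<le> f \<alpha>" "supp f \<subseteq> Delta d" "f \<noteq> (\<lambda>_. 0)"
  shows "normalize_poly d f \<in> poly_simplex d"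
  unfolding poly_simplex_def
proof (intro CollectI conjI allI)
  note S = sum_pos_of_nonzero[OF assms]
  show "supp (normalize_poly d f) \<subseteq> Delta d"
    using assms(2) by (auto simp: normalize_poly_def supp_def)
  show "0 \<le> normalize_poly d f \<alpha>" for \<alpha>
    using S assms(1) by (simp add: normalize_poly_def)
  show "sum (normalize_poly d f) (Delta d) = 1"
    unfolding normalize_poly_def sum_divide_distrib[symmetric] using S by simp
qed

lemma poly_simplex_nonzero: "f \<in> poly_simplex d \<Longrightarrow> f \<noteq> (\<lambda>_. 0)"
  using poly_simplexD(3)[of f d] by auto

lemma poly_simplex_exp_scale:
  assumes "f \<in> poly_simplex d"
  shows "normalize_poly d (\<lambda>\<alpha>. exp (a \<bullet> real_vec \<alpha> + c) * f \<alpha>) \<in> poly_simplex d"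
proof (rule normalize_poly_in_simplex)
  show "(\<lambda>\<alpha>. exp (a \<bullet> real_vec \<alpha> + c) * f \<alpha>) \<noteq> (\<lambda>_. 0)"
    using poly_simplex_nonzero[OF assms] by (auto simp: fun_eq_iff)
qed (use poly_simplexD(1,2)[OF assms] in \<open>auto simp: supp_def\<close>)

text \<open>Logarithmic coordinates: \<open>a\<close> is the logarithm of the torus element and
  \<open>c\<close> absorbs the normalisation. Rescalings become affine functions of the exponent, of
  the same kind as those that define cells.\<close>

lemma orbit_eq:
  fixes f :: "'n::finite polyn"
  assumes f: "f \<in> poly_simplex d"
  shows "orbit d f = {g \<in> poly_simplex d. \<exists>a c. \<forall>\<alpha>. g \<alpha> = exp (a \<bullet> real_vec \<alpha> + c) * f \<alpha>}"
proof -
  have resc: "rescale t f = (\<lambda>\<alpha>. exp ((\<chi> i. ln (t $ i)) \<bullet> real_vec \<alpha> + 0) * f \<alpha>)" if "t \<in> pos_torus" for t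
  proof -
    have "(\<Prod>i\<in>UNIV. t $ i ^ (\<alpha> $ i)) = exp ((\<chi> i. ln (t $ i)) \<bullet> real_vec \<alpha>)" for \<alpha>
      using that by (auto simp: inner_vec_def exp_sum real_vec_def pos_torus_def exp_of_nat2_mult intro!: prod.cong)
    then show ?thesis by (simp add: rescale_def)
  qed
  have S: "0 < (\<Sum>\<beta>\<in>Delta d. exp (a \<bullet> real_vec \<beta> + c) * f \<beta>)" for a c
    using poly_simplexD[OF f] poly_simplex_nonzero[OF f]
    by (intro sum_pos_of_nonzero) (auto simp: supp_def fun_eq_iff)
  show ?thesis
  proof (intro equalityI subsetI)
    fix g assume "g \<in> orbit d f"
    then obtain t where t: "t \<in> pos_torus" "g = normalize_poly d (rescale t f)" by (auto simp: orbit_def)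
    let ?a = "\<chi> i. ln (t $ i)"
    let ?S = "\<Sum>\<beta>\<in>Delta d. exp (?a \<bullet> real_vec \<beta> + 0) * f \<beta>"
    have g: "g = normalize_poly d (\<lambda>\<alpha>. exp (?a \<bullet> real_vec \<alpha> + 0) * f \<alpha>)"
      using t resc by simp
    then have "g \<alpha> = exp (?a \<bullet> real_vec \<alpha> + (- ln ?S)) * f \<alpha>" for \<alpha>
      using S[of ?a 0] by (simp add: normalize_poly_def exp_diff)
    with g poly_simplex_exp_scale[OF f] show "g \<in> {g \<in> poly_simplex d. \<exists>a c. \<forall>\<alpha>. g \<alpha> = exp (a \<bullet> real_vec \<alpha> + c) * f \<alpha>}"
      by blast
  next
    fix g assume "g \<in> {g \<in> poly_simplex d. \<exists>a c. \<forall>\<alpha>. g \<alpha> = exp (a \<bullet> real_vec \<alpha> + c) * f \<alpha>}"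
    then obtain a c where g: "g \<in> poly_simplex d" "\<And>\<alpha>. g \<alpha> = exp (a \<bullet> real_vec \<alpha> + c) * f \<alpha>" by blast
    define t where "t = (\<chi> i. exp (a $ i))"
    have t: "t \<in> pos_torus" "(\<chi> i. ln (t $ i)) = a" by (auto simp: t_def pos_torus_def vec_eq_iff)
    let ?S = "\<Sum>\<beta>\<in>Delta d. exp (a \<bullet> real_vec \<beta>) * f \<beta>"
    have "exp c * ?S = 1"
      using poly_simplexD(3)[OF g(1)] unfolding g(2) by (simp add: exp_add sum_distrib_left mult_ac)
    then have c: "exp c = 1 / ?S" using S[of a 0] by (simp add: field_simps)
    have "g = normalize_poly d (rescale t f)"
      unfolding resc[OF t(1)] t(2) normalize_poly_def
      by (simp add: fun_eq_iff g(2) exp_add c)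
    then show "g \<in> orbit d f" using t(1) by (auto simp: orbit_def)
  qed
qed

lemma orbit_refl:
  assumes "f \<in> poly_simplex d"
  shows "f \<in> orbit d f"
proof -
  have "f \<alpha> = exp (0 \<bullet> real_vec \<alpha> + 0) * f \<alpha>" for \<alpha> by simp
  with assms show ?thesis unfolding orbit_eq[OF assms] by blast
qed

section \<open>Convergence of polynomials\<close>

lemma poly_dist_tendsto_iff:
  assumes "\<And>n. \<sigma> n \<in> poly_simplex d" "f \<in> poly_simplex d"
  shows "(\<lambda>n. poly_dist d (\<sigma> n) f) \<longlonglongrightarrow> 0 \<longleftrightarrow> (\<forall>\<alpha>. (\<lambda>n. \<sigma> n \<alpha>) \<longlonglongrightarrow> f \<alpha>)"
proof
  assume lim: "(\<lambda>n. poly_dist d (\<sigma> n) f) \<longlonglongrightarrow> 0"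
  show "\<forall>\<alpha>. (\<lambda>n. \<sigma> n \<alpha>) \<longlonglongrightarrow> f \<alpha>"
  proof
    fix \<alpha>
    show "(\<lambda>n. \<sigma> n \<alpha>) \<longlonglongrightarrow> f \<alpha>"
    proof (cases "\<alpha> \<in> Delta d")
      case True
      have "norm (\<sigma> n \<alpha> - f \<alpha>) \<le> poly_dist d (\<sigma> n) f" for n
        unfolding poly_dist_def L2_set_def real_norm_def
        by (rule real_le_rsqrt) (use True in \<open>auto intro: member_le_sum[of \<alpha> "Delta d" "\<lambda>\<alpha>. (\<sigma> n \<alpha> - f \<alpha>)\<^sup>2"]\<close>)
      then have "(\<lambda>n. \<sigma> n \<alpha> - f \<alpha>) \<longlonglongrightarrow> 0"
        by (intro Lim_null_comparison[OF _ lim]) auto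
      then show ?thesis by (simp add: LIM_zero_iff)
    next
      case False
      then have "\<sigma> n \<alpha> = 0" "f \<alpha> = 0" for n
        using assms poly_simplexD(2) by blast+
      then show ?thesis by simp
    qed
  qed
next
  assume "\<forall>\<alpha>. (\<lambda>n. \<sigma> n \<alpha>) \<longlonglongrightarrow> f \<alpha>"
  then have "(\<lambda>n. poly_dist d (\<sigma> n) f) \<longlonglongrightarrow> sqrt (\<Sum>\<alpha>\<in>Delta d. (f \<alpha> - f \<alpha>)\<^sup>2)"
    unfolding poly_dist_def L2_set_def by (intro tendsto_intros) auto
  then show "(\<lambda>n. poly_dist d (\<sigma> n) f) \<longlonglongrightarrow> 0" by simp
qed

lemma poly_simplex_limit:
  assumes "\<And>n. \<sigma> n \<in> poly_simplex d" "\<And>\<alpha>. (\<lambda>n. \<sigma> n \<alpha>) \<longlonglongrightarrow> f \<alpha>"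
  shows "f \<in> poly_simplex d"
proof -
  have "0 \<le> f \<alpha>" for \<alpha>
    by (rule LIMSEQ_le_const[OF assms(2)]) (use poly_simplexD(1)[OF assms(1)] in blast)
  moreover have "f \<alpha> = 0" if "\<alpha> \<notin> Delta d" for \<alpha>
    using assms(2)[of \<alpha>] poly_simplexD(2)[OF assms(1) that] by (simp add: LIMSEQ_const_iff)
  moreover have "(\<lambda>n. \<Sum>\<alpha>\<in>Delta d. \<sigma> n \<alpha>) \<longlonglongrightarrow> (\<Sum>\<alpha>\<in>Delta d. f \<alpha>)"
    by (intro tendsto_sum assms(2))
  then have "(\<Sum>\<alpha>\<in>Delta d. f \<alpha>) = 1"
    using poly_simplexD(3)[OF assms(1)] by (simp add: LIMSEQ_const_iff)
  ultimately show ?thesis by (auto simp: poly_simplex_def supp_def)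
qed

text \<open>One extraction for each element of \<open>A\<close>; heredity under subsequences ensures
  that later extractions do not spoil earlier ones.\<close>

lemma finite_subsequence:
  fixes P :: "'a \<Rightarrow> (nat \<Rightarrow> nat) \<Rightarrow> bool"
  assumes "finite A"
    and ex: "\<And>a (s :: nat \<Rightarrow> nat). \<lbrakk>a \<in> A; strict_mono s\<rbrakk> \<Longrightarrow> \<exists>r. strict_mono r \<and> P a (s \<circ> r)"
    and her: "\<And>a s (r :: nat \<Rightarrow> nat). \<lbrakk>a \<in> A; P a s; strict_mono r\<rbrakk> \<Longrightarrow> P a (s \<circ> r)"
  obtains s where "strict_mono s" "\<And>a. a \<in> A \<Longrightarrow> P a s"
proof -
  have "\<exists>s::nat \<Rightarrow> nat. strict_mono s \<and> (\<forall>a\<in>B. P a s)" if "B \<subseteq> A" for B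
    using finite_subset[OF that assms(1)] that
  proof (induction B rule: finite_induct)
    case empty
    then show ?case using strict_mono_id by auto
  next
    case (insert b B)
    then obtain s :: "nat \<Rightarrow> nat" where s: "strict_mono s" "\<And>a. a \<in> B \<Longrightarrow> P a s" by blast
    obtain r where r: "strict_mono r" "P b (s \<circ> r)" using ex[of b s] insert s by blast
    have "strict_mono (s \<circ> r)" using s r by (simp add: strict_mono_o)
    moreover have "\<forall>a\<in>insert b B. P a (s \<circ> r)" using s r her insert.prems by auto
    ultimately show ?case by blast
  qed
  with that show thesis by blast
qed

lemma poly_simplex_subsequence:
  fixes \<sigma> :: "nat \<Rightarrow> 'n::finite polyn"
  assumes \<sigma>: "\<And>n. \<sigma> n \<in> poly_simplex d"
  obtains r f where "strict_mono r" "f \<in> poly_simplex d" "\<And>\<alpha>. (\<lambda>n. \<sigma> (r n) \<alpha>) \<longlonglongrightarrow> f \<alpha>"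
proof -
  obtain s where s: "strict_mono s" "\<And>\<alpha>. \<alpha> \<in> Delta d \<Longrightarrow> convergent (\<lambda>n. \<sigma> (s n) \<alpha>)"
  proof (rule finite_subsequence[of "Delta d :: (nat^'n) set" "\<lambda>\<alpha> s. convergent (\<lambda>n. \<sigma> (s n) \<alpha>)"])
    fix \<alpha> :: "nat^'n" and s :: "nat \<Rightarrow> nat"
    have "bounded (range (\<lambda>n. \<sigma> (s n) \<alpha>))"
      using poly_simplexD(1,4)[OF \<sigma>] by (intro boundedI[of _ 1]) auto
    then show "\<exists>r. strict_mono r \<and> convergent (\<lambda>n. \<sigma> ((s \<circ> r) n) \<alpha>)"
      using bounded_imp_convergent_subsequence[of "\<lambda>n. \<sigma> (s n) \<alpha>"] by (auto simp: convergent_def o_def)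
  next
    fix \<alpha> :: "nat^'n" and s r :: "nat \<Rightarrow> nat"
    assume "convergent (\<lambda>n. \<sigma> (s n) \<alpha>)" "strict_mono r"
    then show "convergent (\<lambda>n. \<sigma> ((s \<circ> r) n) \<alpha>)"
      using convergent_subseq_convergent[of "\<lambda>n. \<sigma> (s n) \<alpha>" r] by (simp add: o_def)
  qed auto
  define f where "f = (\<lambda>\<alpha>. lim (\<lambda>n. \<sigma> (s n) \<alpha>))"
  have lim: "(\<lambda>n. \<sigma> (s n) \<alpha>) \<longlonglongrightarrow> f \<alpha>" for \<alpha>
  proof (cases "\<alpha> \<in> Delta d")
    case True
    then show ?thesis using s(2) by (simp add: f_def convergent_LIMSEQ_iff)
  next
    case False
    then show ?thesis using poly_simplexD(2)[OF \<sigma>] by (simp add: f_def)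
  qed
  have "f \<in> poly_simplex d"
    by (rule poly_simplex_limit[of "\<lambda>n. \<sigma> (s n)"]) (fact \<sigma> lim)+
  then show thesis by (rule that[OF s(1) _ lim])
qed

lemma closure_of_metric:
  "x \<in> mtopology_of m closure_of S \<longleftrightarrow> x \<in> mspace m \<and> (\<forall>e>0. \<exists>y\<in>S. y \<in> mspace m \<and> mdist m x y < e)"
proof -
  interpret Metric_space "mspace m" "mdist m" by simp
  show ?thesis by (auto simp: mtopology_of_def metric_closure_of)
qed

lemma closure_of_metric_sequence:
  assumes "x \<in> mtopology_of m closure_of S"
  obtains \<sigma> where "\<And>n. \<sigma> n \<in> S" "\<And>n. \<sigma> n \<in> mspace m" "(\<lambda>n. mdist m x (\<sigma> n)) \<longlonglongrightarrow> 0"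
proof -
  have "\<forall>n. \<exists>y\<in>S. y \<in> mspace m \<and> mdist m x y < inverse (real (Suc n))"
    using assms unfolding closure_of_metric by simp
  then obtain \<sigma> where \<sigma>: "\<And>n. \<sigma> n \<in> S \<and> \<sigma> n \<in> mspace m \<and> mdist m x (\<sigma> n) < inverse (real (Suc n))"
    by metis
  have "(\<lambda>n. mdist m x (\<sigma> n)) \<longlonglongrightarrow> 0"
    by (rule Lim_null_comparison[OF _ LIMSEQ_inverse_real_of_nat]) (use \<sigma> in \<open>auto intro!: always_eventually less_imp_le\<close>)
  with \<sigma> that show thesis by blast
qed

lemma poly_closure_iff:
  "f \<in> mtopology_of (poly_metric d) closure_of S \<longleftrightarrow>
     (\<exists>\<sigma>. (\<forall>n. \<sigma> n \<in> S \<and> \<sigma> n \<in> poly_simplex d) \<and> (\<forall>\<alpha>. (\<lambda>n. \<sigma> n \<alpha>) \<longlonglongrightarrow> f \<alpha>))"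
proof
  assume f: "f \<in> mtopology_of (poly_metric d) closure_of S"
  then have fs: "f \<in> poly_simplex d" by (simp add: closure_of_metric)
  obtain \<sigma> where \<sigma>: "\<And>n. \<sigma> n \<in> S" "\<And>n. \<sigma> n \<in> poly_simplex d" "(\<lambda>n. poly_dist d f (\<sigma> n)) \<longlonglongrightarrow> 0"
    using closure_of_metric_sequence[OF f] by auto
  then show "\<exists>\<sigma>. (\<forall>n. \<sigma> n \<in> S \<and> \<sigma> n \<in> poly_simplex d) \<and> (\<forall>\<alpha>. (\<lambda>n. \<sigma> n \<alpha>) \<longlonglongrightarrow> f \<alpha>)"
    using poly_dist_tendsto_iff[OF \<sigma>(2) fs] Metric_space.commute[OF Metric_space_poly, of d f] by auto
next
  assume "\<exists>\<sigma>. (\<forall>n. \<sigma> n \<in> S \<and> \<sigma> n \<in> poly_simplex d) \<and> (\<forall>\<alpha>. (\<lambda>n. \<sigma> n \<alpha>) \<longlonglongrightarrow> f \<alpha>)"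
  then obtain \<sigma> where \<sigma>: "\<And>n. \<sigma> n \<in> S" "\<And>n. \<sigma> n \<in> poly_simplex d" "\<And>\<alpha>. (\<lambda>n. \<sigma> n \<alpha>) \<longlonglongrightarrow> f \<alpha>" by blast
  have fs: "f \<in> poly_simplex d" using poly_simplex_limit \<sigma>(2,3) .
  have lim: "(\<lambda>n. poly_dist d (\<sigma> n) f) \<longlonglongrightarrow> 0"
    using poly_dist_tendsto_iff[of \<sigma>, OF \<sigma>(2) fs] \<sigma>(3) by blast
  show "f \<in> mtopology_of (poly_metric d) closure_of S"
    unfolding closure_of_metric mspace_poly_metric mdist_poly_metric
  proof (intro conjI allI impI fs)
    fix e :: real assume "e > 0"
    then have "\<forall>\<^sub>F n in sequentially. poly_dist d (\<sigma> n) f < e" by (rule order_tendstoD(2)[OF lim])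
    then obtain n where "poly_dist d (\<sigma> n) f < e" by (auto simp: eventually_sequentially)
    then show "\<exists>y\<in>S. y \<in> poly_simplex d \<and> poly_dist d f y < e"
      using \<sigma>(1,2)[of n] Metric_space.commute[OF Metric_space_poly, of d f] by auto
  qed
qed

lemma normalize_poly_tendsto:
  assumes "\<And>\<alpha>. (\<lambda>n. g n \<alpha>) \<longlonglongrightarrow> y \<alpha>" "y \<in> poly_simplex d"
  shows "(\<lambda>n. normalize_poly d (g n) \<alpha>) \<longlonglongrightarrow> y \<alpha>"
proof -
  have "(\<lambda>n. g n \<alpha> / (\<Sum>\<beta>\<in>Delta d. g n \<beta>)) \<longlonglongrightarrow> y \<alpha> / (\<Sum>\<beta>\<in>Delta d. y \<beta>)"
    using poly_simplexD(3)[OF assms(2)] by (intro tendsto_intros assms(1)) auto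
  then show ?thesis using poly_simplexD(3)[OF assms(2)] by (simp add: normalize_poly_def)
qed

lemma normalize_exp_in_orbit:
  assumes "f \<in> poly_simplex d"
  shows "normalize_poly d (\<lambda>\<alpha>. exp (a \<bullet> real_vec \<alpha> + c) * f \<alpha>) \<in> orbit d f"
proof -
  let ?g = "\<lambda>\<alpha>. exp (a \<bullet> real_vec \<alpha> + c) * f \<alpha>"
  have S: "0 < sum ?g (Delta d)"
    using poly_simplexD[OF assms] poly_simplex_nonzero[OF assms]
    by (intro sum_pos_of_nonzero) (auto simp: supp_def fun_eq_iff)
  have "normalize_poly d ?g \<alpha> = exp (a \<bullet> real_vec \<alpha> + (c - ln (sum ?g (Delta d)))) * f \<alpha>" for \<alpha>
    using S by (simp add: normalize_poly_def exp_diff exp_add)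
  then show ?thesis
    unfolding orbit_eq[OF assms] using poly_simplex_exp_scale[OF assms] by blast
qed

section \<open>Limits of orbit closures\<close>

text \<open>A sequence of fixed support that converges to \<open>y T\<close> after torus rescalings
  depending on \<open>T\<close>. The locale serves three times: for limits inside a stratum (the
  single cell \<open>J\<close>), for tropical limits, and for families with a prescribed
  subdivision.\<close>

locale degeneration =
  fixes d :: nat and J :: "(nat^'n::finite) set" and x :: "nat \<Rightarrow> 'n polyn"
    and \<T> :: "(nat^'n) set set" and y :: "(nat^'n) set \<Rightarrow> 'n polyn"
    and a :: "(nat^'n) set \<Rightarrow> nat \<Rightarrow> real^'n" and c :: "(nat^'n) set \<Rightarrow> nat \<Rightarrow> real"
  assumes x: "\<And>n. x n \<in> poly_simplex d" "\<And>n. supp (x n) = J"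
    and fin: "finite \<T>" and ne: "\<T> \<noteq> {}"
    and y: "\<And>T. T \<in> \<T> \<Longrightarrow> y T \<in> poly_simplex d" "\<And>T. T \<in> \<T> \<Longrightarrow> supp (y T) = T"
    and lim: "\<And>T \<alpha>. T \<in> \<T> \<Longrightarrow> (\<lambda>n. exp (a T n \<bullet> real_vec \<alpha> + c T n) * x n \<alpha>) \<longlonglongrightarrow> y T \<alpha>"
    and cover: "\<And>p. p \<in> convex hull (real_vec ` J) \<Longrightarrow> \<exists>T\<in>\<T>. p \<in> convex hull (real_vec ` T)"
begin

definition limit :: "'n polyn set" where
  "limit = (\<Union>T\<in>\<T>. orbit_closure d (y T))"

lemma support_bounded: "J \<subseteq> Delta d" "finite J"
proof -
  show "J \<subseteq> Delta d" using x(1)[of 0] x(2)[of 0] by (auto simp: poly_simplex_def)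
  then show "finite J" by (rule finite_subset) simp
qed

lemma x_pos: "\<alpha> \<in> J \<Longrightarrow> 0 < x n \<alpha>" and x_zero: "\<alpha> \<notin> J \<Longrightarrow> x n \<alpha> = 0"
proof -
  have "\<alpha> \<in> J \<longleftrightarrow> x n \<alpha> \<noteq> 0" using x(2)[of n] by (auto simp: supp_def)
  then show "\<alpha> \<in> J \<Longrightarrow> 0 < x n \<alpha>" "\<alpha> \<notin> J \<Longrightarrow> x n \<alpha> = 0"
    using poly_simplexD(1)[OF x(1), of n \<alpha>] by auto
qed

lemma cell_subset: "T \<in> \<T> \<Longrightarrow> T \<subseteq> J"
proof
  fix \<alpha> assume T: "T \<in> \<T>" "\<alpha> \<in> T"
  show "\<alpha> \<in> J"
  proof (rule ccontr)
    assume "\<alpha> \<notin> J"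
    then have "y T \<alpha> = 0" using lim[OF T(1), of \<alpha>] by (simp add: x_zero LIMSEQ_const_iff)
    with y(2)[OF T(1)] T(2) show False by (auto simp: supp_def)
  qed
qed

lemma degeneration_subsequence:
  assumes "strict_mono r"
  shows "degeneration d J (x \<circ> r) \<T> y (\<lambda>T. a T \<circ> r) (\<lambda>T. c T \<circ> r)"
proof
  show "(\<lambda>n. exp ((a T \<circ> r) n \<bullet> real_vec \<alpha> + (c T \<circ> r) n) * (x \<circ> r) n \<alpha>) \<longlonglongrightarrow> y T \<alpha>" if "T \<in> \<T>" for T \<alpha>
    using LIMSEQ_subseq_LIMSEQ[OF lim[OF that, of \<alpha>] assms] by (simp add: o_def)
  show "(x \<circ> r) n \<in> poly_simplex d" "supp ((x \<circ> r) n) = J" for n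
    using x by simp_all
qed (fact fin ne y cover)+

text \<open>
  The barycentre of the support \<open>S\<close> of \<open>z\<close> lies in some \<open>conv T\<close>. Comparing the logarithms of the
  coefficients averaged over \<open>S\<close> and over \<open>T\<close>, where the torus elements cancel, gives \<open>S \<subseteq> T\<close>.
\<close>

lemma limit_point_in_limit:
  assumes z: "\<And>n. z n \<in> orbit d (x n)" and zl: "\<And>\<alpha>. (\<lambda>n. z n \<alpha>) \<longlonglongrightarrow> z' \<alpha>"
  shows "z' \<in> limit"
proof -
  obtain a' c' where zs: "\<And>n. z n \<in> poly_simplex d" and z_eq: "\<And>n \<alpha>. z n \<alpha> = exp (a' n \<bullet> real_vec \<alpha> + c' n) * x n \<alpha>"
    using z unfolding orbit_eq[OF x(1)] by (simp, metis)
  have z's: "z' \<in> poly_simplex d" by (rule poly_simplex_limit[OF zs zl])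
  define S where "S = supp z'"
  have z_pos: "0 < z n \<alpha>" if "\<alpha> \<in> J" for n \<alpha> using x_pos[OF that] by (simp add: z_eq)
  have SJ: "S \<subseteq> J"
  proof
    fix \<alpha> assume "\<alpha> \<in> S"
    show "\<alpha> \<in> J"
    proof (rule ccontr)
      assume "\<alpha> \<notin> J"
      then have "z' \<alpha> = 0" using zl[of \<alpha>] by (simp add: z_eq x_zero LIMSEQ_const_iff)
      with \<open>\<alpha> \<in> S\<close> show False by (simp add: S_def supp_def)
    qed
  qed
  have S: "finite S" "S \<noteq> {}"
    using support_bounded SJ finite_subset poly_simplex_nonzero[OF z's] by (auto simp: S_def supp_def)
  \<comment> \<open>All weights are positive, so that each exponent of \<open>S\<close>, in
    particular one outside \<open>T\<close>, is felt in the average.\<close>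
  define b where "b = 1 / real (card S)"
  have b: "b > 0" "(\<Sum>\<alpha>\<in>S. b) = 1" using S by (auto simp: b_def card_gt_0_iff)
  define p where "p = (\<Sum>\<alpha>\<in>S. b *\<^sub>R real_vec \<alpha>)"
  have "p \<in> convex hull (real_vec ` J)"
    unfolding p_def using S SJ b by (intro convex_sum[OF _ convex_convex_hull]) (auto intro: hull_inc)
  then obtain T where T': "T \<in> \<T>" "p \<in> convex hull (real_vec ` T)" using cover by blast
  have TJ: "T \<subseteq> J" using cell_subset[OF T'(1)] .
  then have finT: "finite T" using support_bounded(2) finite_subset by blast
  obtain u where u: "\<And>t. t \<in> T \<Longrightarrow> 0 \<le> u t" "sum u T = 1" "(\<Sum>t\<in>T. u t *\<^sub>R real_vec t) = p"
    by (rule convex_hull_image_combination[OF finT inj_on_real_vec T'(2)]) (rule that)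
  define k where "k = (\<lambda>n \<alpha>. exp (a T n \<bullet> real_vec \<alpha> + c T n) * x n \<alpha>)"
  have klim: "(\<lambda>n. k n \<alpha>) \<longlonglongrightarrow> y T \<alpha>" for \<alpha> unfolding k_def by (rule lim[OF T'(1)])
  have k_pos: "0 < k n \<alpha>" if "\<alpha> \<in> J" for n \<alpha> using x_pos[OF that] by (simp add: k_def)
  define a1 c1 where "a1 = (\<lambda>n. a' n - a T n)" and "c1 = (\<lambda>n. c' n - c T n)"
  have zk: "z n \<alpha> = exp (a1 n \<bullet> real_vec \<alpha> + c1 n) * k n \<alpha>" for n \<alpha>
    by (simp add: z_eq k_def a1_def c1_def inner_diff_left flip: exp_add mult.assoc)
  have yT_pos: "0 < y T \<alpha>" if "\<alpha> \<in> T" for \<alpha>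
    using y(2)[OF T'(1)] poly_simplexD(1)[OF y(1)[OF T'(1)], of \<alpha>] that by (auto simp: supp_def order_less_le)
  have yT_zero: "y T \<alpha> = 0" if "\<alpha> \<notin> T" for \<alpha>
    using y(2)[OF T'(1)] that by (auto simp: supp_def)
  have "S \<subseteq> T"
  proof (rule ccontr)
    assume "\<not> S \<subseteq> T"
    then obtain \<alpha>0 where \<alpha>0: "\<alpha>0 \<in> S" "\<alpha>0 \<notin> T" by blast
    have lnz: "ln (z n \<alpha>) = (a1 n \<bullet> real_vec \<alpha> + c1 n) + ln (k n \<alpha>)" if "\<alpha> \<in> J" for n \<alpha>
      using k_pos[OF that, of n] by (simp add: zk ln_mult_pos)
    \<comment> \<open>Both averages of the affine function given by \<open>a1 n\<close> and
      \<open>c1 n\<close> equal its value at \<open>p\<close>. The coefficients of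
      \<open>z n\<close> are at most 1, so its logarithmic average over \<open>T\<close> is
      nonpositive, which bounds this common value from above.\<close>
    have key: "(\<Sum>\<alpha>\<in>S. b * ln (z n \<alpha>)) \<le> (\<Sum>\<alpha>\<in>S. b * ln (k n \<alpha>)) - (\<Sum>\<beta>\<in>T. u \<beta> * ln (k n \<beta>))" for n
    proof -
      have "(\<Sum>\<alpha>\<in>S. b * ln (z n \<alpha>)) = (\<Sum>\<alpha>\<in>S. b * (a1 n \<bullet> real_vec \<alpha> + c1 n)) + (\<Sum>\<alpha>\<in>S. b * ln (k n \<alpha>))"
        using SJ by (auto simp: lnz distrib_left sum.distrib[symmetric] intro!: sum.cong)
      also have "(\<Sum>\<alpha>\<in>S. b * (a1 n \<bullet> real_vec \<alpha> + c1 n)) = a1 n \<bullet> p + c1 n"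
        unfolding p_def by (rule affine_functional_combination[symmetric]) (rule b(2))
      finally have 1: "(\<Sum>\<alpha>\<in>S. b * ln (z n \<alpha>)) = a1 n \<bullet> p + c1 n + (\<Sum>\<alpha>\<in>S. b * ln (k n \<alpha>))" .
      have "(\<Sum>\<beta>\<in>T. u \<beta> * ln (z n \<beta>)) = (\<Sum>\<beta>\<in>T. u \<beta> * (a1 n \<bullet> real_vec \<beta> + c1 n)) + (\<Sum>\<beta>\<in>T. u \<beta> * ln (k n \<beta>))"
        using TJ by (auto simp: lnz distrib_left sum.distrib[symmetric] intro!: sum.cong)
      also have "(\<Sum>\<beta>\<in>T. u \<beta> * (a1 n \<bullet> real_vec \<beta> + c1 n)) = a1 n \<bullet> p + c1 n"
        unfolding u(3)[symmetric] by (rule affine_functional_combination[symmetric]) (rule u(2))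
      finally have 2: "(\<Sum>\<beta>\<in>T. u \<beta> * ln (z n \<beta>)) = a1 n \<bullet> p + c1 n + (\<Sum>\<beta>\<in>T. u \<beta> * ln (k n \<beta>))" .
      have "(\<Sum>\<beta>\<in>T. u \<beta> * ln (z n \<beta>)) \<le> 0"
        using u(1) TJ z_pos poly_simplexD(4)[OF zs]
        by (intro sum_nonpos mult_nonneg_nonpos) (auto simp: ln_le_zero_iff subset_iff)
      with 1 2 show ?thesis by linarith
    qed
    \<comment> \<open>Every term except that of \<open>\<alpha>0\<close> is controlled: the averages
      for \<open>z n\<close> over \<open>S\<close> and for \<open>k n\<close> over \<open>T\<close>
      converge, and eventually \<open>k n \<alpha> < y T \<alpha> + 1\<close>. This keeps
      \<open>k n \<alpha>0\<close> away from 0, although it tends to \<open>y T \<alpha>0\<close>,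
      which is 0.\<close>
    define L where "L = (\<Sum>\<alpha>\<in>S. b * ln (z' \<alpha>)) + (\<Sum>\<beta>\<in>T. u \<beta> * ln (y T \<beta>)) - (\<Sum>\<alpha>\<in>S - {\<alpha>0}. b * ln (y T \<alpha> + 1))"
    have z'_pos: "0 < z' \<alpha>" if "\<alpha> \<in> S" for \<alpha>
      using that poly_simplexD(1)[OF z's, of \<alpha>] by (auto simp: S_def supp_def order_less_le)
    have "(\<lambda>n. (\<Sum>\<alpha>\<in>S. b * ln (z n \<alpha>)) + (\<Sum>\<beta>\<in>T. u \<beta> * ln (k n \<beta>)) - (\<Sum>\<alpha>\<in>S - {\<alpha>0}. b * ln (y T \<alpha> + 1))) \<longlonglongrightarrow> L"
      unfolding L_def by (intro tendsto_intros zl klim) (use z'_pos yT_pos in force)+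
    then have ev1: "\<forall>\<^sub>F n in sequentially. L - 1 < (\<Sum>\<alpha>\<in>S. b * ln (z n \<alpha>)) + (\<Sum>\<beta>\<in>T. u \<beta> * ln (k n \<beta>)) - (\<Sum>\<alpha>\<in>S - {\<alpha>0}. b * ln (y T \<alpha> + 1))"
      by (rule order_tendstoD) simp
    have "\<forall>\<^sub>F n in sequentially. k n \<alpha> < y T \<alpha> + 1" for \<alpha>
      by (rule order_tendstoD(2)[OF klim]) simp
    then have ev2: "\<forall>\<^sub>F n in sequentially. \<forall>\<alpha>\<in>S. k n \<alpha> < y T \<alpha> + 1"
      using S(1) by (simp add: eventually_ball_finite_distrib)
    have ev: "\<forall>\<^sub>F n in sequentially. exp ((L - 1) / b) \<le> k n \<alpha>0"
      using ev1 ev2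
    proof eventually_elim
      case (elim n)
      have "(\<Sum>\<alpha>\<in>S - {\<alpha>0}. b * ln (k n \<alpha>)) \<le> (\<Sum>\<alpha>\<in>S - {\<alpha>0}. b * ln (y T \<alpha> + 1))"
      proof (intro sum_mono mult_left_mono)
        fix \<alpha> assume "\<alpha> \<in> S - {\<alpha>0}"
        then have "0 < k n \<alpha>" "k n \<alpha> \<le> y T \<alpha> + 1" using k_pos SJ elim(2) by (auto intro: less_imp_le)
        then show "ln (k n \<alpha>) \<le> ln (y T \<alpha> + 1)" by simp
      qed (use b in auto)
      moreover have "(\<Sum>\<alpha>\<in>S. b * ln (k n \<alpha>)) = b * ln (k n \<alpha>0) + (\<Sum>\<alpha>\<in>S - {\<alpha>0}. b * ln (k n \<alpha>))"
        using S \<alpha>0 by (simp add: sum.remove)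
      ultimately have "L - 1 \<le> b * ln (k n \<alpha>0)" using elim(1) key[of n] by linarith
      then have "(L - 1) / b \<le> ln (k n \<alpha>0)" using b by (simp add: field_simps)
      then show ?case using k_pos[of \<alpha>0 n] \<alpha>0 SJ by (auto simp: ln_ge_iff)
    qed
    have "exp ((L - 1) / b) \<le> y T \<alpha>0"
      by (rule tendsto_lowerbound[OF klim ev]) simp
    then show False using yT_zero[OF \<alpha>0(2)] by simp
  qed
  \<comment> \<open>The torus elements that carry \<open>k n\<close> to \<open>z n\<close>, applied
    to \<open>y T\<close>: on \<open>T\<close> the ratio of \<open>y T\<close> to \<open>k n\<close>
    tends to 1, and off \<open>T\<close> both \<open>g n\<close> and \<open>z'\<close>
    vanish.\<close>
  define g where "g = (\<lambda>n \<alpha>. exp (a1 n \<bullet> real_vec \<alpha> + c1 n) * y T \<alpha>)"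
  have glim: "(\<lambda>n. g n \<alpha>) \<longlonglongrightarrow> z' \<alpha>" for \<alpha>
  proof (cases "\<alpha> \<in> T")
    case True
    have "(\<lambda>n. z n \<alpha> * (y T \<alpha> / k n \<alpha>)) \<longlonglongrightarrow> z' \<alpha> * (y T \<alpha> / y T \<alpha>)"
      using yT_pos[OF True] by (intro tendsto_intros zl klim) auto
    moreover have "z n \<alpha> * (y T \<alpha> / k n \<alpha>) = g n \<alpha>" for n
      using k_pos[of \<alpha> n] True TJ by (auto simp: zk g_def)
    ultimately show ?thesis using yT_pos[OF True] by simp
  next
    case False
    then have "z' \<alpha> = 0" using \<open>S \<subseteq> T\<close> by (auto simp: S_def supp_def)
    then show ?thesis using yT_zero[OF False] by (simp add: g_def)
  qed
  have "normalize_poly d (g n) \<in> orbit d (y T)" for n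
    unfolding g_def by (rule normalize_exp_in_orbit[OF y(1)[OF T'(1)]])
  moreover have "normalize_poly d (g n) \<in> poly_simplex d" for n
    unfolding g_def by (rule poly_simplex_exp_scale[OF y(1)[OF T'(1)]])
  ultimately have "z' \<in> orbit_closure d (y T)"
    unfolding orbit_closure_def poly_closure_iff
    using normalize_poly_tendsto[OF glim z's] by (intro exI[of _ "\<lambda>n. normalize_poly d (g n)"]) auto
  then show ?thesis using T'(1) by (auto simp: limit_def)
qed

section \<open>Hausdorff convergence of the orbit closures\<close>

lemma orbit_point_is_limit:
  assumes T': "T \<in> \<T>" and w: "w \<in> orbit d (y T)"
  obtains z where "\<And>n. z n \<in> orbit d (x n)" "\<And>\<alpha>. (\<lambda>n. z n \<alpha>) \<longlonglongrightarrow> w \<alpha>"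
proof -
  obtain a' c' where ws: "w \<in> poly_simplex d" and w_eq: "\<And>\<alpha>. w \<alpha> = exp (a' \<bullet> real_vec \<alpha> + c') * y T \<alpha>"
    using w unfolding orbit_eq[OF y(1)[OF T']] by auto
  define g where "g = (\<lambda>n \<alpha>. exp ((a T n + a') \<bullet> real_vec \<alpha> + (c T n + c')) * x n \<alpha>)"
  have "(\<lambda>n. g n \<alpha>) \<longlonglongrightarrow> w \<alpha>" for \<alpha>
  proof -
    have "(\<lambda>n. exp (a' \<bullet> real_vec \<alpha> + c') * (exp (a T n \<bullet> real_vec \<alpha> + c T n) * x n \<alpha>)) \<longlonglongrightarrow> w \<alpha>"
      unfolding w_eq by (intro tendsto_intros lim T')
    moreover have "exp (a' \<bullet> real_vec \<alpha> + c') * (exp (a T n \<bullet> real_vec \<alpha> + c T n) * x n \<alpha>) = g n \<alpha>" for n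
      by (simp add: g_def inner_add_left exp_add)
    ultimately show ?thesis by simp
  qed
  from normalize_poly_tendsto[OF this ws] normalize_exp_in_orbit[OF x(1)] that[of "\<lambda>n. normalize_poly d (g n)"]
  show thesis unfolding g_def by blast
qed

text \<open>Uniformity comes from compactness: bad points along a subsequence would accumulate at a
  point of \<open>limit\<close> by \<open>limit_point_in_limit\<close>.\<close>

lemma orbit_closures_upper:
  assumes "e > 0"
  shows "\<forall>\<^sub>F n in sequentially. \<forall>z\<in>orbit_closure d (x n). \<exists>w\<in>limit. poly_dist d z w < e"
proof (rule ccontr)
  assume "\<not> ?thesis"
  then obtain r :: "nat \<Rightarrow> nat" where r: "strict_mono r" "\<forall>n. \<exists>z\<in>orbit_closure d (x (r n)). \<forall>w\<in>limit. e \<le> poly_dist d z w"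
    using not_eventually_sequentiallyD[of "\<lambda>n. \<forall>z\<in>orbit_closure d (x n). \<exists>w\<in>limit. poly_dist d z w < e"]
    by (auto simp: not_less)
  interpret P: Metric_space "poly_simplex d :: 'n polyn set" "poly_dist d" by (rule Metric_space_poly)
  have limS: "limit \<subseteq> poly_simplex d"
    by (auto simp: limit_def orbit_closure_def closure_of_metric)
  \<comment> \<open>\<open>limit_point_in_limit\<close> concerns orbits, so a bad point of the
    closure is replaced by a nearby point of the orbit at the cost of \<open>e / 2\<close>.\<close>
  have "\<exists>z\<in>orbit d (x (r n)). \<forall>w\<in>limit. e / 2 \<le> poly_dist d z w" for n
  proof -
    obtain z where z: "z \<in> orbit_closure d (x (r n))" "\<And>w. w \<in> limit \<Longrightarrow> e \<le> poly_dist d z w" using r(2) by blast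
    then obtain z1 where z1: "z1 \<in> orbit d (x (r n))" "z1 \<in> poly_simplex d" "poly_dist d z z1 < e / 2" and zs: "z \<in> poly_simplex d"
      using \<open>e > 0\<close> unfolding orbit_closure_def closure_of_metric by (auto dest: spec[of _ "e / 2"])
    have "e / 2 \<le> poly_dist d z1 w" if "w \<in> limit" for w
      using z(2)[OF that] z1(3) P.triangle[OF zs z1(2), of w] limS that by auto
    with z1 show ?thesis by blast
  qed
  then obtain z where z: "\<And>n. z n \<in> orbit d (x (r n))" "\<And>n w. w \<in> limit \<Longrightarrow> e / 2 \<le> poly_dist d (z n) w" by metis
  have zs: "z n \<in> poly_simplex d" for n using z(1)[of n] by (simp add: orbit_eq x)
  obtain s f where s: "strict_mono s" "f \<in> poly_simplex d" "\<And>\<alpha>. (\<lambda>n. z (s n) \<alpha>) \<longlonglongrightarrow> f \<alpha>"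
    using poly_simplex_subsequence[of z d] zs by metis
  interpret D: degeneration d J "x \<circ> (r \<circ> s)" \<T> y "\<lambda>T. a T \<circ> (r \<circ> s)" "\<lambda>T. c T \<circ> (r \<circ> s)"
    by (rule degeneration_subsequence) (use r s in \<open>simp add: strict_mono_o\<close>)
  have "f \<in> D.limit" by (rule D.limit_point_in_limit[OF _ s(3)]) (use z in auto)
  then have f: "f \<in> limit" by (simp add: D.limit_def limit_def)
  have "(\<lambda>n. poly_dist d (z (s n)) f) \<longlonglongrightarrow> 0"
    using poly_dist_tendsto_iff[of "\<lambda>n. z (s n)"] zs s by blast
  then have "e / 2 \<le> 0"
    by (rule tendsto_lowerbound) (use z(2)[OF f] in auto)
  then show False using \<open>e > 0\<close> by simp
qed

text \<open>Bad points accumulate in \<open>limit\<close>, which is closed as a finite union. An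
  orbit point near the accumulation point is a limit of points in the orbits of \<open>x n\<close>;
  each of the three distances involved gets \<open>e / 3\<close>.\<close>

lemma orbit_closures_lower:
  assumes "e > 0"
  shows "\<forall>\<^sub>F n in sequentially. \<forall>w\<in>limit. \<exists>z\<in>orbit_closure d (x n). poly_dist d w z < e"
proof (rule ccontr)
  assume "\<not> ?thesis"
  then obtain r :: "nat \<Rightarrow> nat" where r: "strict_mono r" "\<forall>n. \<exists>w\<in>limit. \<forall>z\<in>orbit_closure d (x (r n)). e \<le> poly_dist d w z"
    using not_eventually_sequentiallyD[of "\<lambda>n. \<forall>w\<in>limit. \<exists>z\<in>orbit_closure d (x n). poly_dist d w z < e"]
    by (auto simp: not_less)
  interpret P: Metric_space "poly_simplex d :: 'n polyn set" "poly_dist d" by (rule Metric_space_poly)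
  have limS: "limit \<subseteq> poly_simplex d"
    by (auto simp: limit_def orbit_closure_def closure_of_metric)
  obtain w where w: "\<And>n. w n \<in> limit" "\<And>n z. z \<in> orbit_closure d (x (r n)) \<Longrightarrow> e \<le> poly_dist d (w n) z"
    using r(2) by metis
  have ws: "w n \<in> poly_simplex d" for n using w(1) limS by blast
  obtain s f where s: "strict_mono s" "f \<in> poly_simplex d" "\<And>\<alpha>. (\<lambda>n. w (s n) \<alpha>) \<longlonglongrightarrow> f \<alpha>"
    using poly_simplex_subsequence[of w d] ws by metis
  have "f \<in> limit"
  proof -
    have "closedin (mtopology_of (poly_metric d)) limit"
      unfolding limit_def using fin by (intro closedin_Union) (auto simp: orbit_closure_def)
    then have "limit = mtopology_of (poly_metric d) closure_of limit" by (simp add: closure_of_closedin)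
    moreover have "f \<in> mtopology_of (poly_metric d) closure_of limit"
      unfolding poly_closure_iff using w(1) ws s(3) by (intro exI[of _ "\<lambda>n. w (s n)"]) simp
    ultimately show ?thesis by simp
  qed
  then obtain T where T': "T \<in> \<T>" "f \<in> orbit_closure d (y T)" by (auto simp: limit_def)
  have "e / 3 > 0" using \<open>e > 0\<close> by simp
  with T'(2) obtain f1 where f1: "f1 \<in> orbit d (y T)" "f1 \<in> poly_simplex d" "poly_dist d f f1 < e / 3"
    unfolding orbit_closure_def closure_of_metric mspace_poly_metric mdist_poly_metric by blast
  obtain z where z: "\<And>n. z n \<in> orbit d (x n)" "\<And>\<alpha>. (\<lambda>n. z n \<alpha>) \<longlonglongrightarrow> f1 \<alpha>"
    using orbit_point_is_limit[OF T'(1) f1(1)] by metis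
  have zs: "z n \<in> poly_simplex d" for n using z(1)[of n] by (simp add: orbit_eq x)
  have l1: "(\<lambda>n. poly_dist d (w (s n)) f) \<longlonglongrightarrow> 0"
    using poly_dist_tendsto_iff[of "\<lambda>n. w (s n)"] ws s by blast
  have "(\<lambda>n. poly_dist d (z n) f1) \<longlonglongrightarrow> 0"
    using poly_dist_tendsto_iff[of z] zs f1 z by blast
  from LIMSEQ_subseq_LIMSEQ[OF this, of "r \<circ> s"]
  have l2: "(\<lambda>n. poly_dist d (z (r (s n))) f1) \<longlonglongrightarrow> 0"
    using r s by (simp add: o_def strict_mono_def)
  have "\<forall>\<^sub>F n in sequentially. False"
    using order_tendstoD(2)[OF l1 \<open>e / 3 > 0\<close>] order_tendstoD(2)[OF l2 \<open>e / 3 > 0\<close>]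
  proof eventually_elim
    case (elim n)
    let ?z = "z (r (s n))"
    have "?z \<in> orbit_closure d (x (r (s n)))"
      unfolding orbit_closure_def using z(1) zs by (intro subsetD[OF closure_of_subset]) (auto simp: orbit_eq x)
    from w(2)[OF this] have "e \<le> poly_dist d (w (s n)) ?z" .
    also have "\<dots> \<le> poly_dist d (w (s n)) f + poly_dist d f ?z"
      using P.triangle[of "w (s n)" f ?z] ws zs s by blast
    also have "\<dots> \<le> poly_dist d (w (s n)) f + (poly_dist d f f1 + poly_dist d f1 ?z)"
      using P.triangle[of f f1 ?z] f1 zs s by simp
    also have "\<dots> < e" using elim f1(3) P.commute[of f1 ?z] by simp
    finally show ?case by simp
  qed
  then show False by simp
qed

end

section \<open>Hyperspaces\<close>

lemma hausdorff_dist_le: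
  assumes KL: "K \<in> hyperspace m" "L \<in> hyperspace m"
    and "\<And>x. x \<in> K \<Longrightarrow> \<exists>y\<in>L. mdist m x y \<le> e" "\<And>y. y \<in> L \<Longrightarrow> \<exists>x\<in>K. mdist m y x \<le> e"
  shows "hausdorff_dist m K L \<le> e"
proof -
  interpret hausdorff_facts m .
  have ne: "K \<noteq> {}" "L \<noteq> {}" using KL by (auto simp: hyperspace_def)
  have "(SUP x\<in>K. INF y\<in>L. mdist m x y) \<le> e"
  proof (rule cSUP_least[OF ne(1)])
    fix x assume "x \<in> K"
    then obtain y where "y \<in> L" "mdist m x y \<le> e" using assms(3) by blast
    then show "(INF y\<in>L. mdist m x y) \<le> e" using I_le[of y L x] by linarith
  qed
  moreover have "(SUP y\<in>L. INF x\<in>K. mdist m x y) \<le> e"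
  proof (rule cSUP_least[OF ne(2)])
    fix y assume "y \<in> L"
    then obtain x where "x \<in> K" "mdist m y x \<le> e" using assms(4) by blast
    then show "(INF x\<in>K. mdist m x y) \<le> e" using I_le[of x K y] by (simp add: mdist_commute)
  qed
  ultimately show ?thesis using KL by (simp add: hausdorff_dist_def)
qed

lemma hausdorff_dist_less:
  assumes KL: "K \<in> hyperspace m" "L \<in> hyperspace m" and "hausdorff_dist m K L < e" "x \<in> K"
  shows "\<exists>y\<in>L. mdist m x y < e"
proof -
  interpret hausdorff_facts m .
  have "L \<noteq> {}" using KL by (auto simp: hyperspace_def)
  have "(INF y\<in>L. mdist m x y) \<le> (SUP x\<in>K. INF y\<in>L. mdist m x y)"
    using I_le_D KL \<open>x \<in> K\<close> by blast
  also have "\<dots> < e" using assms by (simp add: hausdorff_dist_def)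
  finally have lt: "(INF y\<in>L. mdist m x y) < e" .
  show ?thesis
  proof (rule ccontr)
    assume "\<not> ?thesis"
    then have "e \<le> (INF y\<in>L. mdist m x y)"
      by (intro cINF_greatest[OF \<open>L \<noteq> {}\<close>]) (auto simp: not_less)
    with lt show False by simp
  qed
qed

lemma compact_poly_simplex:
  assumes "closedin (mtopology_of (poly_metric d :: 'n::finite polyn metric)) K"
  shows "compactin (mtopology_of (poly_metric d)) K"
proof -
  interpret P: Metric_space "poly_simplex d :: 'n polyn set" "poly_dist d" by (rule Metric_space_poly)
  have top: "mtopology_of (poly_metric d :: 'n polyn metric) = P.mtopology"
    by (simp add: mtopology_of_def)
  have "compactin P.mtopology (poly_simplex d)"
    unfolding P.compactin_sequentially
  proof (intro conjI subset_refl allI impI)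
    fix \<sigma> :: "nat \<Rightarrow> 'n polyn" assume "range \<sigma> \<subseteq> poly_simplex d"
    then have \<sigma>: "\<sigma> n \<in> poly_simplex d" for n by blast
    obtain r f where r: "strict_mono r" "f \<in> poly_simplex d" "\<And>\<alpha>. (\<lambda>n. \<sigma> (r n) \<alpha>) \<longlonglongrightarrow> f \<alpha>"
      using poly_simplex_subsequence[of \<sigma> d] \<sigma> by metis
    have "(\<lambda>n. poly_dist d (\<sigma> (r n)) f) \<longlonglongrightarrow> 0"
      using poly_dist_tendsto_iff[of "\<lambda>n. \<sigma> (r n)"] \<sigma> r by blast
    then have "limitin P.mtopology (\<sigma> \<circ> r) f sequentially"
      using r(2) \<sigma> by (simp add: P.limitin_metric_dist_null)
    then show "\<exists>l r. l \<in> poly_simplex d \<and> strict_mono r \<and> limitin P.mtopology (\<sigma> \<circ> r) l sequentially"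
      using r by blast
  qed
  then show ?thesis
    using assms unfolding top by (metis closed_compactin closedin_subset P.topspace_mtopology)
qed

lemma hyperspace_poly_iff:
  assumes "closedin (mtopology_of (poly_metric d :: 'n::finite polyn metric)) K"
  shows "K \<in> hyperspace (submetric (poly_metric d) X) \<longleftrightarrow> K \<noteq> {} \<and> K \<subseteq> X"
proof -
  have "compactin (mtopology_of (poly_metric d)) K"
    using compact_poly_simplex[OF assms] .
  then show ?thesis
    by (simp only: hyperspace_def mtopology_of_submetric compactin_subtopology mem_Collect_eq simp_thms)
qed

section \<open>Asymptotic sign vectors\<close>

definition settled :: "(nat \<Rightarrow> real) \<Rightarrow> bool" where
  "settled u \<longleftrightarrow> convergent u \<or> filterlim u at_top sequentially \<or> filterlim u at_bot sequentially"

text \<open>By compactness of the extended reals some subsequence has an extended real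
  limit.\<close>

lemma settled_subsequence:
  fixes u :: "nat \<Rightarrow> real"
  shows "\<exists>r. strict_mono r \<and> settled (u \<circ> r)"
proof -
  obtain l :: ereal and r where r: "strict_mono r" "((\<lambda>n. ereal (u n)) \<circ> r) \<longlonglongrightarrow> l"
    using compact_complete_linorder[of "\<lambda>n. ereal (u n)"] by blast
  have "settled (u \<circ> r)"
  proof (cases l)
    case (real x)
    then have "(u \<circ> r) \<longlonglongrightarrow> x" using r(2) by (simp add: o_def)
    then show ?thesis by (auto simp: settled_def convergent_def)
  next
    case PInf
    then show ?thesis using r(2) by (simp add: settled_def o_def tendsto_PInfty_eq_at_top)
  next
    case MInf
    then show ?thesis using r(2)
      by (simp add: settled_def o_def filterlim_uminus_at_bot tendsto_PInfty_eq_at_top[symmetric] flip: uminus_ereal.simps(1))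
        (use ereal_Lim_uminus[of "\<lambda>n. ereal (u (r n))" "- \<infinity>" sequentially] in simp)
  qed
  with r(1) show ?thesis by blast
qed

lemma settled_subseq:
  assumes "settled u" "strict_mono r"
  shows "settled (u \<circ> r)"
proof -
  have "filterlim r sequentially sequentially" using assms(2) by (rule filterlim_subseq)
  then show ?thesis
    using assms convergent_subseq_convergent[OF _ assms(2)] filterlim_compose[of u _ sequentially r]
    unfolding settled_def by (auto simp: o_def)
qed

definition pairing :: "'a set \<Rightarrow> ('a \<Rightarrow> real) \<Rightarrow> ('a \<Rightarrow> real) \<Rightarrow> real" where
  "pairing J c v = (\<Sum>\<alpha>\<in>J. c \<alpha> * v \<alpha>)"

lemma pairing_linear: "pairing J c (\<lambda>\<alpha>. u \<alpha> + s * v \<alpha>) = pairing J c u + s * pairing J c v"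
  by (simp add: pairing_def distrib_left sum.distrib sum_distrib_left mult.left_commute)

lemma pairing_diff: "pairing J c (\<lambda>\<alpha>. u \<alpha> - v \<alpha>) = pairing J c u - pairing J c v"
  by (simp add: pairing_def right_diff_distrib sum_subtractf)

text \<open>If the new functional is nonzero on the common kernel of the earlier ones, a correction
  along that kernel makes it vanish without disturbing them. Otherwise it already vanishes, because
  the corrected vectors lie in that kernel.\<close>

lemma bounded_correction:
  fixes v :: "nat \<Rightarrow> 'a \<Rightarrow> real"
  assumes "finite \<Lambda>" "\<And>c. c \<in> \<Lambda> \<Longrightarrow> \<exists>B. \<forall>n. \<bar>pairing J c (v n)\<bar> \<le> B"
  shows "\<exists>r. (\<forall>c\<in>\<Lambda>. \<forall>n. pairing J c (\<lambda>\<alpha>. v n \<alpha> - r n \<alpha>) = 0) \<and> (\<forall>\<alpha>. \<exists>B. \<forall>n::nat. \<bar>r n \<alpha> :: real\<bar> \<le> B)"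
  using assms
proof (induction \<Lambda> rule: finite_induct)
  case empty
  then show ?case by (intro exI[of _ "\<lambda>_ _. 0"]) auto
next
  case (insert c \<Lambda>)
  then obtain r :: "nat \<Rightarrow> 'a \<Rightarrow> real"
    where r: "\<forall>c\<in>\<Lambda>. \<forall>n. pairing J c (\<lambda>\<alpha>. v n \<alpha> - r n \<alpha>) = 0" "\<forall>\<alpha>. \<exists>B. \<forall>n. \<bar>r n \<alpha>\<bar> \<le> B"
    by auto
  let ?v = "\<lambda>n \<alpha>. v n \<alpha> - r n \<alpha>"
  show ?case
  proof (cases "\<exists>u. (\<forall>c'\<in>\<Lambda>. pairing J c' u = 0) \<and> pairing J c u \<noteq> 0")
    case False
    then have "pairing J c (?v n) = 0" for n using r(1) by blast
    with r show ?thesis by (intro exI[of _ r]) auto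
  next
    case True
    then obtain u where u: "\<And>c'. c' \<in> \<Lambda> \<Longrightarrow> pairing J c' u = 0" "pairing J c u \<noteq> 0" by blast
    define s where "s = (\<lambda>n. pairing J c (?v n) / pairing J c u)"
    obtain B where B: "\<And>n. \<bar>pairing J c (v n)\<bar> \<le> B" using insert.prems by blast
    obtain Br where Br: "\<And>\<alpha> n. \<bar>r n \<alpha>\<bar> \<le> Br \<alpha>" using r(2) by metis
    have "\<bar>pairing J c (r n)\<bar> \<le> (\<Sum>\<alpha>\<in>J. \<bar>c \<alpha>\<bar> * Br \<alpha>)" for n
      unfolding pairing_def using Br
      by (intro order_trans[OF sum_abs] sum_mono) (auto simp: abs_mult intro: mult_left_mono)
    then have "\<bar>pairing J c (?v n)\<bar> \<le> B + (\<Sum>\<alpha>\<in>J. \<bar>c \<alpha>\<bar> * Br \<alpha>)" for n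
      unfolding pairing_diff by (intro order_trans[OF abs_triangle_ineq4] add_mono B)
    then have s: "\<bar>s n\<bar> \<le> (B + (\<Sum>\<alpha>\<in>J. \<bar>c \<alpha>\<bar> * Br \<alpha>)) / \<bar>pairing J c u\<bar>" for n
      by (simp add: s_def divide_right_mono)
    define r' where "r' = (\<lambda>n \<alpha>. r n \<alpha> + s n * u \<alpha>)"
    have v': "(\<lambda>\<alpha>. v n \<alpha> - r' n \<alpha>) = (\<lambda>\<alpha>. ?v n \<alpha> + (- s n) * u \<alpha>)" for n
      by (auto simp: r'_def)
    have "pairing J c' (\<lambda>\<alpha>. v n \<alpha> - r' n \<alpha>) = 0" if "c' \<in> insert c \<Lambda>" for c' n
      unfolding v' pairing_linear using that u r(1) by (auto simp: s_def)
    moreover have "\<exists>B. \<forall>n. \<bar>r' n \<alpha>\<bar> \<le> B" for \<alpha>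
    proof (intro exI allI)
      fix n
      show "\<bar>r' n \<alpha>\<bar> \<le> Br \<alpha> + (B + (\<Sum>\<alpha>\<in>J. \<bar>c \<alpha>\<bar> * Br \<alpha>)) / \<bar>pairing J c u\<bar> * \<bar>u \<alpha>\<bar>"
        unfolding r'_def using Br[of n \<alpha>] mult_right_mono[OF s[of n], of "\<bar>u \<alpha>\<bar>"]
        by (intro order_trans[OF abs_triangle_ineq]) (auto simp: abs_mult)
    qed
    ultimately show ?thesis by blast
  qed
qed

text \<open>
  The vector \<open>w\<close> is a late member of the sequence, corrected by a bounded amount so that the
  bounded functionals vanish on it.
\<close>

lemma asymptotic_sign_vector:
  fixes v :: "nat \<Rightarrow> 'a \<Rightarrow> real"
  assumes fin: "finite \<Lambda>" and settled: "\<And>c. c \<in> \<Lambda> \<Longrightarrow> settled (\<lambda>n. pairing J c (v n))"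
  obtains w where "\<And>c. c \<in> \<Lambda> \<Longrightarrow> convergent (\<lambda>n. pairing J c (v n)) \<Longrightarrow> pairing J c w = 0"
    "\<And>c. c \<in> \<Lambda> \<Longrightarrow> filterlim (\<lambda>n. pairing J c (v n)) at_top sequentially \<Longrightarrow> pairing J c w > 0"
    "\<And>c. c \<in> \<Lambda> \<Longrightarrow> filterlim (\<lambda>n. pairing J c (v n)) at_bot sequentially \<Longrightarrow> pairing J c w < 0"
proof -
  define \<Lambda>0 where "\<Lambda>0 = {c \<in> \<Lambda>. convergent (\<lambda>n. pairing J c (v n))}"
  have "\<exists>B. \<forall>n. \<bar>pairing J c (v n)\<bar> \<le> B" if "c \<in> \<Lambda>0" for c
    using that Bseq_def convergent_imp_Bseq[of "\<lambda>n. pairing J c (v n)"] by (auto simp: \<Lambda>0_def Bseq_def)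
  moreover have "finite \<Lambda>0" using fin by (simp add: \<Lambda>0_def)
  ultimately obtain r where r: "\<And>c n. c \<in> \<Lambda>0 \<Longrightarrow> pairing J c (\<lambda>\<alpha>. v n \<alpha> - r n \<alpha>) = 0" "\<And>\<alpha>. \<exists>B. \<forall>n::nat. \<bar>r n \<alpha>\<bar> \<le> B"
    using bounded_correction[of \<Lambda>0 J v] by blast
  obtain Br where Br: "\<And>\<alpha> n. \<bar>r n \<alpha>\<bar> \<le> Br \<alpha>" using r(2) by metis
  \<comment> \<open>A bound for the effect of the correction on \<open>c\<close>; the index
    \<open>N\<close> below is so late that the unbounded functionals exceed it.\<close>
  define R where "R = (\<lambda>c. \<Sum>\<alpha>\<in>J. \<bar>c \<alpha>\<bar> * Br \<alpha>)"
  have R: "\<bar>pairing J c (r n)\<bar> \<le> R c" for c n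
    unfolding pairing_def R_def using Br
    by (intro order_trans[OF sum_abs] sum_mono) (auto simp: abs_mult intro: mult_left_mono)
  have "\<forall>\<^sub>F n in sequentially. (filterlim (\<lambda>n. pairing J c (v n)) at_top sequentially \<longrightarrow> R c < pairing J c (v n)) \<and>
      (filterlim (\<lambda>n. pairing J c (v n)) at_bot sequentially \<longrightarrow> pairing J c (v n) < - R c)" for c
    by (intro eventually_conj) (auto simp: filterlim_at_top_dense filterlim_at_bot_dense)
  then have "\<forall>\<^sub>F n in sequentially. \<forall>c\<in>\<Lambda>. (filterlim (\<lambda>n. pairing J c (v n)) at_top sequentially \<longrightarrow> R c < pairing J c (v n)) \<and>
      (filterlim (\<lambda>n. pairing J c (v n)) at_bot sequentially \<longrightarrow> pairing J c (v n) < - R c)"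
    using fin by (simp add: eventually_ball_finite_distrib)
  then obtain N where N: "\<And>c. c \<in> \<Lambda> \<Longrightarrow> filterlim (\<lambda>n. pairing J c (v n)) at_top sequentially \<Longrightarrow> R c < pairing J c (v N)"
      "\<And>c. c \<in> \<Lambda> \<Longrightarrow> filterlim (\<lambda>n. pairing J c (v n)) at_bot sequentially \<Longrightarrow> pairing J c (v N) < - R c"
    unfolding eventually_sequentially by blast
  let ?w = "\<lambda>\<alpha>. v N \<alpha> - r N \<alpha>"
  show thesis
  proof (rule that[of ?w])
    fix c assume c: "c \<in> \<Lambda>"
    show "pairing J c ?w = 0" if "convergent (\<lambda>n. pairing J c (v n))"
      using that c r(1) by (simp add: \<Lambda>0_def)
    show "pairing J c ?w > 0" if "filterlim (\<lambda>n. pairing J c (v n)) at_top sequentially"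
      using N(1)[OF c that] R[of c N] unfolding pairing_diff by linarith
    show "pairing J c ?w < 0" if "filterlim (\<lambda>n. pairing J c (v n)) at_bot sequentially"
      using N(2)[OF c that] R[of c N] unfolding pairing_diff by linarith
  qed
qed

section \<open>Affine interpolation\<close>

lemma affine_interpolation:
  fixes B :: "(real^'n::finite) set"
  assumes "\<not> affine_dependent B"
  obtains a c where "\<And>b. b \<in> B \<Longrightarrow> a \<bullet> b + c = f b"
proof (cases "B = {}")
  case False
  then obtain b0 where b0: "b0 \<in> B" by blast
  have "independent ((\<lambda>x. - b0 + x) ` (B - {b0}))"
    using assms affine_dependent_iff_dependent2[OF b0] by simp
  then obtain g :: "real^'n \<Rightarrow> real" where g: "linear g" "\<And>x. x \<in> (\<lambda>x. - b0 + x) ` (B - {b0}) \<Longrightarrow> g x = f (x + b0) - f b0"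
    using linear_independent_extend[of "(\<lambda>x. - b0 + x) ` (B - {b0})" "\<lambda>x. f (x + b0) - f b0"] by blast
  define a where "a = adjoint g 1"
  have ga: "g x = a \<bullet> x" for x
    using adjoint_works[OF g(1), of x 1] by (simp add: a_def inner_commute)
  have "a \<bullet> b + (f b0 - a \<bullet> b0) = f b" if "b \<in> B" for b
  proof (cases "b = b0")
    case False
    then have "g (- b0 + b) = f b - f b0" using g(2)[of "- b0 + b"] that by auto
    then show ?thesis by (simp add: ga inner_diff_right)
  qed simp
  then show thesis by (rule that)
qed (use that in blast)

section \<open>Functionals that detect cells and exchanges\<close>

lemma affine_coefficients:
  fixes B :: "(nat^'n::finite) set"
  assumes "finite B" "real_vec \<alpha> \<in> affine hull (real_vec ` B)"
  obtains \<mu> where "sum \<mu> B = 1" "(\<Sum>\<beta>\<in>B. \<mu> \<beta> *\<^sub>R real_vec \<beta>) = real_vec \<alpha>"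
proof -
  obtain u where "sum u (real_vec ` B) = 1" "(\<Sum>y\<in>real_vec ` B. u y *\<^sub>R y) = real_vec \<alpha>"
    using assms by (auto simp: affine_hull_finite)
  with that[of "u \<circ> real_vec"] show thesis by (simp add: sum.reindex)
qed

text \<open>Fixing one choice makes \<open>residual B \<alpha>\<close> depend on \<open>B\<close>
  and \<alpha> alone, so that finitely many functionals suffice.\<close>

definition interpolation_coeffs :: "(nat^'n::finite) set \<Rightarrow> nat^'n \<Rightarrow> nat^'n \<Rightarrow> real" where
  "interpolation_coeffs B \<alpha> = (SOME \<mu>. sum \<mu> B = 1 \<and> (\<Sum>\<beta>\<in>B. \<mu> \<beta> *\<^sub>R real_vec \<beta>) = real_vec \<alpha>)"

text \<open>The error at \<alpha> of affine interpolation from \<open>B\<close>, as a coefficient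
  vector. If \<open>B\<close> lies in the contact set of a spanning cell and has the same affine
  hull, this error is 0 at the contact points and positive at all other points of
  \<open>J\<close>.\<close>

definition residual :: "(nat^'n::finite) set \<Rightarrow> nat^'n \<Rightarrow> nat^'n \<Rightarrow> real" where
  "residual B \<alpha> = (\<lambda>\<beta>. (if \<beta> = \<alpha> then 1 else 0) - (if \<beta> \<in> B then interpolation_coeffs B \<alpha> \<beta> else 0))"

lemma pairing_residual:
  fixes J :: "(nat^'n::finite) set"
  assumes J: "finite J" "B \<subseteq> J" "\<alpha> \<in> J" and \<alpha>: "real_vec \<alpha> \<in> affine hull (real_vec ` B)"
    and v: "\<And>\<beta>. \<beta> \<in> B \<Longrightarrow> a \<bullet> real_vec \<beta> + c = v \<beta>"
  shows "pairing J (residual B \<alpha>) v = v \<alpha> - (a \<bullet> real_vec \<alpha> + c)"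
proof -
  let ?\<mu> = "interpolation_coeffs B \<alpha>"
  have finB: "finite B" using J finite_subset by blast
  obtain \<mu> where "sum \<mu> B = 1 \<and> (\<Sum>\<beta>\<in>B. \<mu> \<beta> *\<^sub>R real_vec \<beta>) = real_vec \<alpha>"
    using affine_coefficients[OF finB \<alpha>] by metis
  then have \<mu>: "sum ?\<mu> B = 1" "(\<Sum>\<beta>\<in>B. ?\<mu> \<beta> *\<^sub>R real_vec \<beta>) = real_vec \<alpha>"
    using someI[of "\<lambda>\<mu>. sum \<mu> B = 1 \<and> (\<Sum>\<beta>\<in>B. \<mu> \<beta> *\<^sub>R real_vec \<beta>) = real_vec \<alpha>" \<mu>]
    by (simp_all add: interpolation_coeffs_def)
  have "pairing J (residual B \<alpha>) v = (\<Sum>\<beta>\<in>J. (if \<beta> = \<alpha> then v \<alpha> else 0) - (if \<beta> \<in> B then ?\<mu> \<beta> * v \<beta> else 0))"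
    unfolding pairing_def residual_def by (intro sum.cong) (auto simp: left_diff_distrib)
  also have "\<dots> = v \<alpha> - (\<Sum>\<beta>\<in>B. ?\<mu> \<beta> * v \<beta>)"
    using J by (simp add: sum_subtractf sum.inter_restrict[symmetric] Int_absorb1)
  also have "(\<Sum>\<beta>\<in>B. ?\<mu> \<beta> * v \<beta>) = (\<Sum>\<beta>\<in>B. ?\<mu> \<beta> * (a \<bullet> real_vec \<beta> + c))"
    by (intro sum.cong) (auto simp: v)
  also have "\<dots> = a \<bullet> real_vec \<alpha> + c"
    unfolding \<mu>(2)[symmetric] by (rule affine_functional_combination[OF \<mu>(1), symmetric])
  finally show ?thesis .
qed

text \<open>A sum of indicators, so that coinciding exponents count with multiplicity.\<close>

definition exchange_functional :: "'a \<Rightarrow> 'a \<Rightarrow> 'a \<Rightarrow> 'a \<Rightarrow> 'a \<Rightarrow> real" where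
  "exchange_functional \<alpha> \<beta> \<gamma> \<delta> = (\<lambda>\<xi>. (if \<xi> = \<alpha> then 1 else 0) + (if \<xi> = \<beta> then 1 else 0)
     - (if \<xi> = \<gamma> then 1 else 0) - (if \<xi> = \<delta> then 1 else 0))"

lemma pairing_exchange_functional:
  assumes "finite J" "\<alpha> \<in> J" "\<beta> \<in> J" "\<gamma> \<in> J" "\<delta> \<in> J"
  shows "pairing J (exchange_functional \<alpha> \<beta> \<gamma> \<delta>) v = v \<alpha> + v \<beta> - v \<gamma> - v \<delta>"
proof -
  have "exchange_functional \<alpha> \<beta> \<gamma> \<delta> \<xi> * v \<xi> = (if \<xi> = \<alpha> then v \<alpha> else 0) + (if \<xi> = \<beta> then v \<beta> else 0)
     - (if \<xi> = \<gamma> then v \<gamma> else 0) - (if \<xi> = \<delta> then v \<delta> else 0)" for \<xi>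
    by (simp add: exchange_functional_def algebra_simps)
  then show ?thesis using assms by (simp add: pairing_def sum.distrib sum_subtractf)
qed

lemma choice2: "\<forall>x. \<exists>a b. P x a b \<Longrightarrow> \<exists>f g. \<forall>x. P x (f x) (g x)"
  by metis

lemma choice3: "\<forall>x. \<exists>a b c. P x a b c \<Longrightarrow> \<exists>f g h. \<forall>x. P x (f x) (g x) (h x)"
  by metis

section \<open>Strata\<close>

text \<open>For \<open>C > 0\<close> and after applying -ln, this is \<open>local_exchange\<close>
  up to the additive error \<open>ln C\<close>.\<close>

definition exchange_bound :: "(nat^'n::finite) set \<Rightarrow> real \<Rightarrow> 'n polyn \<Rightarrow> bool" where
  "exchange_bound J C f \<longleftrightarrow> (\<forall>\<alpha> i j k l. i \<noteq> k \<and> i \<noteq> l \<and> j \<noteq> k \<and> j \<noteq> l \<and>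
     \<alpha> + evec i + evec j \<in> J \<and> \<alpha> + evec k + evec l \<in> J \<longrightarrow>
     f (\<alpha> + evec i + evec j) * f (\<alpha> + evec k + evec l)
       \<le> C * max (f (\<alpha> + evec i + evec k) * f (\<alpha> + evec j + evec l)) (f (\<alpha> + evec i + evec l) * f (\<alpha> + evec j + evec k)))"

text \<open>All that the quotient theorem uses about \<open>PL\<close> and \<open>Gr\<close>. The
  guards on \<open>J\<close> exclude \<open>Gr d q {}\<close>, whose only element is the zero
  function, which is not in the simplex.\<close>

locale strata =
  fixes d :: nat and U :: "(nat^'n::finite) set \<Rightarrow> 'n polyn set"
  assumes in_simplex: "\<lbrakk>J \<noteq> {}; f \<in> U J\<rbrakk> \<Longrightarrow> f \<in> poly_simplex d"
    and has_supp: "\<lbrakk>J \<noteq> {}; f \<in> U J\<rbrakk> \<Longrightarrow> supp f = J"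
    and orbit_in: "\<lbrakk>J \<noteq> {}; f \<in> U J\<rbrakk> \<Longrightarrow> orbit d f \<subseteq> U J"
    and limit_in: "\<lbrakk>J \<noteq> {}; \<And>n. \<sigma> n \<in> U J; \<And>\<alpha>. (\<lambda>n. \<sigma> n \<alpha>) \<longlonglongrightarrow> f \<alpha>; M_convex (supp f)\<rbrakk> \<Longrightarrow> f \<in> U (supp f)"
    and exchange: "\<lbrakk>J \<noteq> {}; J \<subseteq> Delta d\<rbrakk> \<Longrightarrow> \<exists>C. \<forall>f\<in>U J. exchange_bound J C f"
    and exp_in: "\<lbrakk>M_convex J; J \<subseteq> Delta d; M_convex_fun J v\<rbrakk> \<Longrightarrow>
       normalize_poly d (\<lambda>\<alpha>. if \<alpha> \<in> J then exp (- v \<alpha>) / fact_vec \<alpha> else 0) \<in> U J"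

locale strata_at = strata d U
  for d :: nat and U :: "(nat^'n::finite) set \<Rightarrow> 'n polyn set" +
  fixes J :: "(nat^'n::finite) set" and X :: "'n polyn set"
  assumes J: "J \<subseteq> Delta d" "M_convex J" and X: "X = mtopology_of (poly_metric d) closure_of (U J)"
begin

lemma finJ: "finite J" "J \<noteq> {}"
  using J finite_subset[OF J(1)] by (auto simp: M_convex_def)

lemmas U_simplex = in_simplex[OF finJ(2)]
  and U_supp = has_supp[OF finJ(2)]
  and U_orbit = orbit_in[OF finJ(2)]
  and U_limit = limit_in[OF finJ(2)]

lemma U_pos: "\<lbrakk>f \<in> U J; \<alpha> \<in> J\<rbrakk> \<Longrightarrow> 0 < f \<alpha>" and U_zero: "\<lbrakk>f \<in> U J; \<alpha> \<notin> J\<rbrakk> \<Longrightarrow> f \<alpha> = 0"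
  using U_supp[of f] poly_simplexD(1)[OF U_simplex, of f \<alpha>] by (auto simp: supp_def order_less_le)

text \<open>Both properties of \<open>w\<close> are read off from signs: an exchange functional that
  does not tend to minus infinity is nonnegative at \<open>w\<close>, and the residuals decide which
  coefficients survive a rescaling adapted to a cell.\<close>

lemma tropical_limit:
  fixes \<sigma> :: "nat \<Rightarrow> 'n polyn"
  assumes \<sigma>: "\<And>n. \<sigma> n \<in> U J"
  obtains r w where "strict_mono r" "M_convex_fun J w"
    "\<And>T a0 c0. spanning_cell J w a0 c0 T \<Longrightarrow> \<exists>a c y. y \<in> poly_simplex d \<and> supp y = T \<and>
       (\<forall>\<alpha>. (\<lambda>n. exp (a n \<bullet> real_vec \<alpha> + c n) * \<sigma> (r n) \<alpha>) \<longlonglongrightarrow> y \<alpha>)"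
proof -
  define \<Lambda> where "\<Lambda> = (\<lambda>(B, \<alpha>). residual B \<alpha>) ` (Pow J \<times> J) \<union>
     (\<lambda>(\<alpha>, \<beta>, \<gamma>, \<delta>). exchange_functional \<alpha> \<beta> \<gamma> \<delta>) ` (J \<times> J \<times> J \<times> J)"
  have \<Lambda>: "finite \<Lambda>" using finJ by (simp add: \<Lambda>_def)
  obtain r :: "nat \<Rightarrow> nat" where r: "strict_mono r" "\<And>c. c \<in> \<Lambda> \<Longrightarrow> settled (\<lambda>n. pairing J c (\<lambda>\<alpha>. - ln (\<sigma> (r n) \<alpha>)))"
  proof (rule finite_subsequence[OF \<Lambda>, of "\<lambda>c (s :: nat \<Rightarrow> nat). settled (\<lambda>n. pairing J c (\<lambda>\<alpha>. - ln (\<sigma> (s n) \<alpha>)))"])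
    fix c and s :: "nat \<Rightarrow> nat"
    show "\<exists>r. strict_mono r \<and> settled (\<lambda>n. pairing J c (\<lambda>\<alpha>. - ln (\<sigma> ((s \<circ> r) n) \<alpha>)))"
      using settled_subsequence[of "\<lambda>n. pairing J c (\<lambda>\<alpha>. - ln (\<sigma> (s n) \<alpha>))"] by (simp add: o_def)
  next
    fix c and s r :: "nat \<Rightarrow> nat"
    assume "settled (\<lambda>n. pairing J c (\<lambda>\<alpha>. - ln (\<sigma> (s n) \<alpha>)))" "strict_mono r"
    from settled_subseq[OF this] show "settled (\<lambda>n. pairing J c (\<lambda>\<alpha>. - ln (\<sigma> ((s \<circ> r) n) \<alpha>)))"
      by (simp add: o_def)
  qed auto
  define v where "v = (\<lambda>n \<alpha>. - ln (\<sigma> (r n) \<alpha>))"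
  have settled: "settled (\<lambda>n. pairing J c (v n))" if "c \<in> \<Lambda>" for c
    using r(2)[OF that] by (simp add: v_def)
  obtain w where w: "\<And>c. c \<in> \<Lambda> \<Longrightarrow> convergent (\<lambda>n. pairing J c (v n)) \<Longrightarrow> pairing J c w = 0"
    "\<And>c. c \<in> \<Lambda> \<Longrightarrow> filterlim (\<lambda>n. pairing J c (v n)) at_top sequentially \<Longrightarrow> pairing J c w > 0"
    "\<And>c. c \<in> \<Lambda> \<Longrightarrow> filterlim (\<lambda>n. pairing J c (v n)) at_bot sequentially \<Longrightarrow> pairing J c w < 0"
    by (rule asymptotic_sign_vector[OF \<Lambda>, of J v]) (erule settled, rule that)
  obtain C where C: "\<And>f. f \<in> U J \<Longrightarrow> exchange_bound J C f"
    using exchange[OF finJ(2) J(1)] by blast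
  \<comment> \<open>A positive constant, so that the bound can be passed through
    \<open>ln\<close>.\<close>
  define D where "D = max C 1"
  have D: "D > 0" "C \<le> D" by (auto simp: D_def)
  have nonneg: "0 \<le> \<sigma> n \<alpha>" for n \<alpha> using poly_simplexD(1)[OF U_simplex[OF \<sigma>]] .
  have exch: "v n \<beta>1 + v n \<beta>2 - v n \<gamma>1 - v n \<gamma>2 \<ge> - ln D"
    if "\<beta>1 \<in> J" "\<beta>2 \<in> J" "\<gamma>1 \<in> J" "\<gamma>2 \<in> J"
      "\<sigma> (r n) \<beta>1 * \<sigma> (r n) \<beta>2 \<le> D * (\<sigma> (r n) \<gamma>1 * \<sigma> (r n) \<gamma>2)" for n \<beta>1 \<beta>2 \<gamma>1 \<gamma>2
  proof -
    have pos: "0 < \<sigma> (r n) \<beta>1" "0 < \<sigma> (r n) \<beta>2" "0 < \<sigma> (r n) \<gamma>1" "0 < \<sigma> (r n) \<gamma>2"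
      using that U_pos[OF \<sigma>] by auto
    then have "ln (\<sigma> (r n) \<beta>1 * \<sigma> (r n) \<beta>2) \<le> ln (D * (\<sigma> (r n) \<gamma>1 * \<sigma> (r n) \<gamma>2))"
      using that(5) D by (intro ln_mono) auto
    then show ?thesis using pos D by (simp add: v_def ln_mult)
  qed
  \<comment> \<open>Validity for infinitely many \<open>n\<close> is enough: the functional is
    bounded below along them, so, being settled, it converges or tends to plus infinity.\<close>
  have w_exch: "w \<beta>1 + w \<beta>2 \<ge> w \<gamma>1 + w \<gamma>2"
    if J4: "\<beta>1 \<in> J" "\<beta>2 \<in> J" "\<gamma>1 \<in> J" "\<gamma>2 \<in> J"
      and freq: "\<exists>\<^sub>F n in sequentially. \<sigma> (r n) \<beta>1 * \<sigma> (r n) \<beta>2 \<le> D * (\<sigma> (r n) \<gamma>1 * \<sigma> (r n) \<gamma>2)" for \<beta>1 \<beta>2 \<gamma>1 \<gamma>2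
  proof -
    let ?c = "exchange_functional \<beta>1 \<beta>2 \<gamma>1 \<gamma>2"
    have c: "?c \<in> \<Lambda>"
      unfolding \<Lambda>_def using J4 by (intro UnI2 image_eqI[of _ _ "(\<beta>1, \<beta>2, \<gamma>1, \<gamma>2)"]) auto
    have eq: "pairing J ?c u = u \<beta>1 + u \<beta>2 - u \<gamma>1 - u \<gamma>2" for u
      using finJ J4 by (intro pairing_exchange_functional)
    have "\<not> filterlim (\<lambda>n. pairing J ?c (v n)) at_bot sequentially"
    proof
      assume "filterlim (\<lambda>n. pairing J ?c (v n)) at_bot sequentially"
      then have "\<forall>\<^sub>F n in sequentially. pairing J ?c (v n) < - ln D"
        by (simp add: filterlim_at_bot_dense)
      then have "\<forall>\<^sub>F n in sequentially. \<not> \<sigma> (r n) \<beta>1 * \<sigma> (r n) \<beta>2 \<le> D * (\<sigma> (r n) \<gamma>1 * \<sigma> (r n) \<gamma>2)"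
        by eventually_elim (use exch[OF J4] in \<open>auto simp: eq not_le[symmetric]\<close>)
      with freq show False by (simp add: frequently_def)
    qed
    then have "pairing J ?c w \<ge> 0" using settled[OF c] w(1,2)[OF c] by (force simp: settled_def)
    then show ?thesis by (simp add: eq)
  qed
  have "local_exchange J w"
    unfolding local_exchange_def
  proof (intro allI impI)
    fix \<alpha> i j k l
    assume "i \<noteq> k \<and> i \<noteq> l \<and> j \<noteq> k \<and> j \<noteq> l \<and> \<alpha> + evec i + evec j \<in> J \<and> \<alpha> + evec k + evec l \<in> J"
    then have ijkl: "i \<noteq> k" "i \<noteq> l" "j \<noteq> k" "j \<noteq> l" and \<beta>: "\<alpha> + evec i + evec j \<in> J" "\<alpha> + evec k + evec l \<in> J"
      by auto
    let ?\<beta>1 = "\<alpha> + evec i + evec j" and ?\<beta>2 = "\<alpha> + evec k + evec l"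
    let ?\<gamma>1 = "\<alpha> + evec i + evec k" and ?\<gamma>2 = "\<alpha> + evec j + evec l"
    let ?\<delta>1 = "\<alpha> + evec i + evec l" and ?\<delta>2 = "\<alpha> + evec j + evec k"
    let ?P = "\<lambda>n \<gamma>1 \<gamma>2. \<sigma> (r n) ?\<beta>1 * \<sigma> (r n) ?\<beta>2 \<le> D * (\<sigma> (r n) \<gamma>1 * \<sigma> (r n) \<gamma>2)"
    have or: "?P n ?\<gamma>1 ?\<gamma>2 \<or> ?P n ?\<delta>1 ?\<delta>2" for n
    proof -
      let ?M = "max (\<sigma> (r n) ?\<gamma>1 * \<sigma> (r n) ?\<gamma>2) (\<sigma> (r n) ?\<delta>1 * \<sigma> (r n) ?\<delta>2)"
      have "0 \<le> ?M" using nonneg by (simp add: le_max_iff_disj)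
      have "\<sigma> (r n) ?\<beta>1 * \<sigma> (r n) ?\<beta>2 \<le> C * ?M"
        using C[OF \<sigma>] ijkl \<beta> unfolding exchange_bound_def by blast
      also have "\<dots> \<le> D * ?M" using D \<open>0 \<le> ?M\<close> by (intro mult_right_mono)
      finally show ?thesis by (auto simp: max_def split: if_splits)
    qed
    have in_J: "\<gamma>1 \<in> J \<and> \<gamma>2 \<in> J" if "?P n \<gamma>1 \<gamma>2" for n \<gamma>1 \<gamma>2
    proof -
      have "0 < \<sigma> (r n) ?\<beta>1 * \<sigma> (r n) ?\<beta>2" using \<beta> U_pos[OF \<sigma>] by simp
      then have "\<sigma> (r n) \<gamma>1 * \<sigma> (r n) \<gamma>2 \<noteq> 0" using that by auto
      then show ?thesis using U_zero[OF \<sigma>] by auto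
    qed
    \<comment> \<open>Which alternative holds may depend on \<open>n\<close>, but one of the two
      holds infinitely often.\<close>
    have "\<exists>\<^sub>F n in sequentially. ?P n ?\<gamma>1 ?\<gamma>2 \<or> ?P n ?\<delta>1 ?\<delta>2"
      using or by (simp add: always_eventually eventually_frequently)
    then consider "\<exists>\<^sub>F n in sequentially. ?P n ?\<gamma>1 ?\<gamma>2" | "\<exists>\<^sub>F n in sequentially. ?P n ?\<delta>1 ?\<delta>2"
      unfolding frequently_disj_iff by blast
    then show "(?\<gamma>1 \<in> J \<and> ?\<gamma>2 \<in> J \<and> w ?\<beta>1 + w ?\<beta>2 \<ge> w ?\<gamma>1 + w ?\<gamma>2) \<or> (?\<delta>1 \<in> J \<and> ?\<delta>2 \<in> J \<and> w ?\<beta>1 + w ?\<beta>2 \<ge> w ?\<delta>1 + w ?\<delta>2)"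
    proof cases
      case 1
      then obtain n where "?P n ?\<gamma>1 ?\<gamma>2" by (auto dest: frequently_ex)
      then show ?thesis using in_J w_exch[OF \<beta> _ _ 1] by blast
    next
      case 2
      then obtain n where "?P n ?\<delta>1 ?\<delta>2" by (auto dest: frequently_ex)
      then show ?thesis using in_J w_exch[OF \<beta> _ _ 2] by blast
    qed
  qed
  then have wM: "M_convex_fun J w" by (rule local_exchange_imp_M_convex_fun[OF J])
  have "\<exists>a c y. y \<in> poly_simplex d \<and> supp y = T \<and> (\<forall>\<alpha>. (\<lambda>n. exp (a n \<bullet> real_vec \<alpha> + c n) * \<sigma> (r n) \<alpha>) \<longlonglongrightarrow> y \<alpha>)"
    if T: "spanning_cell J w a0 c0 T" for T a0 c0
  proof -
    have TJ: "T \<subseteq> J" using T by (auto simp: spanning_cell_def is_cell_def)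
    have cell: "is_cell J w a0 c0 T" using T by (simp add: spanning_cell_def)
    have T0: "T \<noteq> {}" using T finJ by (auto simp: spanning_cell_def)
    \<comment> \<open>An affine basis inside the contact set. Interpolating \<open>v n\<close> on it
      yields the rescalings, and it reaches all of \<open>J\<close> because the cell is
      spanning.\<close>
    obtain B' where B': "B' \<subseteq> real_vec ` T" "\<not> affine_dependent B'" "affine hull B' = affine hull (real_vec ` T)"
      using affine_basis_exists[of "real_vec ` T"] by blast
    obtain B where B: "B \<subseteq> T" "B' = real_vec ` B" using B'(1) by (auto simp: subset_image_iff)
    have span: "real_vec \<alpha> \<in> affine hull (real_vec ` B)" if "\<alpha> \<in> J" for \<alpha>
      using T that B' B by (auto simp: spanning_cell_def)
    have "\<exists>a c. \<forall>\<beta>\<in>B. a \<bullet> real_vec \<beta> + c = u \<beta>" for u :: "nat^'n \<Rightarrow> real"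
    proof -
      obtain a c where "\<And>b. b \<in> B' \<Longrightarrow> a \<bullet> b + c = u (inv real_vec b)"
        by (rule affine_interpolation[OF B'(2), of "\<lambda>b. u (inv real_vec b)"]) (rule that)
      from this[unfolded B(2)] have "\<forall>\<beta>\<in>B. a \<bullet> real_vec \<beta> + c = u \<beta>" by (simp add: inv_f_f)
      then show ?thesis by blast
    qed
    then have "\<forall>n. \<exists>a c. \<forall>\<beta>\<in>B. a \<bullet> real_vec \<beta> + c = v n \<beta>" by blast
    from choice2[OF this] obtain a c where "\<forall>n. \<forall>\<beta>\<in>B. a n \<bullet> real_vec \<beta> + c n = v n \<beta>" by blast
    then have ac: "\<And>n \<beta>. \<beta> \<in> B \<Longrightarrow> a n \<bullet> real_vec \<beta> + c n = v n \<beta>" by blast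
    have BJ: "B \<subseteq> J" using B TJ by blast
    have res: "residual B \<alpha> \<in> \<Lambda>" if "\<alpha> \<in> J" for \<alpha>
      unfolding \<Lambda>_def using that BJ by (intro UnI1 image_eqI[of _ _ "(B, \<alpha>)"]) auto
    have pv: "pairing J (residual B \<alpha>) (v n) = v n \<alpha> - (a n \<bullet> real_vec \<alpha> + c n)" if "\<alpha> \<in> J" for \<alpha> n
      by (rule pairing_residual[OF finJ(1) BJ that span[OF that] ac])
    have pw: "pairing J (residual B \<alpha>) w = w \<alpha> - (a0 \<bullet> real_vec \<alpha> + c0)" if "\<alpha> \<in> J" for \<alpha>
      by (rule pairing_residual[OF finJ(1) BJ that span[OF that]]) (use cell B(1) in \<open>auto simp: is_cell_def\<close>)
    \<comment> \<open>The rescaled coefficient is the exponential of minus the residual. Residuals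
      of points of \<open>T\<close> converge, those of other points of \<open>J\<close> tend to
      infinity.\<close>
    have ex: "exp (a n \<bullet> real_vec \<alpha> + c n) * \<sigma> (r n) \<alpha> = exp (- pairing J (residual B \<alpha>) (v n))" if "\<alpha> \<in> J" for \<alpha> n
    proof -
      have "\<sigma> (r n) \<alpha> = exp (- v n \<alpha>)" using U_pos[OF \<sigma> that] by (simp add: v_def)
      then show ?thesis unfolding pv[OF that] by (simp flip: exp_add)
    qed
    have "\<exists>y0. (\<lambda>n. exp (a n \<bullet> real_vec \<alpha> + c n) * \<sigma> (r n) \<alpha>) \<longlonglongrightarrow> y0 \<and> 0 \<le> y0 \<and> (y0 \<noteq> 0 \<longleftrightarrow> \<alpha> \<in> T)" for \<alpha>
    proof (cases "\<alpha> \<in> J")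
      case False
      then show ?thesis using TJ U_zero[OF \<sigma>] by (intro exI[of _ 0]) auto
    next
      case \<alpha>J: True
      show ?thesis
      proof (cases "\<alpha> \<in> T")
        case True
        then have "pairing J (residual B \<alpha>) w = 0" using pw[OF \<alpha>J] cell by (auto simp: is_cell_def)
        then have "convergent (\<lambda>n. pairing J (residual B \<alpha>) (v n))"
          using settled[OF res[OF \<alpha>J]] w(2,3)[OF res[OF \<alpha>J]] by (auto simp: settled_def)
        then obtain L where "(\<lambda>n. pairing J (residual B \<alpha>) (v n)) \<longlonglongrightarrow> L" by (auto simp: convergent_def)
        then have "(\<lambda>n. exp (- pairing J (residual B \<alpha>) (v n))) \<longlonglongrightarrow> exp (- L)" by (intro tendsto_intros)
        then show ?thesis unfolding ex[OF \<alpha>J] using True by (intro exI[of _ "exp (- L)"]) auto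
      next
        case False
        then have "a0 \<bullet> real_vec \<alpha> + c0 \<le> w \<alpha>" "a0 \<bullet> real_vec \<alpha> + c0 \<noteq> w \<alpha>"
          using cell \<alpha>J by (auto simp: is_cell_def)
        then have "pairing J (residual B \<alpha>) w > 0" using pw[OF \<alpha>J] by simp
        then have "filterlim (\<lambda>n. pairing J (residual B \<alpha>) (v n)) at_top sequentially"
          using settled[OF res[OF \<alpha>J]] w(1,3)[OF res[OF \<alpha>J]] by (force simp: settled_def)
        then have "filterlim (\<lambda>n. - pairing J (residual B \<alpha>) (v n)) at_bot sequentially"
          by (simp add: filterlim_uminus_at_bot)
        then have "(\<lambda>n. exp (- pairing J (residual B \<alpha>) (v n))) \<longlonglongrightarrow> 0"
          by (rule filterlim_compose[OF exp_at_bot])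
        then show ?thesis unfolding ex[OF \<alpha>J] using False by (intro exI[of _ 0]) auto
      qed
    qed
    then have "\<forall>\<alpha>. \<exists>y0. (\<lambda>n. exp (a n \<bullet> real_vec \<alpha> + c n) * \<sigma> (r n) \<alpha>) \<longlonglongrightarrow> y0 \<and> 0 \<le> y0 \<and> (y0 \<noteq> 0 \<longleftrightarrow> \<alpha> \<in> T)"
      by blast
    from choice[OF this] obtain y0 where y0: "\<And>\<alpha>. (\<lambda>n. exp (a n \<bullet> real_vec \<alpha> + c n) * \<sigma> (r n) \<alpha>) \<longlonglongrightarrow> y0 \<alpha>"
      "\<And>\<alpha>. 0 \<le> y0 \<alpha>" "\<And>\<alpha>. y0 \<alpha> \<noteq> 0 \<longleftrightarrow> \<alpha> \<in> T" by blast
    have y0s: "supp y0 = T" using y0(3) by (auto simp: supp_def)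
    have y0n: "y0 \<noteq> (\<lambda>_. 0)" using T0 y0(3) by fastforce
    have TD: "supp y0 \<subseteq> Delta d" using TJ J y0s by auto
    let ?s = "sum y0 (Delta d)"
    have s: "?s > 0" by (rule sum_pos_of_nonzero[OF y0(2) TD y0n])
    have "(\<lambda>n. exp (a n \<bullet> real_vec \<alpha> + (c n - ln ?s)) * \<sigma> (r n) \<alpha>) \<longlonglongrightarrow> normalize_poly d y0 \<alpha>" for \<alpha>
    proof -
      have "exp (a n \<bullet> real_vec \<alpha> + (c n - ln ?s)) * \<sigma> (r n) \<alpha> = exp (a n \<bullet> real_vec \<alpha> + c n) * \<sigma> (r n) \<alpha> / ?s" for n
        using s by (simp add: exp_diff exp_add)
      then show ?thesis unfolding normalize_poly_def using s by (auto intro!: tendsto_intros y0(1))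
    qed
    moreover have "supp (normalize_poly d y0) = T"
      using s y0s by (auto simp: supp_def normalize_poly_def)
    ultimately show ?thesis
      using normalize_poly_in_simplex[OF y0(2) TD y0n]
      by (intro exI[of _ a] exI[of _ "\<lambda>n. c n - ln ?s"] exI[of _ "normalize_poly d y0"]) auto
  qed
  with r(1) wM that show thesis by blast
qed

section \<open>The quotient\<close>

lemma X_simplex: "X \<subseteq> poly_simplex d"
  by (auto simp: X closure_of_metric)

lemma U_subset_X: "U J \<subseteq> X"
  unfolding X using U_simplex by (intro closure_of_subset) auto

lemma X_limit:
  assumes "f \<in> X"
  obtains \<sigma> where "\<And>n. \<sigma> n \<in> U J" "\<And>\<alpha>. (\<lambda>n. \<sigma> n \<alpha>) \<longlonglongrightarrow> f \<alpha>"
  using assms unfolding X poly_closure_iff by blast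

lemma X_closed:
  assumes "\<And>n. \<sigma> n \<in> X" "\<And>\<alpha>. (\<lambda>n. \<sigma> n \<alpha>) \<longlonglongrightarrow> f \<alpha>"
  shows "f \<in> X"
proof -
  have "f \<in> mtopology_of (poly_metric d) closure_of X"
    unfolding poly_closure_iff using assms X_simplex by (intro exI[of _ \<sigma>]) blast
  then show ?thesis unfolding X by simp
qed

text \<open>A limit with full support has the M-convex support \<open>J\<close>, so
  \<open>limit_in\<close> returns it to the stratum. Thus the stratum is cut out of \<open>X\<close>
  by nonvanishing of coefficients, which makes it open.\<close>

lemma X_in_U:
  assumes "f \<in> X" "\<And>\<alpha>. \<alpha> \<in> J \<Longrightarrow> f \<alpha> \<noteq> 0"
  shows "f \<in> U J"
proof -
  obtain \<sigma> where \<sigma>: "\<And>n. \<sigma> n \<in> U J" "\<And>\<alpha>. (\<lambda>n. \<sigma> n \<alpha>) \<longlonglongrightarrow> f \<alpha>"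
    using X_limit[OF assms(1)] by blast
  have "f \<alpha> = 0" if "\<alpha> \<notin> J" for \<alpha>
    using \<sigma>(2)[of \<alpha>] U_zero[OF \<sigma>(1) that] by (simp add: LIMSEQ_const_iff)
  then have "supp f = J" using assms(2) by (auto simp: supp_def)
  then show ?thesis using U_limit[OF \<sigma>] J(2) by simp
qed

lemma U_eventually:
  assumes "\<And>n. \<sigma> n \<in> X" "\<And>\<alpha>. (\<lambda>n. \<sigma> n \<alpha>) \<longlonglongrightarrow> f \<alpha>" "f \<in> U J"
  shows "\<forall>\<^sub>F n in sequentially. \<sigma> n \<in> U J"
proof -
  have "\<forall>\<^sub>F n in sequentially. \<sigma> n \<alpha> \<noteq> 0" if "\<alpha> \<in> J" for \<alpha>
    using order_tendstoD(1)[OF assms(2) U_pos[OF assms(3) that]] by (auto elim: eventually_mono)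
  then have "\<forall>\<^sub>F n in sequentially. \<forall>\<alpha>\<in>J. \<sigma> n \<alpha> \<noteq> 0"
    using finJ by (simp add: eventually_ball_finite_distrib)
  then show ?thesis by eventually_elim (use X_in_U assms(1) in blast)
qed

lemma X_orbit: "f \<in> X \<Longrightarrow> orbit d f \<subseteq> X"
proof
  fix g assume f: "f \<in> X" and g: "g \<in> orbit d f"
  have fs: "f \<in> poly_simplex d" using f X_simplex by blast
  obtain a c where gs: "g \<in> poly_simplex d" and g_eq: "\<And>\<alpha>. g \<alpha> = exp (a \<bullet> real_vec \<alpha> + c) * f \<alpha>"
    using g unfolding orbit_eq[OF fs] by auto
  obtain \<sigma> where \<sigma>: "\<And>n. \<sigma> n \<in> U J" "\<And>\<alpha>. (\<lambda>n. \<sigma> n \<alpha>) \<longlonglongrightarrow> f \<alpha>"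
    using X_limit[OF f] by blast
  let ?h = "\<lambda>n \<alpha>. exp (a \<bullet> real_vec \<alpha> + c) * \<sigma> n \<alpha>"
  have "(\<lambda>n. ?h n \<alpha>) \<longlonglongrightarrow> g \<alpha>" for \<alpha> unfolding g_eq by (intro tendsto_intros \<sigma>(2))
  then have "(\<lambda>n. normalize_poly d (?h n) \<alpha>) \<longlonglongrightarrow> g \<alpha>" for \<alpha>
    by (rule normalize_poly_tendsto[OF _ gs])
  moreover have "normalize_poly d (?h n) \<in> X" for n
    using normalize_exp_in_orbit[OF U_simplex[OF \<sigma>(1)]] U_orbit[OF \<sigma>(1)] U_subset_X by blast
  ultimately show "g \<in> X" using X_closed[of "\<lambda>n. normalize_poly d (?h n)" g] by blast
qed

lemma X_orbit_closure:
  assumes "f \<in> X"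
  shows "orbit_closure d f \<subseteq> X"
proof -
  have "orbit_closure d f \<subseteq> mtopology_of (poly_metric d) closure_of X"
    unfolding orbit_closure_def by (intro closure_of_mono X_orbit assms)
  then show ?thesis unfolding X by simp
qed

lemma mem_orbit_closure: "f \<in> poly_simplex d \<Longrightarrow> f \<in> orbit_closure d f"
  unfolding orbit_closure_def
  by (rule subsetD[OF closure_of_subset orbit_refl]) (auto simp: orbit_eq)

lemma orbit_closure_hyperspace:
  assumes "f \<in> X"
  shows "orbit_closure d f \<in> hyperspace (submetric (poly_metric d) X)"
proof -
  have "closedin (mtopology_of (poly_metric d)) (orbit_closure d f)"
    by (simp add: orbit_closure_def)
  moreover have "orbit_closure d f \<noteq> {}" using mem_orbit_closure assms X_simplex by blast
  ultimately show ?thesis using hyperspace_poly_iff X_orbit_closure[OF assms] by blast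
qed

text \<open>Each \<open>y T\<close> is a limit of points in the orbits of the \<open>x n\<close>,
  which stay in \<open>U J\<close>. This puts it into \<open>X\<close> and, for M-convex
  \<open>T\<close>, into \<open>U T\<close>.\<close>

lemma degeneration_hausdorff:
  assumes deg: "degeneration d J x \<T> y a c" and x: "\<And>n. x n \<in> U J"
  defines "K \<equiv> \<Union>T\<in>\<T>. orbit_closure d (y T)"
  shows "K \<in> hyperspace (submetric (poly_metric d) X)"
    "(\<lambda>n. hausdorff_dist (submetric (poly_metric d) X) (orbit_closure d (x n)) K) \<longlonglongrightarrow> 0"
    "\<And>T. T \<in> \<T> \<Longrightarrow> M_convex T \<Longrightarrow> y T \<in> U T"
proof -
  interpret degeneration d J x \<T> y a c by fact
  have K: "K = limit" by (simp add: K_def limit_def)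
  have yn: "\<exists>\<sigma>. (\<forall>n. \<sigma> n \<in> U J) \<and> (\<forall>\<alpha>. (\<lambda>n. \<sigma> n \<alpha>) \<longlonglongrightarrow> y T \<alpha>)" if "T \<in> \<T>" for T
    using orbit_point_is_limit[OF that orbit_refl[OF y(1)[OF that]]] U_orbit[OF assms(2)] by (metis subsetD)
  show "y T \<in> U T" if T: "T \<in> \<T>" "M_convex T" for T
  proof -
    obtain \<sigma> where "\<And>n. \<sigma> n \<in> U J" "\<And>\<alpha>. (\<lambda>n. \<sigma> n \<alpha>) \<longlonglongrightarrow> y T \<alpha>" using yn[OF T(1)] by blast
    from U_limit[OF this] show ?thesis using T y(2) by simp
  qed
  have yX: "y T \<in> X" if T: "T \<in> \<T>" for T
  proof -
    obtain \<sigma> where "\<And>n. \<sigma> n \<in> U J" "\<And>\<alpha>. (\<lambda>n. \<sigma> n \<alpha>) \<longlonglongrightarrow> y T \<alpha>" using yn[OF T] by blast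
    then show ?thesis using X_closed[of \<sigma>] U_subset_X by blast
  qed
  have "closedin (mtopology_of (poly_metric d)) K"
    unfolding K_def using fin by (intro closedin_Union) (auto simp: orbit_closure_def)
  moreover have "K \<noteq> {}" "K \<subseteq> X"
    using ne yX mem_orbit_closure[OF y(1)] X_orbit_closure[OF yX] unfolding K_def by blast+
  ultimately show KH: "K \<in> hyperspace (submetric (poly_metric d) X)"
    using hyperspace_poly_iff by blast
  have xH: "orbit_closure d (x n) \<in> hyperspace (submetric (poly_metric d) X)" for n
    using orbit_closure_hyperspace assms(2) U_subset_X by blast
  show "(\<lambda>n. hausdorff_dist (submetric (poly_metric d) X) (orbit_closure d (x n)) K) \<longlonglongrightarrow> 0"
  proof (rule LIMSEQ_I)
    fix e :: real assume "e > 0"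
    then have "e / 2 > 0" by simp
    from orbit_closures_upper[OF this] orbit_closures_lower[OF this]
    have "\<forall>\<^sub>F n in sequentially. norm (hausdorff_dist (submetric (poly_metric d) X) (orbit_closure d (x n)) K - 0) < e"
    proof eventually_elim
      case (elim n)
      have "hausdorff_dist (submetric (poly_metric d) X) (orbit_closure d (x n)) K \<le> e / 2"
        using elim unfolding K[symmetric]
        by (intro hausdorff_dist_le xH KH) (simp add: mdist_submetric, meson less_imp_le)+
      moreover have "0 \<le> hausdorff_dist (submetric (poly_metric d) X) (orbit_closure d (x n)) K"
        using Metric_space.nonneg[OF hausdorff_facts.Metric_space_hausdorff] .
      ultimately show ?case using \<open>e > 0\<close> by simp
    qed
    then show "\<exists>no. \<forall>n\<ge>no. norm (hausdorff_dist (submetric (poly_metric d) X) (orbit_closure d (x n)) K - 0) < e"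
      by (simp add: eventually_sequentially)
  qed
qed

lemma U_open_dense_invariant: "open_dense_invariant d X (U J)"
proof -
  interpret S: Metric_space "X \<inter> poly_simplex d" "poly_dist d"
    by (rule Metric_space.subspace[OF Metric_space_poly]) auto
  have top: "mtopology_of (submetric (poly_metric d) X) = S.mtopology"
    by (simp add: mtopology_of_def mspace_submetric mdist_submetric)
  have "openin S.mtopology (U J)"
    unfolding S.openin_mtopology
  proof (intro conjI allI impI)
    show "U J \<subseteq> X \<inter> poly_simplex d" using U_subset_X X_simplex by blast
    fix f assume f: "f \<in> U J"
    then have fs: "f \<in> poly_simplex d" by (rule U_simplex)
    show "\<exists>r>0. S.mball f r \<subseteq> U J"
    proof (rule ccontr)
      assume no: "\<not> ?thesis"
      have "\<exists>g\<in>X. poly_dist d f g < inverse (real (Suc n)) \<and> g \<notin> U J" for n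
      proof -
        have "\<not> S.mball f (inverse (real (Suc n))) \<subseteq> U J" using no by (metis inverse_positive_iff_positive of_nat_0_less_iff zero_less_Suc)
        then show ?thesis by (auto simp: S.in_mball)
      qed
      then obtain \<sigma> where \<sigma>: "\<And>n. \<sigma> n \<in> X" "\<And>n. poly_dist d f (\<sigma> n) < inverse (real (Suc n))" "\<And>n. \<sigma> n \<notin> U J"
        by metis
      have \<sigma>s: "\<sigma> n \<in> poly_simplex d" for n using \<sigma>(1) X_simplex by blast
      have comm: "poly_dist d (\<sigma> n) f = poly_dist d f (\<sigma> n)" for n
        by (rule Metric_space.commute[OF Metric_space_poly])
      have "(\<lambda>n. poly_dist d (\<sigma> n) f) \<longlonglongrightarrow> 0"
        by (rule Lim_null_comparison[OF always_eventually LIMSEQ_inverse_real_of_nat])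
          (use \<sigma>(2) Metric_space.nonneg[OF Metric_space_poly, of d] in \<open>auto simp: comm intro: less_imp_le\<close>)
      then have "(\<lambda>n. \<sigma> n \<alpha>) \<longlonglongrightarrow> f \<alpha>" for \<alpha>
        using poly_dist_tendsto_iff[of \<sigma>, OF \<sigma>s fs] by blast
      from U_eventually[OF \<sigma>(1) this f] show False using \<sigma>(3) by simp
    qed
  qed
  moreover have "mtopology_of (submetric (poly_metric d) X) closure_of U J = X"
  proof -
    have "f \<in> mtopology_of (submetric (poly_metric d) X) closure_of U J \<longleftrightarrow> f \<in> X" for f
    proof
      assume "f \<in> mtopology_of (submetric (poly_metric d) X) closure_of U J"
      then show "f \<in> X" by (simp add: closure_of_metric mspace_submetric)
    next
      assume f: "f \<in> X"
      have "\<exists>g\<in>U J. g \<in> X \<inter> poly_simplex d \<and> poly_dist d f g < e" if "e > 0" for e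
      proof -
        obtain g where "g \<in> U J" "g \<in> poly_simplex d" "poly_dist d f g < e"
          using f \<open>e > 0\<close> unfolding X closure_of_metric by auto
        then show ?thesis using U_subset_X by blast
      qed
      then show "f \<in> mtopology_of (submetric (poly_metric d) X) closure_of U J"
        using f X_simplex unfolding closure_of_metric by (auto simp: mspace_submetric mdist_submetric)
    qed
    then show ?thesis by blast
  qed
  ultimately show ?thesis
    unfolding open_dense_invariant_def top using U_orbit by blast
qed

text \<open>One inclusion holds because \<open>U J\<close> is itself open, dense and invariant. For
  the other, a point of \<open>U J\<close> is a limit of points of \<open>V\<close> that eventually
  lie in \<open>U J\<close>, and for constant support the orbit closures converge.\<close>

lemma hausdorff_quotient_eq:
  "hausdorff_quotient d X =
     mtopology_of (hausdorff_metric (submetric (poly_metric d) X)) closure_of (orbit_closure d ` U J)"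
  (is "_ = ?c (orbit_closure d ` U J)")
proof
  show "hausdorff_quotient d X \<subseteq> ?c (orbit_closure d ` U J)"
    unfolding hausdorff_quotient_def using U_open_dense_invariant by blast
  show "?c (orbit_closure d ` U J) \<subseteq> hausdorff_quotient d X"
    unfolding hausdorff_quotient_def
  proof (rule INT_greatest)
    fix V assume "V \<in> {V. open_dense_invariant d X V}"
    then have V: "mtopology_of (submetric (poly_metric d) X) closure_of V = X"
      by (simp add: open_dense_invariant_def)
    have "orbit_closure d ` U J \<subseteq> ?c (orbit_closure d ` V)"
    proof (rule image_subsetI)
      fix f assume f: "f \<in> U J"
      then have fs: "f \<in> poly_simplex d" by (rule U_simplex)
      have "f \<in> mtopology_of (submetric (poly_metric d) X) closure_of V" using V f U_subset_X by blast
      from closure_of_metric_sequence[OF this]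
      obtain \<sigma> where \<sigma>: "\<And>n. \<sigma> n \<in> V" "\<And>n. \<sigma> n \<in> X \<inter> poly_simplex d" "(\<lambda>n. poly_dist d f (\<sigma> n)) \<longlonglongrightarrow> 0"
        by (auto simp: mspace_submetric mdist_submetric)
      have \<sigma>X: "\<sigma> n \<in> X" for n using \<sigma>(2) by blast
      have \<sigma>s: "\<sigma> n \<in> poly_simplex d" for n using \<sigma>(2) by blast
      have comm: "poly_dist d (\<sigma> n) f = poly_dist d f (\<sigma> n)" for n
        by (rule Metric_space.commute[OF Metric_space_poly])
      have lim: "(\<lambda>n. \<sigma> n \<alpha>) \<longlonglongrightarrow> f \<alpha>" for \<alpha>
        using poly_dist_tendsto_iff[of \<sigma>, OF \<sigma>s fs] \<sigma>(3) by (simp add: comm)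
      obtain N where N: "\<And>n. n \<ge> N \<Longrightarrow> \<sigma> n \<in> U J"
        using U_eventually[OF \<sigma>X lim f] by (auto simp: eventually_sequentially)
      define x where "x = (\<lambda>n. \<sigma> (n + N))"
      have xU: "x n \<in> U J" for n by (simp add: x_def N)
      have xlim: "(\<lambda>n. x n \<alpha>) \<longlonglongrightarrow> f \<alpha>" for \<alpha> unfolding x_def by (rule LIMSEQ_ignore_initial_segment[OF lim])
      \<comment> \<open>The single cell \<open>J\<close> with trivial rescalings expresses
        continuity of the orbit closure on the stratum.\<close>
      have "degeneration d J x {J} (\<lambda>_. f) (\<lambda>_ _. 0) (\<lambda>_ _. 0)"
        by unfold_locales (use U_simplex[OF xU] U_supp[OF xU] fs U_supp[OF f] xlim in auto)
      note D = degeneration_hausdorff[OF this xU]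
      show "orbit_closure d f \<in> ?c (orbit_closure d ` V)"
        unfolding closure_of_metric mspace_hausdorff_metric mdist_hausdorff_metric
      proof (intro conjI allI impI)
        show "orbit_closure d f \<in> hyperspace (submetric (poly_metric d) X)" using D(1) by simp
        fix e :: real assume "e > 0"
        from order_tendstoD(2)[OF D(2) this] obtain n
          where "hausdorff_dist (submetric (poly_metric d) X) (orbit_closure d (x n)) (\<Union>T\<in>{J}. orbit_closure d f) < e"
          by (auto simp: eventually_sequentially)
        then have "hausdorff_dist (submetric (poly_metric d) X) (orbit_closure d f) (orbit_closure d (x n)) < e"
          using Metric_space.commute[OF hausdorff_facts.Metric_space_hausdorff, of _ "orbit_closure d f"] by simp
        moreover have "x n \<in> V" by (simp add: x_def \<sigma>(1))
        moreover have "orbit_closure d (x n) \<in> hyperspace (submetric (poly_metric d) X)"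
          using orbit_closure_hyperspace xU U_subset_X by blast
        ultimately show "\<exists>K\<in>orbit_closure d ` V. K \<in> hyperspace (submetric (poly_metric d) X) \<and>
            hausdorff_dist (submetric (poly_metric d) X) (orbit_closure d f) K < e" by blast
      qed
    qed
    then show "?c (orbit_closure d ` U J) \<subseteq> ?c (orbit_closure d ` V)"
      by (meson closure_of_minimal closedin_closure_of)
  qed
qed

lemma quotient_limit:
  assumes deg: "degeneration d J x {T. \<exists>a c. spanning_cell J w a c T} y a c" and x: "\<And>n. x n \<in> U J"
    and w: "M_convex_fun J w"
  shows "(\<Union>T\<in>{T. \<exists>a c. spanning_cell J w a c T}. orbit_closure d (y T)) \<in> Y d U X (regular_subdivision J w)"
    (is "?K \<in> _")
proof -
  let ?\<T> = "{T. \<exists>a c. spanning_cell J w a c T}" and ?h = "\<lambda>T. convex hull (real_vec ` T)"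
  note D = degeneration_hausdorff[OF deg x]
  have MT: "M_convex T" "lattice_points (?h T) = T" if T': "T \<in> ?\<T>" for T
  proof -
    obtain a c where "spanning_cell J w a c T" using T' by blast
    then have T: "is_cell J w a c T" "T \<noteq> {}" using finJ by (auto simp: spanning_cell_def)
    show "M_convex T" using M_convex_cell[OF w T] .
    moreover have "finite T" using T finJ by (auto simp: is_cell_def)
    ultimately show "lattice_points (?h T) = T" by (rule M_convex_lattice_points[rotated])
  qed
  have "?K \<in> hausdorff_quotient d X"
    unfolding hausdorff_quotient_eq closure_of_metric mspace_hausdorff_metric mdist_hausdorff_metric
  proof (intro conjI allI impI)
    show "?K \<in> hyperspace (submetric (poly_metric d) X)" by (rule D(1))
    fix e :: real assume "e > 0"
    from order_tendstoD(2)[OF D(2) this] obtain n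
      where "hausdorff_dist (submetric (poly_metric d) X) (orbit_closure d (x n)) ?K < e"
      by (auto simp: eventually_sequentially)
    then have "hausdorff_dist (submetric (poly_metric d) X) ?K (orbit_closure d (x n)) < e"
      using Metric_space.commute[OF hausdorff_facts.Metric_space_hausdorff] by metis
    moreover have "orbit_closure d (x n) \<in> hyperspace (submetric (poly_metric d) X)"
      using orbit_closure_hyperspace x U_subset_X by blast
    ultimately show "\<exists>L\<in>orbit_closure d ` U J. L \<in> hyperspace (submetric (poly_metric d) X) \<and>
        hausdorff_dist (submetric (poly_metric d) X) ?K L < e" using x by blast
  qed
  \<comment> \<open>\<open>Y\<close> indexes polynomials by polytopes, so each cell is sent back to
    its contact set by \<open>lattice_points\<close>.\<close>
  moreover have "\<forall>C\<in>?h ` ?\<T>. y (lattice_points C) \<in> U (lattice_points C)"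
    using D(3) MT by auto
  moreover have "?K = (\<Union>C\<in>?h ` ?\<T>. orbit_closure d (y (lattice_points C)))"
    using MT(2) by (auto simp: image_iff)
  ultimately show ?thesis
    unfolding Y_def maximal_cells_regular_subdivision[OF finJ w]
    by (intro CollectI conjI exI[of _ "\<lambda>C. y (lattice_points C)"]) auto
qed

lemma spanning_cells_finite: "finite {T. \<exists>a c. spanning_cell J w a c T}"
  by (rule finite_subset[of _ "Pow J"]) (use finJ in \<open>auto simp: spanning_cell_def is_cell_def\<close>)

lemma spanning_cells_nonempty: "{T. \<exists>a c. spanning_cell J w a c T} \<noteq> {}"
proof -
  obtain \<alpha> where "\<alpha> \<in> J" using finJ by blast
  then have "real_vec \<alpha> \<in> convex hull (real_vec ` J)" by (simp add: hull_inc)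
  from spanning_cells_cover[OF finJ(1) this, of w] show ?thesis by blast
qed

lemma spanning_cells_cover_J:
  assumes "p \<in> convex hull (real_vec ` J)"
  shows "\<exists>T\<in>{T. \<exists>a c. spanning_cell J w a c T}. p \<in> convex hull (real_vec ` T)"
proof -
  obtain a c T where "spanning_cell J w a c T" "p \<in> convex hull (real_vec ` T)"
    by (rule spanning_cells_cover[OF finJ(1) assms]) (rule that)
  then show ?thesis by blast
qed

lemma sequence_limit:
  fixes \<sigma> :: "nat \<Rightarrow> 'n polyn"
  assumes \<sigma>: "\<And>n. \<sigma> n \<in> U J"
  obtains r w K where "strict_mono r" "M_convex_fun J w" "K \<in> Y d U X (regular_subdivision J w)"
    "K \<in> hyperspace (submetric (poly_metric d) X)"
    "(\<lambda>n. hausdorff_dist (submetric (poly_metric d) X) (orbit_closure d (\<sigma> (r n))) K) \<longlonglongrightarrow> 0"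
proof -
  obtain r w where r: "strict_mono r" and w: "M_convex_fun J w"
    and ex: "\<And>T a0 c0. spanning_cell J w a0 c0 T \<Longrightarrow> \<exists>a c y. y \<in> poly_simplex d \<and> supp y = T \<and>
       (\<forall>\<alpha>. (\<lambda>n. exp (a n \<bullet> real_vec \<alpha> + c n) * \<sigma> (r n) \<alpha>) \<longlonglongrightarrow> y \<alpha>)"
    by (rule tropical_limit[OF \<sigma>]) (rule that)
  let ?\<T> = "{T. \<exists>a c. spanning_cell J w a c T}"
  have "\<forall>T. \<exists>a c y. T \<in> ?\<T> \<longrightarrow> y \<in> poly_simplex d \<and> supp y = T \<and>
       (\<forall>\<alpha>. (\<lambda>n. exp (a n \<bullet> real_vec \<alpha> + c n) * \<sigma> (r n) \<alpha>) \<longlonglongrightarrow> y \<alpha>)"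
    using ex by blast
  from choice3[OF this] obtain a c y where "\<forall>T. T \<in> ?\<T> \<longrightarrow> y T \<in> poly_simplex d \<and> supp (y T) = T \<and>
       (\<forall>\<alpha>. (\<lambda>n. exp (a T n \<bullet> real_vec \<alpha> + c T n) * \<sigma> (r n) \<alpha>) \<longlonglongrightarrow> y T \<alpha>)"
    by blast
  then have acy: "\<And>T. T \<in> ?\<T> \<Longrightarrow> y T \<in> poly_simplex d \<and> supp (y T) = T \<and>
       (\<forall>\<alpha>. (\<lambda>n. exp (a T n \<bullet> real_vec \<alpha> + c T n) * \<sigma> (r n) \<alpha>) \<longlonglongrightarrow> y T \<alpha>)"
    by blast
  let ?x = "\<lambda>n. \<sigma> (r n)"
  have deg: "degeneration d J ?x ?\<T> y a c"
  proof
    show "\<exists>T\<in>?\<T>. p \<in> convex hull (real_vec ` T)" if "p \<in> convex hull (real_vec ` J)" for p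
      by (rule spanning_cells_cover_J[OF that])
    show "\<sigma> (r n) \<in> poly_simplex d" "supp (\<sigma> (r n)) = J" for n
      using U_simplex[OF \<sigma>] U_supp[OF \<sigma>] by blast+
    show "finite ?\<T>" "?\<T> \<noteq> {}" by (fact spanning_cells_finite spanning_cells_nonempty)+
    fix T assume T: "T \<in> ?\<T>"
    show "y T \<in> poly_simplex d" "supp (y T) = T"
      "(\<lambda>n. exp (a T n \<bullet> real_vec \<alpha> + c T n) * \<sigma> (r n) \<alpha>) \<longlonglongrightarrow> y T \<alpha>" for \<alpha>
      using acy[OF T] by blast+
  qed
  have xU: "?x n \<in> U J" for n by (rule \<sigma>)
  show thesis
    by (rule that[OF r w quotient_limit[OF deg xU w] degeneration_hausdorff(1,2)[OF deg xU]])
qed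

text \<open>All positive multiples of \<open>w\<close> have the same cells. Rescaling by
  \<open>n\<close> times the supporting function of \<open>T\<close> leaves coefficients
  proportional to 1/\<alpha>! on \<open>T\<close> and makes the others decay geometrically.\<close>

lemma regular_subdivision_realized:
  assumes w: "M_convex_fun J w"
  shows "Y d U X (regular_subdivision J w) \<noteq> {}"
proof -
  let ?\<T> = "{T. \<exists>a c. spanning_cell J w a c T}"
  define g where "g = (\<lambda>n \<alpha>. if \<alpha> \<in> J then exp (- (real n * w \<alpha>)) / fact_vec \<alpha> else 0)"
  define x where "x = (\<lambda>n. normalize_poly d (g n))"
  have fact_pos: "0 < fact_vec \<alpha>" for \<alpha> :: "nat^'n" by (simp add: fact_vec_def prod_pos)
  have xU: "x n \<in> U J" for n
  proof -
    have "M_convex_fun J (\<lambda>\<alpha>. real n * w \<alpha>)"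
      unfolding M_convex_fun_def
    proof (intro ballI allI impI)
      fix \<alpha> \<beta> k assume "\<alpha> \<in> J" "\<beta> \<in> J" "\<beta> $ k < \<alpha> $ k"
      then obtain l where l: "\<alpha> $ l < \<beta> $ l" "\<alpha> + evec l - evec k \<in> J" "\<beta> + evec k - evec l \<in> J"
          "w \<alpha> + w \<beta> \<ge> w (\<alpha> + evec l - evec k) + w (\<beta> + evec k - evec l)"
        using w unfolding M_convex_fun_def by blast
      have "real n * (w (\<alpha> + evec l - evec k) + w (\<beta> + evec k - evec l)) \<le> real n * (w \<alpha> + w \<beta>)"
        using l(4) by (intro mult_left_mono) auto
      with l show "\<exists>l. \<alpha> $ l < \<beta> $ l \<and> \<alpha> + evec l - evec k \<in> J \<and> \<beta> + evec k - evec l \<in> J \<and>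
          real n * w \<alpha> + real n * w \<beta> \<ge> real n * w (\<alpha> + evec l - evec k) + real n * w (\<beta> + evec k - evec l)"
        by (auto simp: distrib_left)
    qed
    from exp_in[OF J(2,1) this] show ?thesis by (simp add: x_def g_def)
  qed
  have S: "0 < sum (g n) (Delta d)" for n
  proof (rule sum_pos_of_nonzero)
    show "0 \<le> g n \<alpha>" for \<alpha> using fact_pos[of \<alpha>] by (simp add: g_def)
    show "supp (g n) \<subseteq> Delta d" using J by (auto simp: supp_def g_def split: if_splits)
    obtain \<alpha> where "\<alpha> \<in> J" using finJ by blast
    then have "g n \<alpha> \<noteq> 0" using fact_pos[of \<alpha>] by (simp add: g_def)
    then show "g n \<noteq> (\<lambda>_. 0)" by auto
  qed
  define y0 where "y0 = (\<lambda>(T :: (nat^'n) set) \<alpha>. if \<alpha> \<in> T then 1 / fact_vec \<alpha> else (0::real))"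
  have "\<forall>T. \<exists>a0 c0. T \<in> ?\<T> \<longrightarrow> spanning_cell J w a0 c0 T" by blast
  from choice2[OF this] obtain a0 c0 where ac0: "\<And>T. T \<in> ?\<T> \<Longrightarrow> spanning_cell J w (a0 T) (c0 T) T" by blast
  have S0: "0 < sum (y0 T) (Delta d)" and y0s: "normalize_poly d (y0 T) \<in> poly_simplex d" if T: "T \<in> ?\<T>" for T
  proof -
    have TJ: "T \<subseteq> J" "T \<noteq> {}" using T finJ by (auto simp: spanning_cell_def is_cell_def)
    have 1: "0 \<le> y0 T \<alpha>" for \<alpha> using fact_pos[of \<alpha>] by (simp add: y0_def)
    have 2: "supp (y0 T) \<subseteq> Delta d" using J TJ by (auto simp: supp_def y0_def split: if_splits)
    obtain \<alpha> where "\<alpha> \<in> T" using TJ by blast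
    then have "y0 T \<alpha> \<noteq> 0" using fact_pos[of \<alpha>] by (simp add: y0_def)
    then have 3: "y0 T \<noteq> (\<lambda>_. 0)" by auto
    show "0 < sum (y0 T) (Delta d)" by (rule sum_pos_of_nonzero[OF 1 2 3])
    show "normalize_poly d (y0 T) \<in> poly_simplex d" by (rule normalize_poly_in_simplex[OF 1 2 3])
  qed
  define a where "a = (\<lambda>T n. real n *\<^sub>R a0 T)"
  \<comment> \<open>The two logarithms undo the normalisation of \<open>g n\<close> and introduce
    that of \<open>y0 T\<close>.\<close>
  define c where "c = (\<lambda>T n. real n * c0 T + ln (sum (g n) (Delta d)) - ln (sum (y0 T) (Delta d)))"
  have "degeneration d J x ?\<T> (\<lambda>T. normalize_poly d (y0 T)) a c"
  proof
    show "\<exists>T\<in>?\<T>. p \<in> convex hull (real_vec ` T)" if "p \<in> convex hull (real_vec ` J)" for p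
      by (rule spanning_cells_cover_J[OF that])
    show "x n \<in> poly_simplex d" "supp (x n) = J" for n using U_simplex[OF xU] U_supp[OF xU] by blast+
    show "finite ?\<T>" "?\<T> \<noteq> {}" by (fact spanning_cells_finite spanning_cells_nonempty)+
    fix T assume T: "T \<in> ?\<T>"
    show "normalize_poly d (y0 T) \<in> poly_simplex d" by (rule y0s[OF T])
    have "normalize_poly d (y0 T) \<alpha> \<noteq> 0 \<longleftrightarrow> \<alpha> \<in> T" for \<alpha>
      using S0[OF T] fact_pos[of \<alpha>] by (simp add: normalize_poly_def y0_def)
    then show "supp (normalize_poly d (y0 T)) = T" by (simp add: supp_def)
    have cell: "is_cell J w (a0 T) (c0 T) T" using ac0[OF T] by (simp add: spanning_cell_def)
    fix \<alpha>
    let ?l = "a0 T \<bullet> real_vec \<alpha> + c0 T"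
    show "(\<lambda>n. exp (a T n \<bullet> real_vec \<alpha> + c T n) * x n \<alpha>) \<longlonglongrightarrow> normalize_poly d (y0 T) \<alpha>"
    proof (cases "\<alpha> \<in> J")
      case False
      then have "\<alpha> \<notin> T" using cell by (auto simp: is_cell_def)
      with False show ?thesis by (simp add: x_def g_def y0_def normalize_poly_def)
    next
      case \<alpha>: True
      have eq: "exp (a T n \<bullet> real_vec \<alpha> + c T n) * x n \<alpha> = exp (real n * (?l - w \<alpha>)) / fact_vec \<alpha> / sum (y0 T) (Delta d)" for n
      proof -
        have "a T n \<bullet> real_vec \<alpha> + c T n = real n * ?l + ln (sum (g n) (Delta d)) - ln (sum (y0 T) (Delta d))"
          by (simp add: a_def c_def algebra_simps)
        then have "exp (a T n \<bullet> real_vec \<alpha> + c T n) = exp (real n * ?l) * sum (g n) (Delta d) / sum (y0 T) (Delta d)"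
          using S[of n] S0[OF T] by (simp add: exp_add exp_diff)
        moreover have "exp (real n * (?l - w \<alpha>)) = exp (real n * ?l) * exp (- (real n * w \<alpha>))"
          by (simp add: right_diff_distrib exp_diff exp_minus field_simps)
        moreover have "x n \<alpha> = exp (- (real n * w \<alpha>)) / fact_vec \<alpha> / sum (g n) (Delta d)"
          using \<alpha> by (simp add: x_def normalize_poly_def g_def)
        ultimately show ?thesis using S[of n] by (simp only:) (simp add: field_simps)
      qed
      show ?thesis
      proof (cases "\<alpha> \<in> T")
        case True
        then have "?l = w \<alpha>" using cell by (auto simp: is_cell_def)
        with True show ?thesis unfolding eq by (simp add: normalize_poly_def y0_def)
      next
        case False
        then have "?l \<le> w \<alpha>" "?l \<noteq> w \<alpha>" using cell \<alpha> by (auto simp: is_cell_def)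
        then have lt: "?l - w \<alpha> < 0" by simp
        have "(\<lambda>n. exp (?l - w \<alpha>) ^ n) \<longlonglongrightarrow> 0"
          by (rule LIMSEQ_power_zero) (use lt in simp)
        then have "(\<lambda>n. exp (real n * (?l - w \<alpha>))) \<longlonglongrightarrow> 0" by (simp only: exp_of_nat_mult)
        then have "(\<lambda>n. exp (real n * (?l - w \<alpha>)) / fact_vec \<alpha> / sum (y0 T) (Delta d)) \<longlonglongrightarrow> 0 / fact_vec \<alpha> / sum (y0 T) (Delta d)"
          using S0[OF T] fact_pos[of \<alpha>] by (intro tendsto_intros) auto
        with False show ?thesis unfolding eq by (simp add: normalize_poly_def y0_def)
      qed
    qed
  qed
  from quotient_limit[OF this xU w] show ?thesis by blast
qed

theorem quotient_theorem:
  "(\<forall>x\<in>X. \<exists>K\<in>hausdorff_quotient d X. x \<in> K) \<and>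
   hausdorff_quotient d X = (\<Union>\<P>\<in>{\<P>. regular_polymatroid_subdivision J \<P>}. Y d U X \<P>) \<and>
   (\<forall>\<P>. regular_polymatroid_subdivision J \<P> \<longrightarrow> Y d U X \<P> \<noteq> {})"
proof (intro conjI)
  let ?m = "submetric (poly_metric d :: 'n polyn metric) X"
  interpret H: Metric_space "hyperspace ?m" "hausdorff_dist ?m"
    by (rule hausdorff_facts.Metric_space_hausdorff)
  have Yq: "Y d U X \<P> \<subseteq> hausdorff_quotient d X" for \<P> by (auto simp: Y_def)
  show "\<forall>x\<in>X. \<exists>K\<in>hausdorff_quotient d X. x \<in> K"
  proof
    fix x assume x: "x \<in> X"
    then obtain \<sigma> where \<sigma>: "\<And>n. \<sigma> n \<in> U J" "\<And>\<alpha>. (\<lambda>n. \<sigma> n \<alpha>) \<longlonglongrightarrow> x \<alpha>"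
      by (rule X_limit) (rule that)
    obtain r w K where r: "strict_mono r" and w: "M_convex_fun J w" and K: "K \<in> Y d U X (regular_subdivision J w)"
      "K \<in> hyperspace ?m" "(\<lambda>n. hausdorff_dist ?m (orbit_closure d (\<sigma> (r n))) K) \<longlonglongrightarrow> 0"
      by (rule sequence_limit[OF \<sigma>(1)]) (rule that)
    have xs: "x \<in> poly_simplex d" and \<sigma>s: "\<sigma> n \<in> poly_simplex d" for n
      using x X_simplex U_simplex[OF \<sigma>(1)] by auto
    have KX: "K \<subseteq> X" using K(2) by (auto simp: hyperspace_def dest!: compactin_subset_topspace)
    interpret P: Metric_space "poly_simplex d :: 'n polyn set" "poly_dist d" by (rule Metric_space_poly)
    have "(\<lambda>n. poly_dist d (\<sigma> n) x) \<longlonglongrightarrow> 0" using poly_dist_tendsto_iff[of \<sigma>, OF \<sigma>s xs] \<sigma>(2) by blast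
    from LIMSEQ_subseq_LIMSEQ[OF this r] have lim: "(\<lambda>n. poly_dist d (\<sigma> (r n)) x) \<longlonglongrightarrow> 0" by (simp add: o_def)
    \<comment> \<open>\<open>x\<close> is close to \<open>\<sigma> (r n)\<close>, a point of an
      orbit closure that is Hausdorff close to \<open>K\<close>; closedness of \<open>K\<close> then
      gives membership.\<close>
    have "x \<in> mtopology_of (poly_metric d) closure_of K"
      unfolding closure_of_metric mspace_poly_metric mdist_poly_metric
    proof (intro conjI allI impI xs)
      fix e :: real assume "e > 0"
      then have e: "e / 2 > 0" by simp
      have "\<forall>\<^sub>F n in sequentially. poly_dist d (\<sigma> (r n)) x < e / 2 \<and> hausdorff_dist ?m (orbit_closure d (\<sigma> (r n))) K < e / 2"
        using order_tendstoD(2)[OF lim e] order_tendstoD(2)[OF K(3) e] by eventually_elim blast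
      then obtain n where n: "poly_dist d (\<sigma> (r n)) x < e / 2" "hausdorff_dist ?m (orbit_closure d (\<sigma> (r n))) K < e / 2"
        by (auto simp: eventually_sequentially)
      have "orbit_closure d (\<sigma> (r n)) \<in> hyperspace ?m" using orbit_closure_hyperspace \<sigma>(1) U_subset_X by blast
      from hausdorff_dist_less[OF this K(2) n(2) mem_orbit_closure[OF \<sigma>s]]
      obtain z where z: "z \<in> K" "poly_dist d (\<sigma> (r n)) z < e / 2" by (auto simp: mdist_submetric)
      have zs: "z \<in> poly_simplex d" using z KX X_simplex by blast
      have "poly_dist d x z \<le> poly_dist d x (\<sigma> (r n)) + poly_dist d (\<sigma> (r n)) z"
        by (rule P.triangle[OF xs \<sigma>s zs])
      also have "\<dots> < e" using n(1) z(2) P.commute[of x "\<sigma> (r n)"] by simp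
      finally show "\<exists>y\<in>K. y \<in> poly_simplex d \<and> poly_dist d x y < e" using z zs by blast
    qed
    moreover have "closedin (mtopology_of (poly_metric d)) K"
    proof -
      have "compactin (mtopology_of (poly_metric d)) K"
        using K(2) by (simp add: hyperspace_def mtopology_of_submetric compactin_subtopology)
      then show ?thesis
        by (intro compactin_imp_closedin) (simp_all add: mtopology_of_def P.Hausdorff_space_mtopology)
    qed
    ultimately have "x \<in> K" by (simp add: closure_of_closedin)
    then show "\<exists>K\<in>hausdorff_quotient d X. x \<in> K" using K(1) Yq by blast
  qed
  show "hausdorff_quotient d X = (\<Union>\<P>\<in>{\<P>. regular_polymatroid_subdivision J \<P>}. Y d U X \<P>)"
  proof
    show "hausdorff_quotient d X \<subseteq> (\<Union>\<P>\<in>{\<P>. regular_polymatroid_subdivision J \<P>}. Y d U X \<P>)"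
    proof
      fix L assume "L \<in> hausdorff_quotient d X"
      then have L: "L \<in> mtopology_of (hausdorff_metric ?m) closure_of (orbit_closure d ` U J)"
        by (simp add: hausdorff_quotient_eq)
      then have LH: "L \<in> hyperspace ?m" by (simp add: closure_of_metric)
      obtain \<tau> where \<tau>0: "\<And>n. \<tau> n \<in> orbit_closure d ` U J" "\<And>n. \<tau> n \<in> mspace (hausdorff_metric ?m)"
        "(\<lambda>n. mdist (hausdorff_metric ?m) L (\<tau> n)) \<longlonglongrightarrow> 0"
        by (rule closure_of_metric_sequence[OF L]) (rule that)
      note \<tau> = \<tau>0[unfolded mspace_hausdorff_metric mdist_hausdorff_metric]
      have "\<forall>n. \<exists>f. f \<in> U J \<and> \<tau> n = orbit_closure d f" using \<tau>(1) by blast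
      from choice[OF this] obtain \<sigma> where \<sigma>: "\<And>n. \<sigma> n \<in> U J" "\<And>n. \<tau> n = orbit_closure d (\<sigma> n)" by blast
      obtain r w K where r: "strict_mono r" and w: "M_convex_fun J w" and K: "K \<in> Y d U X (regular_subdivision J w)"
        "K \<in> hyperspace ?m" "(\<lambda>n. hausdorff_dist ?m (orbit_closure d (\<sigma> (r n))) K) \<longlonglongrightarrow> 0"
        by (rule sequence_limit[OF \<sigma>(1)]) (rule that)
      have "(\<lambda>n. hausdorff_dist ?m L (\<tau> (r n))) \<longlonglongrightarrow> 0"
        using LIMSEQ_subseq_LIMSEQ[OF \<tau>(3) r] by (simp add: o_def)
      then have "(\<lambda>n. hausdorff_dist ?m L (\<tau> (r n)) + hausdorff_dist ?m (\<tau> (r n)) K) \<longlonglongrightarrow> 0 + 0"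
        using K(3) by (intro tendsto_add) (simp_all add: \<sigma>(2))
      \<comment> \<open>The same subsequence of orbit closures tends to \<open>L\<close> and to
        \<open>K\<close>, so the two coincide.\<close>
      then have "hausdorff_dist ?m L K \<le> 0 + 0"
        by (rule LIMSEQ_le_const) (use H.triangle[OF LH \<tau>(2) K(2)] in blast)
      then have "L = K" using H.zero[OF LH K(2)] H.nonneg[of L K] by simp
      then show "L \<in> (\<Union>\<P>\<in>{\<P>. regular_polymatroid_subdivision J \<P>}. Y d U X \<P>)"
        using K(1) w unfolding regular_polymatroid_subdivision_def by blast
    qed
  qed (use Yq in blast)
  show "\<forall>\<P>. regular_polymatroid_subdivision J \<P> \<longrightarrow> Y d U X \<P> \<noteq> {}"
    using regular_subdivision_realized unfolding regular_polymatroid_subdivision_def by blast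
qed

end

section \<open>Lorentzian polynomials\<close>

text \<open>The coefficients with respect to the divided powers x^\<alpha>/\<alpha>!. They are the
  entries of the Hessians and the values of T_q-representations.\<close>

definition rho :: "'n::finite polyn \<Rightarrow> 'n polyn" where
  "rho f = (\<lambda>\<alpha>. fact_vec \<alpha> * f \<alpha>)"

lemma fact_vec_pos: "0 < fact_vec \<alpha>"
  by (simp add: fact_vec_def prod_pos)

lemma fact_vec_ge_1: "1 \<le> fact_vec \<alpha>"
  by (simp add: fact_vec_def prod_ge_1)

lemma fact_vec_nonzero [simp]: "fact_vec \<alpha> \<noteq> 0"
  using fact_vec_pos[of \<alpha>] by simp

lemma supp_rho [simp]: "supp (rho f) = supp f"
  by (simp add: supp_def rho_def)

text \<open>The factorials of successive derivatives telescope, and at exponent 0 only those of the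
  total exponent remain.\<close>

lemma hessian_pderivs: "hessian (pderivs \<alpha> f) $ i $ j = rho f (\<alpha> + evec i + evec j)"
proof -
  have "fact_vec (0 :: nat^'a) = 1" by (simp add: fact_vec_def)
  moreover have "fact_vec \<beta> \<noteq> 0" for \<beta> :: "nat^'a" using fact_vec_pos[of \<beta>] by simp
  ultimately show ?thesis
    by (simp add: hessian_def pderivs_def rho_def add_ac)
qed

lemma hessian_symmetric: "transpose (hessian (pderivs \<alpha> f)) = hessian (pderivs \<alpha> f)"
  by (simp add: transpose_def vec_eq_iff hessian_pderivs add_ac)

lemma Lorentzian_iff:
  "Lorentzian d f \<longleftrightarrow> f \<noteq> (\<lambda>_. 0) \<and> supp f \<subseteq> Delta d \<and> (\<forall>\<alpha>. 0 \<le> f \<alpha>) \<and> M_convex (supp f) \<and>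
     (\<forall>\<alpha>. degree_vec \<alpha> + 2 = d \<longrightarrow> reverse_CS (hessian (pderivs \<alpha> f)))"
  by (auto simp: Lorentzian_def num_pos_eigenvalues_le_1_iff[OF hessian_symmetric] fun_eq_iff)

lemma real_vec_evec: "real_vec (evec i) = axis i 1"
  by (simp add: real_vec_def vec_eq_iff axis_def)

text \<open>The torus acts on these Hessians by diagonal congruence, up to a positive
  factor.\<close>

lemma reverse_CS_hessian_scale:
  assumes "reverse_CS (hessian (pderivs \<alpha> f))" "\<And>\<alpha>. g \<alpha> = exp (a \<bullet> real_vec \<alpha> + c) * f \<alpha>"
  shows "reverse_CS (hessian (pderivs \<alpha> g))"
proof (rule reverse_CS_congruence[OF assms(1)])
  show "hessian (pderivs \<alpha> g) $ i $ j = exp (a \<bullet> real_vec \<alpha> + c) * exp (a $ i) * exp (a $ j) * hessian (pderivs \<alpha> f) $ i $ j" for i j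
    by (simp add: hessian_pderivs rho_def assms(2) real_vec_add real_vec_evec inner_add_right inner_axis exp_add)
qed simp

lemma normalize_eq_exp:
  assumes "\<And>\<alpha>. 0 \<le> f \<alpha>" "supp f \<subseteq> Delta d" "f \<noteq> (\<lambda>_. 0)"
  shows "normalize_poly d f \<alpha> = exp (0 \<bullet> real_vec \<alpha> + (- ln (sum f (Delta d)))) * f \<alpha>"
  using sum_pos_of_nonzero[OF assms] by (simp add: normalize_poly_def exp_minus field_simps)

lemma supp_exp_scale:
  assumes "\<And>\<alpha>. g \<alpha> = exp (a \<bullet> real_vec \<alpha> + c) * f \<alpha>"
  shows "supp g = supp f"
  by (simp add: supp_def assms)

lemma nonzero_of_supp: "supp f \<noteq> {} \<Longrightarrow> f \<noteq> (\<lambda>_. 0)"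
  by (auto simp: supp_def)

lemma normalize_poly_simplex: "f \<in> poly_simplex d \<Longrightarrow> normalize_poly d f = f"
  by (simp add: normalize_poly_def poly_simplexD(3))

lemma PL_iff: "f \<in> PL d J \<longleftrightarrow> f \<in> poly_simplex d \<and> supp f = J \<and> Lorentzian d f"
proof
  assume "f \<in> PL d J"
  then obtain g where g: "Lorentzian d g" "supp g = J" "f = normalize_poly d g" by (auto simp: PL_def)
  then have g': "\<And>\<alpha>. 0 \<le> g \<alpha>" "supp g \<subseteq> Delta d" "g \<noteq> (\<lambda>_. 0)" by (auto simp: Lorentzian_iff)
  note eq = normalize_eq_exp[OF g', folded g(3)]
  have fs: "f \<in> poly_simplex d" unfolding g(3) by (rule normalize_poly_in_simplex[OF g'])
  moreover have "supp f = J" using supp_exp_scale[OF eq] g(2) by simp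
  moreover have "Lorentzian d f"
    using g fs poly_simplex_nonzero[OF fs] supp_exp_scale[OF eq] reverse_CS_hessian_scale[OF _ eq]
    unfolding Lorentzian_iff by (auto simp: poly_simplexD)
  ultimately show "f \<in> poly_simplex d \<and> supp f = J \<and> Lorentzian d f" by blast
next
  assume "f \<in> poly_simplex d \<and> supp f = J \<and> Lorentzian d f"
  then show "f \<in> PL d J" unfolding PL_def by (metis (mono_tags, lifting) imageI mem_Collect_eq normalize_poly_simplex)
qed

section \<open>Polynomials built from M-convex functions\<close>

definition tropical_weight :: "(nat^'n::finite) set \<Rightarrow> (nat^'n \<Rightarrow> real) \<Rightarrow> real \<Rightarrow> 'n polyn" where
  "tropical_weight J v c = (\<lambda>\<alpha>. if \<alpha> \<in> J then c * exp (- v \<alpha>) else 0)"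

lemma tropical_weight_le:
  assumes "\<alpha>' \<in> J" "\<beta>' \<in> J" "v \<alpha>' + v \<beta>' \<le> v \<alpha> + v \<beta>"
  shows "tropical_weight J v c \<alpha> * tropical_weight J v c \<beta> \<le> tropical_weight J v c \<alpha>' * tropical_weight J v c \<beta>'"
proof -
  have "c\<^sup>2 * exp (- v \<alpha> - v \<beta>) \<le> c\<^sup>2 * exp (- v \<alpha>' - v \<beta>')"
    using assms(3) by (intro mult_left_mono) auto
  moreover have "c * exp (- v \<alpha>) * (c * exp (- v \<beta>)) = c\<^sup>2 * exp (- v \<alpha> - v \<beta>)" for \<alpha> \<beta>
    by (simp add: power2_eq_square exp_diff exp_minus field_simps)
  ultimately show ?thesis using assms(1,2) by (auto simp: tropical_weight_def)
qed

text \<open>An exchange at \<open>i\<close> between the two points on the left can only bring in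
  \<open>k\<close> or \<open>l\<close>, and either outcome is one of the products on the right. If
  the two pairs share an index, a product on the right equals the left side.\<close>

lemma M_convex_fun_four_point:
  fixes \<alpha> :: "nat^'n::finite"
  assumes v: "M_convex_fun J v" and c: "c > 0"
  defines "A \<equiv> \<lambda>i j. tropical_weight J v c (\<alpha> + evec i + evec j)"
  shows "A i j * A k l \<le> max (A i k * A j l) (A i l * A j k)"
proof -
  have nonneg: "0 \<le> A i j" for i j using c by (simp add: A_def tropical_weight_def)
  have sym: "A i j = A j i" for i j by (simp add: A_def add_ac)
  let ?\<beta> = "\<alpha> + evec i + evec j" and ?\<gamma> = "\<alpha> + evec k + evec l"
  show ?thesis
  proof (cases "i = k \<or> i = l \<or> j = k \<or> j = l")
    case True
    then show ?thesis using sym by (auto simp: mult.commute)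
  next
    case ne: False
    show ?thesis
    proof (cases "?\<beta> \<in> J \<and> ?\<gamma> \<in> J")
      case False
      then have "A i j * A k l = 0" by (auto simp: A_def tropical_weight_def)
      moreover have "0 \<le> A i k * A j l" by (intro mult_nonneg_nonneg nonneg)
      ultimately show ?thesis by linarith
    next
      case True
      have "?\<beta> $ i > ?\<gamma> $ i" using ne by (simp add: axis_def)
      then obtain m where m: "?\<beta> $ m < ?\<gamma> $ m" "?\<beta> + evec m - evec i \<in> J" "?\<gamma> + evec i - evec m \<in> J"
        "v ?\<beta> + v ?\<gamma> \<ge> v (?\<beta> + evec m - evec i) + v (?\<gamma> + evec i - evec m)"
        using v True unfolding M_convex_fun_def by blast
      have \<beta>': "?\<beta> + evec m - evec i = \<alpha> + evec j + evec m"
        by (simp add: vec_eq_iff)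
      have "m = k \<or> m = l" using m(1) by (auto simp: axis_def split: if_splits)
      then show ?thesis
      proof
        assume mk: "m = k"
        then have \<gamma>': "?\<gamma> + evec i - evec m = \<alpha> + evec i + evec l" by (simp add: vec_eq_iff)
        have "A i j * A k l \<le> A j k * A i l"
          using m mk unfolding A_def \<beta>' \<gamma>' by (intro tropical_weight_le) auto
        then show ?thesis by (simp add: mult.commute le_max_iff_disj)
      next
        assume ml: "m = l"
        then have \<gamma>': "?\<gamma> + evec i - evec m = \<alpha> + evec i + evec k" by (simp add: vec_eq_iff)
        have "A i j * A k l \<le> A j l * A i k"
          using m ml unfolding A_def \<beta>' \<gamma>' by (intro tropical_weight_le) auto
        then show ?thesis by (simp add: mult.commute le_max_iff_disj)
      qed
    qed
  qed
qed

lemma rho_bound: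
  obtains M where "M > 0" "\<And>f \<alpha>. f \<in> poly_simplex d \<Longrightarrow> f \<alpha> \<le> rho f \<alpha> \<and> rho f \<alpha> \<le> M * f (\<alpha> :: nat^'n::finite)"
proof
  define M where "M = Max (insert 1 (fact_vec ` (Delta d :: (nat^'n) set)))"
  show "M > 0" unfolding M_def by (rule less_le_trans[of 0 1]) auto
  fix f :: "'n polyn" and \<alpha> assume f: "f \<in> poly_simplex d"
  show "f \<alpha> \<le> rho f \<alpha> \<and> rho f \<alpha> \<le> M * f \<alpha>"
  proof (cases "\<alpha> \<in> Delta d")
    case True
    then have "fact_vec \<alpha> \<le> M" unfolding M_def by (intro Max_ge) auto
    then show ?thesis
      using mult_right_mono[OF fact_vec_ge_1 poly_simplexD(1)[OF f]] mult_right_mono[OF _ poly_simplexD(1)[OF f]]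
      by (simp add: rho_def)
  next
    case False
    then show ?thesis using poly_simplexD(2)[OF f] by (simp add: rho_def)
  qed
qed

text \<open>On the finite set of exponents the factorials are bounded factors, so passing between
  coefficients and divided-power coefficients only changes the constant.\<close>

lemma exchange_bound_of_rho:
  fixes U :: "'n::finite polyn set"
  assumes U: "U \<subseteq> poly_simplex d" and b: "\<And>f. f \<in> U \<Longrightarrow> exchange_bound J C (rho f)" and C: "0 \<le> C"
  shows "\<exists>C. \<forall>f\<in>U. exchange_bound J C f"
proof -
  obtain M where M: "M > 0" "\<And>f \<alpha>. f \<in> poly_simplex d \<Longrightarrow> f \<alpha> \<le> rho f \<alpha> \<and> rho f \<alpha> \<le> M * f (\<alpha> :: nat^'n)"
    by (rule rho_bound) (rule that)
  have "exchange_bound J (C * M\<^sup>2) f" if "f \<in> U" for f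
    unfolding exchange_bound_def
  proof (intro allI impI)
    fix \<alpha> i j k l
    assume *: "i \<noteq> k \<and> i \<noteq> l \<and> j \<noteq> k \<and> j \<noteq> l \<and> \<alpha> + evec i + evec j \<in> J \<and> \<alpha> + evec k + evec l \<in> J"
    have fs: "f \<in> poly_simplex d" using that U by blast
    note M' = M(2)[OF fs] and nn = poly_simplexD(1)[OF fs]
    have rn: "0 \<le> rho f \<alpha>" for \<alpha> using M'[of \<alpha>] nn[of \<alpha>] by linarith
    have up: "rho f \<alpha> * rho f \<beta> \<le> M\<^sup>2 * (f \<alpha> * f \<beta>)" for \<alpha> \<beta>
    proof -
      have "rho f \<alpha> * rho f \<beta> \<le> (M * f \<alpha>) * (M * f \<beta>)"
        using M' rn nn M(1) by (intro mult_mono) auto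
      then show ?thesis by (simp add: power2_eq_square mult_ac)
    qed
    have "f (\<alpha> + evec i + evec j) * f (\<alpha> + evec k + evec l) \<le> rho f (\<alpha> + evec i + evec j) * rho f (\<alpha> + evec k + evec l)"
      using M' rn nn by (intro mult_mono) auto
    also have "\<dots> \<le> C * max (rho f (\<alpha> + evec i + evec k) * rho f (\<alpha> + evec j + evec l)) (rho f (\<alpha> + evec i + evec l) * rho f (\<alpha> + evec j + evec k))"
      using b[OF that] * unfolding exchange_bound_def by blast
    also have "\<dots> \<le> C * max (M\<^sup>2 * (f (\<alpha> + evec i + evec k) * f (\<alpha> + evec j + evec l))) (M\<^sup>2 * (f (\<alpha> + evec i + evec l) * f (\<alpha> + evec j + evec k)))"
      by (intro mult_left_mono max.mono up C)
    also have "\<dots> = C * M\<^sup>2 * max (f (\<alpha> + evec i + evec k) * f (\<alpha> + evec j + evec l)) (f (\<alpha> + evec i + evec l) * f (\<alpha> + evec j + evec k))"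
      by (simp add: max_mult_distrib_left C mult.assoc)
    finally show "f (\<alpha> + evec i + evec j) * f (\<alpha> + evec k + evec l) \<le> C * M\<^sup>2 * max (f (\<alpha> + evec i + evec k) * f (\<alpha> + evec j + evec l)) (f (\<alpha> + evec i + evec l) * f (\<alpha> + evec j + evec k))" .
  qed
  then show ?thesis by blast
qed

lemma normalized_exp:
  fixes J :: "(nat^'n::finite) set" and v :: "nat^'n \<Rightarrow> real"
  assumes J: "J \<noteq> {}" "J \<subseteq> Delta d"
  defines "f \<equiv> normalize_poly d (\<lambda>\<alpha>. if \<alpha> \<in> J then exp (- v \<alpha>) / fact_vec \<alpha> else 0)"
  shows "f \<in> poly_simplex d" "supp f = J" "\<exists>c>0. rho f = tropical_weight J v c"
proof -
  let ?g = "\<lambda>\<alpha>. if \<alpha> \<in> J then exp (- v \<alpha>) / fact_vec \<alpha> else (0::real)"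
  have nz: "fact_vec \<alpha> \<noteq> 0" for \<alpha> :: "nat^'n" using fact_vec_pos[of \<alpha>] by simp
  have gs: "supp ?g = J" by (auto simp: supp_def nz)
  have 1: "0 \<le> ?g \<alpha>" for \<alpha> using fact_vec_pos[of \<alpha>] by (simp add: less_imp_le)
  have 2: "supp ?g \<subseteq> Delta d" using gs J by simp
  have 3: "?g \<noteq> (\<lambda>_. 0)" by (rule nonzero_of_supp) (simp only: gs J(1) not_False_eq_True)
  show "f \<in> poly_simplex d" unfolding f_def by (rule normalize_poly_in_simplex[OF 1 2 3])
  note eq = normalize_eq_exp[OF 1 2 3, folded f_def]
  show "supp f = J" using supp_exp_scale[OF eq] gs by simp
  have "rho f = tropical_weight J v (1 / sum ?g (Delta d))"
    by (auto simp: fun_eq_iff rho_def tropical_weight_def f_def normalize_poly_def nz)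
  moreover have "1 / sum ?g (Delta d) > 0" using sum_pos_of_nonzero[OF 1 2 3] by simp
  ultimately show "\<exists>c>0. rho f = tropical_weight J v c" by blast
qed

lemma strata_PL: "strata d (PL d :: (nat^'n::finite) set \<Rightarrow> 'n polyn set)"
proof
  fix J :: "(nat^'n) set" and f :: "'n polyn"
  assume f: "f \<in> PL d J"
  then show "f \<in> poly_simplex d" "supp f = J" by (simp_all add: PL_iff)
  show "orbit d f \<subseteq> PL d J"
  proof
    fix g assume g: "g \<in> orbit d f"
    have fs: "f \<in> poly_simplex d" using f by (simp add: PL_iff)
    obtain a c where gs: "g \<in> poly_simplex d" and g_eq: "\<And>\<alpha>. g \<alpha> = exp (a \<bullet> real_vec \<alpha> + c) * f \<alpha>"
      using g unfolding orbit_eq[OF fs] by auto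
    have "supp g = supp f" by (rule supp_exp_scale[OF g_eq])
    moreover have "Lorentzian d g"
      using f poly_simplex_nonzero[OF gs] \<open>supp g = supp f\<close> reverse_CS_hessian_scale[OF _ g_eq]
        poly_simplexD(1)[OF gs]
      unfolding PL_iff Lorentzian_iff by auto
    ultimately show "g \<in> PL d J" using f gs by (simp add: PL_iff)
  qed
next
  fix J :: "(nat^'n) set" and \<sigma> :: "nat \<Rightarrow> 'n polyn" and f
  assume \<sigma>: "\<And>n. \<sigma> n \<in> PL d J" and lim: "\<And>\<alpha>. (\<lambda>n. \<sigma> n \<alpha>) \<longlonglongrightarrow> f \<alpha>" and M: "M_convex (supp f)"
  have fs: "f \<in> poly_simplex d" by (rule poly_simplex_limit[OF _ lim]) (use \<sigma> in \<open>simp add: PL_iff\<close>)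
  have "reverse_CS (hessian (pderivs \<alpha> f))" if "degree_vec \<alpha> + 2 = d" for \<alpha>
  proof (rule reverse_CS_limit)
    show "reverse_CS (hessian (pderivs \<alpha> (\<sigma> n)))" for n
      using \<sigma>[of n] that by (simp add: PL_iff Lorentzian_iff)
    show "(\<lambda>n. hessian (pderivs \<alpha> (\<sigma> n)) $ i $ j) \<longlonglongrightarrow> hessian (pderivs \<alpha> f) $ i $ j" for i j
      unfolding hessian_pderivs rho_def by (intro tendsto_intros lim)
  qed
  then have "Lorentzian d f"
    using M poly_simplex_nonzero[OF fs] fs poly_simplexD(1)[OF fs] by (auto simp: Lorentzian_iff poly_simplex_def)
  then show "f \<in> PL d (supp f)" using fs by (simp add: PL_iff)
next
  fix J :: "(nat^'n) set" assume J: "J \<subseteq> Delta d"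
  \<comment> \<open>The three-term inequality bounds the square root of the left product by twice
    the root of the maximum; squaring gives 4.\<close>
  have "exchange_bound J 4 (rho f)" if f: "f \<in> PL d J" for f
    unfolding exchange_bound_def
  proof (intro allI impI)
    fix \<alpha> i j k l
    assume *: "i \<noteq> k \<and> i \<noteq> l \<and> j \<noteq> k \<and> j \<noteq> l \<and> \<alpha> + evec i + evec j \<in> J \<and> \<alpha> + evec k + evec l \<in> J"
    then have deg: "degree_vec \<alpha> + 2 = d" using J by (auto simp: Delta_def subset_iff)
    let ?A = "\<lambda>i j. rho f (\<alpha> + evec i + evec j)"
    have nn: "0 \<le> ?A i j" for i j
      using f poly_simplexD(1)[of f d] less_imp_le[OF fact_vec_pos]
      unfolding rho_def PL_iff by (blast intro: mult_nonneg_nonneg)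
    have "sqrt (?A i j * ?A k l) \<le> sqrt (?A i k * ?A j l) + sqrt (?A i l * ?A j k)"
      unfolding hessian_pderivs[symmetric]
    proof (rule reverse_CS_plucker)
      show "reverse_CS (hessian (pderivs \<alpha> f))" using f deg by (simp add: PL_iff Lorentzian_iff)
      show "hessian (pderivs \<alpha> f) $ i $ j = hessian (pderivs \<alpha> f) $ j $ i" for i j
        by (simp add: hessian_pderivs add_ac)
      show "0 \<le> hessian (pderivs \<alpha> f) $ i $ j" for i j
        by (simp only: hessian_pderivs nn)
    qed
    also have "\<dots> \<le> sqrt (max (?A i k * ?A j l) (?A i l * ?A j k)) + sqrt (max (?A i k * ?A j l) (?A i l * ?A j k))"
      by (intro add_mono real_sqrt_le_mono) auto
    also have "\<dots> = sqrt (4 * max (?A i k * ?A j l) (?A i l * ?A j k))"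
      by (simp add: real_sqrt_mult)
    finally show "?A i j * ?A k l \<le> 4 * max (?A i k * ?A j l) (?A i l * ?A j k)" by simp
  qed
  then show "\<exists>C. \<forall>f\<in>PL d J. exchange_bound J C f"
    by (intro exchange_bound_of_rho[of _ d J 4]) (auto simp: PL_iff)
next
  fix J :: "(nat^'n) set" and v
  assume J: "M_convex J" "J \<subseteq> Delta d" "M_convex_fun J v"
  let ?f = "normalize_poly d (\<lambda>\<alpha>. if \<alpha> \<in> J then exp (- v \<alpha>) / fact_vec \<alpha> else 0)"
  have J0: "J \<noteq> {}" using J(1) by (simp add: M_convex_def)
  note N = normalized_exp[OF J0 J(2), of v]
  obtain c where c: "c > 0" "rho ?f = tropical_weight J v c" using N(3) by blast
  have "reverse_CS (hessian (pderivs \<alpha> ?f))" for \<alpha>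
  proof (rule four_point_reverse_CS)
    show "hessian (pderivs \<alpha> ?f) $ i $ j = hessian (pderivs \<alpha> ?f) $ j $ i" for i j
      by (simp only: hessian_pderivs add_ac)
    show "0 \<le> hessian (pderivs \<alpha> ?f) $ i $ j" for i j
      using c(1) by (simp add: hessian_pderivs c(2) tropical_weight_def)
    show "hessian (pderivs \<alpha> ?f) $ i $ j * hessian (pderivs \<alpha> ?f) $ k $ l
      \<le> max (hessian (pderivs \<alpha> ?f) $ i $ k * hessian (pderivs \<alpha> ?f) $ j $ l) (hessian (pderivs \<alpha> ?f) $ i $ l * hessian (pderivs \<alpha> ?f) $ j $ k)" for i j k l
      unfolding hessian_pderivs c(2) by (rule M_convex_fun_four_point[OF J(3) c(1)])
  qed
  then have "Lorentzian d ?f"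
    using N(1,2) J poly_simplex_nonzero[OF N(1)] poly_simplexD(1)[OF N(1)] by (auto simp: Lorentzian_iff)
  then show "?f \<in> PL d J" using N(1,2) by (simp add: PL_iff)
qed

section \<open>Representations over the triangular hyperfields\<close>

definition triangle_condition :: "real \<Rightarrow> nat \<Rightarrow> (nat \<Rightarrow> real) \<Rightarrow> bool" where
  "triangle_condition q s b \<longleftrightarrow> (\<forall>k\<in>{0..s}. b k powr (1 / q) \<le> (\<Sum>m\<in>{0..s} - {k}. b m powr (1 / q)))"

definition plucker_terms :: "'n::finite polyn \<Rightarrow> nat^'n \<Rightarrow> nat \<Rightarrow> (nat \<Rightarrow> 'n) \<Rightarrow> (nat \<Rightarrow> 'n) \<Rightarrow> nat \<Rightarrow> real" where
  "plucker_terms \<rho> \<alpha> s i j k =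
     \<rho> (\<alpha> + (\<Sum>m\<in>{0..s} - {k}. evec (i m))) * \<rho> (\<alpha> + evec (i k) + (\<Sum>m=2..s. evec (j m)))"

definition admissible :: "nat \<Rightarrow> (nat^'n::{finite,linorder}) set \<Rightarrow> nat \<Rightarrow> nat^'n::{finite,linorder} \<Rightarrow> (nat \<Rightarrow> 'n) \<Rightarrow> (nat \<Rightarrow> 'n) \<Rightarrow> bool" where
  "admissible d J s \<alpha> i j \<longleftrightarrow>
     2 \<le> s \<and> s \<le> d \<and> \<alpha> \<in> Delta (d - s) \<and> delta_minus J \<le> \<alpha> \<and>
     mono_on {0..s} i \<and> mono_on {2..s} j \<and>
     \<alpha> + (\<Sum>m=0..s. evec (i m)) + (\<Sum>m=2..s. evec (j m)) \<le> delta_plus J"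

lemma Tq_representation_iff:
  "Tq_representation d q J \<rho> \<longleftrightarrow> (\<forall>\<alpha>. 0 \<le> \<rho> \<alpha>) \<and> supp \<rho> = J \<and> J \<subseteq> Delta d \<and>
     (\<forall>s \<alpha> i j. admissible d J s \<alpha> i j \<longrightarrow> triangle_condition q s (plucker_terms \<rho> \<alpha> s i j))"
  by (simp only: Tq_representation_def admissible_def triangle_condition_def plucker_terms_def Let_def)

text \<open>The exponents of the two factors have a sum independent of \<open>k\<close>, so the
  torus multiplies all terms of one relation by a common factor.\<close>

lemma plucker_terms_scale:
  assumes g: "\<And>\<alpha>. g \<alpha> = exp (a \<bullet> real_vec \<alpha> + c) * f \<alpha>" and k: "k \<in> {0..s}"
  shows "plucker_terms g \<alpha> s i j k =
    exp (a \<bullet> real_vec (\<alpha> + \<alpha> + (\<Sum>m=0..s. evec (i m)) + (\<Sum>m=2..s. evec (j m))) + (c + c)) * plucker_terms f \<alpha> s i j k"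
proof -
  let ?P = "\<alpha> + (\<Sum>m\<in>{0..s} - {k}. evec (i m))" and ?R = "\<alpha> + evec (i k) + (\<Sum>m=2..s. evec (j m))"
  have "(\<Sum>m=0..s. evec (i m)) = evec (i k) + (\<Sum>m\<in>{0..s} - {k}. evec (i m))"
    using k sum.remove[of "{0..s}" k "\<lambda>m. evec (i m)"] by simp
  then have total: "\<alpha> + \<alpha> + (\<Sum>m=0..s. evec (i m)) + (\<Sum>m=2..s. evec (j m)) = ?P + ?R"
    by (simp only: add_ac)
  have "exp (a \<bullet> real_vec (?P + ?R) + (c + c)) = exp (a \<bullet> real_vec ?P + c) * exp (a \<bullet> real_vec ?R + c)"
    by (simp only: real_vec_add[of ?P ?R] inner_add_right exp_add mult_ac)
  then show ?thesis
    unfolding total by (simp only: plucker_terms_def g mult_ac)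
qed

lemma Tq_representation_scale:
  assumes f: "Tq_representation d q J f" and g: "\<And>\<alpha>. g \<alpha> = exp (a \<bullet> real_vec \<alpha> + c) * f \<alpha>"
  shows "Tq_representation d q J g"
  unfolding Tq_representation_iff
proof (intro conjI allI impI)
  have fn: "0 \<le> f \<alpha>" for \<alpha> using f by (simp add: Tq_representation_iff)
  show "0 \<le> g \<alpha>" for \<alpha> using fn by (simp add: g)
  show "supp g = J" "J \<subseteq> Delta d" using f supp_exp_scale[OF g] by (simp_all add: Tq_representation_iff)
  fix s \<alpha> i j assume "admissible d J s \<alpha> i j"
  then have t: "triangle_condition q s (plucker_terms f \<alpha> s i j)" using f by (simp add: Tq_representation_iff)
  let ?E = "exp (a \<bullet> real_vec (\<alpha> + \<alpha> + (\<Sum>m=0..s. evec (i m)) + (\<Sum>m=2..s. evec (j m))) + (c + c))"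
  have pw: "plucker_terms g \<alpha> s i j k powr (1 / q) = ?E powr (1 / q) * plucker_terms f \<alpha> s i j k powr (1 / q)" if "k \<in> {0..s}" for k
    unfolding plucker_terms_scale[OF g that] by (rule powr_mult)
  show "triangle_condition q s (plucker_terms g \<alpha> s i j)"
    unfolding triangle_condition_def
  proof
    fix k assume k: "k \<in> {0..s}"
    have "?E powr (1 / q) * plucker_terms f \<alpha> s i j k powr (1 / q) \<le> ?E powr (1 / q) * (\<Sum>m\<in>{0..s} - {k}. plucker_terms f \<alpha> s i j m powr (1 / q))"
      using t k by (intro mult_left_mono) (auto simp: triangle_condition_def)
    also have "\<dots> = (\<Sum>m\<in>{0..s} - {k}. plucker_terms g \<alpha> s i j m powr (1 / q))"
      unfolding sum_distrib_left by (intro sum.cong) (auto simp: pw)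
    finally show "plucker_terms g \<alpha> s i j k powr (1 / q) \<le> (\<Sum>m\<in>{0..s} - {k}. plucker_terms g \<alpha> s i j m powr (1 / q))"
      by (simp add: pw[OF k])
  qed
qed

lemma Gr_iff:
  assumes "J \<noteq> {}"
  shows "f \<in> Gr d q J \<longleftrightarrow> f \<in> poly_simplex d \<and> Tq_representation d q J (rho f)"
proof
  {
    assume "f \<in> Gr d q J"
    then obtain \<rho> where \<rho>: "Tq_representation d q J \<rho>" "f = normalize_poly d (\<lambda>\<alpha>. \<rho> \<alpha> / fact_vec \<alpha>)"
      by (auto simp: Gr_def)
    let ?g = "\<lambda>\<alpha>. \<rho> \<alpha> / fact_vec \<alpha>"
    have gs: "supp ?g = J" using \<rho>(1) by (auto simp: supp_def Tq_representation_iff)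
    have 1: "0 \<le> ?g \<alpha>" for \<alpha> using \<rho>(1) fact_vec_pos[of \<alpha>] by (simp add: Tq_representation_iff)
    have 2: "supp ?g \<subseteq> Delta d" using gs \<rho>(1) by (simp add: Tq_representation_iff)
    have 3: "?g \<noteq> (\<lambda>_. 0)" by (rule nonzero_of_supp) (simp only: gs assms not_False_eq_True)
    have "rho f \<alpha> = exp (0 \<bullet> real_vec \<alpha> + (- ln (sum ?g (Delta d)))) * \<rho> \<alpha>" for \<alpha>
      unfolding rho_def \<rho>(2) normalize_eq_exp[OF 1 2 3] by simp
    from Tq_representation_scale[OF \<rho>(1) this] normalize_poly_in_simplex[OF 1 2 3]
    show "f \<in> poly_simplex d \<and> Tq_representation d q J (rho f)" by (simp add: \<rho>(2))
  }
  assume f: "f \<in> poly_simplex d \<and> Tq_representation d q J (rho f)"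
  have "(\<lambda>\<alpha>. rho f \<alpha> / fact_vec \<alpha>) = f" by (simp add: rho_def)
  then have "f = normalize_poly d (\<lambda>\<alpha>. rho f \<alpha> / fact_vec \<alpha>)" using f by (simp add: normalize_poly_simplex)
  then show "f \<in> Gr d q J" unfolding Gr_def using f by blast
qed

lemma delta_minus_le: "\<lbrakk>finite J; \<alpha> \<in> J\<rbrakk> \<Longrightarrow> delta_minus J $ i \<le> \<alpha> $ i"
  by (simp add: delta_minus_def)

lemma delta_plus_ge: "\<lbrakk>finite J; \<alpha> \<in> J\<rbrakk> \<Longrightarrow> \<alpha> $ i \<le> delta_plus J $ i"
  by (simp add: delta_plus_def)

text \<open>A smaller support has a smaller box between \<open>delta_minus\<close> and
  \<open>delta_plus\<close>, so its relations occur among those of the larger support. This lets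
  limits drop into a smaller stratum.\<close>

lemma admissible_subset:
  fixes J :: "(nat^'n::{finite,linorder}) set"
  assumes "J' \<subseteq> J" "J' \<noteq> {}" "finite J" "admissible d J' s \<alpha> i j"
  shows "admissible d J s \<alpha> i j"
proof -
  have fin: "finite J'" using assms finite_subset by blast
  have "delta_minus J $ x \<le> delta_minus J' $ x" for x
    unfolding delta_minus_def vec_lambda_beta using assms by (intro Min_antimono image_mono) auto
  moreover have "delta_plus J' $ x \<le> delta_plus J $ x" for x
    unfolding delta_plus_def vec_lambda_beta using assms by (intro Max_mono image_mono) auto
  ultimately show ?thesis
    using assms(4) order_trans unfolding admissible_def less_eq_vec_def by meson
qed

text \<open>The relation with s = 2 is available for sorted indices only, but it then gives all
  three triangle inequalities. The terms are symmetric in the indices of their first factor, so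
  every order of x, y, z reduces to a sorted one.\<close>

lemma Tq_exchange_three:
  fixes \<rho> :: "'n::{finite,linorder} polyn"
  assumes T: "Tq_representation d q J \<rho>" and d: "degree_vec \<alpha> + 2 = d"
    and lo: "delta_minus J \<le> \<alpha>" and hi: "\<alpha> + evec x + evec y + evec z + evec l \<le> delta_plus J"
  defines "t \<equiv> \<lambda>x y z. (\<rho> (\<alpha> + evec x + evec y) * \<rho> (\<alpha> + evec z + evec l)) powr (1 / q)"
  shows "t x y z \<le> t x z y + t y z x"
proof -
  have sorted: "t x y z \<le> t x z y + t y z x \<and> t x z y \<le> t x y z + t y z x \<and> t y z x \<le> t x y z + t x z y"
    if "x \<le> y" "y \<le> z" "\<alpha> + evec x + evec y + evec z + evec l \<le> delta_plus J" for x y z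
  proof -
    define i where "i = (\<lambda>m::nat. if m = 0 then x else if m = 1 then y else z)"
    have sets: "{0..2::nat} = {0, 1, 2}" by auto
    have "admissible d J 2 \<alpha> i (\<lambda>_. l)"
      unfolding admissible_def
    proof (intro conjI)
      show "mono_on {0..2} i" using that unfolding mono_on_def sets i_def by auto
      show "\<alpha> + (\<Sum>m=0..2. evec (i m)) + (\<Sum>m=2..(2::nat). evec l) \<le> delta_plus J"
        using that(3) unfolding sets by (simp add: i_def add_ac)
    qed (use d lo in \<open>auto simp: Delta_def mono_on_def\<close>)
    then have tc: "triangle_condition q 2 (plucker_terms \<rho> \<alpha> 2 i (\<lambda>_. l))"
      using T by (simp add: Tq_representation_iff)
    have del: "{0, 1, 2} - {0} = {1, 2::nat}" "{0, 1, 2} - {1} = {0, 2::nat}" "{0, 1, 2} - {2} = {0, 1::nat}" by auto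
    have p: "plucker_terms \<rho> \<alpha> 2 i (\<lambda>_. l) 0 powr (1 / q) = t y z x"
      "plucker_terms \<rho> \<alpha> 2 i (\<lambda>_. l) 1 powr (1 / q) = t x z y"
      "plucker_terms \<rho> \<alpha> 2 i (\<lambda>_. l) 2 powr (1 / q) = t x y z"
      unfolding plucker_terms_def sets del t_def by (simp_all add: i_def add_ac)
    show ?thesis
      using tc unfolding triangle_condition_def sets ball_simps del by (simp add: p add_ac)
  qed
  have sym: "t x y z = t y x z" for x y z by (simp add: t_def add_ac)
  have hi': "\<alpha> + evec x + evec z + evec y + evec l \<le> delta_plus J" "\<alpha> + evec y + evec x + evec z + evec l \<le> delta_plus J"
    "\<alpha> + evec y + evec z + evec x + evec l \<le> delta_plus J" "\<alpha> + evec z + evec x + evec y + evec l \<le> delta_plus J"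
    "\<alpha> + evec z + evec y + evec x + evec l \<le> delta_plus J"
    using hi by (simp_all add: add_ac)
  consider "x \<le> y" "y \<le> z" | "x \<le> z" "z \<le> y" | "y \<le> x" "x \<le> z" | "y \<le> z" "z \<le> x" | "z \<le> x" "x \<le> y" | "z \<le> y" "y \<le> x"
    using linear by blast
  then show ?thesis
  proof cases
    case 1
    then show ?thesis using sorted[OF 1 hi] by simp
  next
    case 2
    then show ?thesis using sorted[OF 2 hi'(1)] sym[of z y x] by simp
  next
    case 3
    then show ?thesis using sorted[OF 3 hi'(2)] sym[of y x z] by simp
  next
    case 4
    then show ?thesis using sorted[OF 4 hi'(3)] sym[of y x z] sym[of z x y] by simp
  next
    case 5
    then show ?thesis using sorted[OF 5 hi'(4)] sym[of z x y] sym[of z y x] by simp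
  next
    case 6
    then show ?thesis using sorted[OF 6 hi'(5)] sym[of z x y] sym[of z y x] sym[of y x z] by simp
  qed
qed

lemma Tq_exchange_bound:
  assumes T: "Tq_representation d q J \<rho>" and q: "q > 0"
  shows "exchange_bound J (2 powr q) \<rho>"
  unfolding exchange_bound_def
proof (intro allI impI)
  fix \<alpha> i j k l
  assume "i \<noteq> k \<and> i \<noteq> l \<and> j \<noteq> k \<and> j \<noteq> l \<and> \<alpha> + evec i + evec j \<in> J \<and> \<alpha> + evec k + evec l \<in> J"
  then have ne: "i \<noteq> k" "i \<noteq> l" "j \<noteq> k" "j \<noteq> l" and \<beta>: "\<alpha> + evec i + evec j \<in> J" "\<alpha> + evec k + evec l \<in> J" by auto
  have J: "J \<subseteq> Delta d" and nn: "\<And>\<alpha>. 0 \<le> \<rho> \<alpha>" using T by (auto simp: Tq_representation_iff)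
  have fin: "finite J" using J finite_subset finite_Delta by blast
  have d: "degree_vec \<alpha> + 2 = d" using J \<beta>(1) by (auto simp: Delta_def subset_iff)
  \<comment> \<open>Since {i, j} and {k, l} are disjoint, each coordinate of \<alpha> is attained by
    one of the two points of \<open>J\<close>; in the same way each coordinate of the full sum in
    \<open>hi\<close> is attained by one of them.\<close>
  have lo: "delta_minus J \<le> \<alpha>"
    unfolding less_eq_vec_def
  proof
    fix x
    show "delta_minus J $ x \<le> \<alpha> $ x"
      using delta_minus_le[OF fin \<beta>(1), of x] delta_minus_le[OF fin \<beta>(2), of x] ne
      by (auto simp: axis_def split: if_splits)
  qed
  have hi: "\<alpha> + evec i + evec j + evec k + evec l \<le> delta_plus J"
    unfolding less_eq_vec_def
  proof
    fix x
    show "(\<alpha> + evec i + evec j + evec k + evec l) $ x \<le> delta_plus J $ x"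
      using delta_plus_ge[OF fin \<beta>(1), of x] delta_plus_ge[OF fin \<beta>(2), of x] ne
      by (auto simp: axis_def split: if_splits)
  qed
  let ?x = "\<rho> (\<alpha> + evec i + evec j) * \<rho> (\<alpha> + evec k + evec l)"
  let ?y = "\<rho> (\<alpha> + evec i + evec k) * \<rho> (\<alpha> + evec j + evec l)"
  let ?z = "\<rho> (\<alpha> + evec i + evec l) * \<rho> (\<alpha> + evec j + evec k)"
  have nn': "0 \<le> ?x" "0 \<le> ?y" "0 \<le> ?z" using nn by auto
  have "?x powr (1 / q) \<le> ?y powr (1 / q) + ?z powr (1 / q)"
    using Tq_exchange_three[OF T d lo hi] by (simp add: mult.commute)
  also have "\<dots> \<le> max ?y ?z powr (1 / q) + max ?y ?z powr (1 / q)"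
    using nn' q by (intro add_mono powr_mono2) auto
  finally have le: "?x powr (1 / q) \<le> 2 * max ?y ?z powr (1 / q)" by simp
  have root: "(t powr (1 / q)) powr q = t" if "0 \<le> t" for t :: real
    using q that by (simp add: powr_powr)
  have "(?x powr (1 / q)) powr q \<le> (2 * max ?y ?z powr (1 / q)) powr q"
    using q le by (intro powr_mono2) auto
  also have "(?x powr (1 / q)) powr q = ?x"
    using root[OF nn'(1)] .
  also have "(2 * max ?y ?z powr (1 / q)) powr q = 2 powr q * (max ?y ?z powr (1 / q)) powr q"
    by (rule powr_mult)
  also have "(max ?y ?z powr (1 / q)) powr q = max ?y ?z"
    using nn' by (intro root) linarith
  finally show "?x \<le> 2 powr q * max ?y ?z" .
qed

text \<open>The hypothesis says that the maximum is attained at least twice, the tropical form of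
  the relation; it implies the triangle inequalities for every positive q.\<close>

lemma triangle_condition_of_max:
  assumes "q > 0" "\<And>k. 0 \<le> b k" "\<And>k. k \<le> s \<Longrightarrow> \<exists>m\<le>s. m \<noteq> k \<and> b k \<le> b m"
  shows "triangle_condition q s b"
  unfolding triangle_condition_def
proof
  fix k assume "k \<in> {0..s}"
  then obtain m where m: "m \<le> s" "m \<noteq> k" "b k \<le> b m" using assms(3) by auto
  then have "b k powr (1 / q) \<le> b m powr (1 / q)" using assms by (intro powr_mono2) auto
  also have "\<dots> \<le> (\<Sum>m\<in>{0..s} - {k}. b m powr (1 / q))"
    using m by (intro member_le_sum[of m "{0..s} - {k}" "\<lambda>m. b m powr (1 / q)"]) auto
  finally show "b k powr (1 / q) \<le> (\<Sum>m\<in>{0..s} - {k}. b m powr (1 / q))" .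
qed

lemma sum_evec_pos:
  assumes "finite A" "0 < (\<Sum>m\<in>A. evec (i m)) $ x"
  obtains m where "m \<in> A" "i m = x"
proof -
  have "\<exists>m\<in>A. evec (i m) $ x \<noteq> (0::nat)"
  proof (rule ccontr)
    assume "\<not> ?thesis"
    then have "(\<Sum>m\<in>A. evec (i m) $ x) = (0::nat)" by simp
    with assms(2) show False by simp
  qed
  then obtain m where "m \<in> A" "evec (i m) $ x \<noteq> (0::nat)" by blast
  then show thesis using that by (cases "i m = x") (auto simp: axis_def)
qed

text \<open>An exchange at \<open>i k\<close> between the two points of term \<open>k\<close>
  produces exactly the two points of another term. It is available if the second point exceeds the
  first at \<open>i k\<close>; otherwise \<open>i k\<close> occurs again among the other indices and
  two terms coincide.\<close>

lemma tropical_weight_max_twice: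
  fixes J :: "(nat^'n::finite) set"
  assumes v: "M_convex_fun J v" and c: "c > 0" and k: "k \<le> s" and s: "1 \<le> s"
  shows "\<exists>m\<le>s. m \<noteq> k \<and> plucker_terms (tropical_weight J v c) \<alpha> s i j k \<le> plucker_terms (tropical_weight J v c) \<alpha> s i j m"
proof -
  let ?w = "tropical_weight J v c"
  define S where "S = (\<lambda>k. \<Sum>m\<in>{0..s} - {k}. evec (i m) :: nat^'n)"
  define t where "t = (\<Sum>m=2..s. evec (j m) :: nat^'n)"
  have S: "S m + evec (i m) = S k + evec (i k)" if "m \<le> s" for m
  proof -
    have "(\<Sum>m=0..s. evec (i m)) = evec (i m) + S m" "(\<Sum>m=0..s. evec (i m)) = evec (i k) + S k"
      unfolding S_def using that k sum.remove[of "{0..s}" m "\<lambda>m. evec (i m)"] sum.remove[of "{0..s}" k "\<lambda>m. evec (i m)"]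
      by simp_all
    then show ?thesis by (simp add: add.commute)
  qed
  have pt: "plucker_terms ?w \<alpha> s i j m = ?w (\<alpha> + S m) * ?w (\<alpha> + evec (i m) + t)" for m
    by (simp add: plucker_terms_def S_def t_def)
  have nn: "0 \<le> ?w \<beta>" for \<beta> using c by (simp add: tropical_weight_def)
  let ?\<beta> = "\<alpha> + S k" and ?\<gamma> = "\<alpha> + evec (i k) + t"
  show ?thesis
  proof (cases "?\<beta> \<in> J \<and> ?\<gamma> \<in> J")
    case False
    then have "plucker_terms ?w \<alpha> s i j k = 0" unfolding pt by (auto simp: tropical_weight_def)
    moreover have "\<exists>m\<le>s. m \<noteq> k" using s by (cases "k = 0") auto
    ultimately show ?thesis unfolding pt using nn by (metis mult_nonneg_nonneg)
  next
    case in_J: True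
    show ?thesis
    proof (cases "?\<gamma> $ i k \<le> ?\<beta> $ i k")
      case True
      then have "0 < S k $ i k" by (simp add: axis_def)
      then obtain m where m: "m \<in> {0..s} - {k}" "i m = i k"
        unfolding S_def by (rule sum_evec_pos[rotated]) auto
      then have "S m = S k" using S[of m] by simp
      with m show ?thesis unfolding pt by (intro exI[of _ m]) auto
    next
      case False
      then have "?\<beta> $ i k < ?\<gamma> $ i k" by simp
      then obtain l where l: "?\<gamma> $ l < ?\<beta> $ l" "?\<gamma> + evec l - evec (i k) \<in> J" "?\<beta> + evec (i k) - evec l \<in> J"
          "v ?\<gamma> + v ?\<beta> \<ge> v (?\<gamma> + evec l - evec (i k)) + v (?\<beta> + evec (i k) - evec l)"
        using v in_J unfolding M_convex_fun_def by blast
      have "0 < S k $ l" using l(1) by (simp add: axis_def split: if_splits)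
      then obtain m where m: "m \<in> {0..s} - {k}" "i m = l"
        unfolding S_def by (rule sum_evec_pos[rotated]) auto
      have Sm: "S m + evec l = S k + evec (i k)" using S[of m] m by simp
      have "?\<beta> + evec (i k) - evec l = \<alpha> + (S m + evec l) - evec l" unfolding Sm by (simp add: add.assoc)
      then have \<beta>': "?\<beta> + evec (i k) - evec l = \<alpha> + S m" by (simp add: vec_eq_iff)
      have \<gamma>': "?\<gamma> + evec l - evec (i k) = \<alpha> + evec l + t" by (simp add: vec_eq_iff)
      have "?w ?\<beta> * ?w ?\<gamma> \<le> ?w (\<alpha> + S m) * ?w (\<alpha> + evec l + t)"
        using l unfolding \<beta>' \<gamma>' by (intro tropical_weight_le) auto
      then show ?thesis using m unfolding pt by (intro exI[of _ m]) auto
    qed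
  qed
qed

lemma strata_Gr:
  assumes q: "q > 0"
  shows "strata d (Gr d q :: (nat^'n::{finite,linorder}) set \<Rightarrow> 'n polyn set)"
proof
  fix J :: "(nat^'n::{finite,linorder}) set" and f :: "'n polyn"
  assume J0: "J \<noteq> {}" and f: "f \<in> Gr d q J"
  show fs: "f \<in> poly_simplex d" using f J0 by (simp add: Gr_iff)
  have T: "Tq_representation d q J (rho f)" using f J0 by (simp add: Gr_iff)
  show "supp f = J" using T by (simp add: Tq_representation_iff)
  show "orbit d f \<subseteq> Gr d q J"
  proof
    fix g assume g: "g \<in> orbit d f"
    obtain a c where gs: "g \<in> poly_simplex d" and g_eq: "\<And>\<alpha>. g \<alpha> = exp (a \<bullet> real_vec \<alpha> + c) * f \<alpha>"
      using g unfolding orbit_eq[OF fs] by auto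
    have "rho g \<alpha> = exp (a \<bullet> real_vec \<alpha> + c) * rho f \<alpha>" for \<alpha> by (simp add: rho_def g_eq)
    from Tq_representation_scale[OF T this] show "g \<in> Gr d q J" using gs J0 by (simp add: Gr_iff)
  qed
next
  fix J :: "(nat^'n::{finite,linorder}) set" and \<sigma> :: "nat \<Rightarrow> 'n polyn" and f
  assume J0: "J \<noteq> {}" and \<sigma>: "\<And>n. \<sigma> n \<in> Gr d q J" and lim: "\<And>\<alpha>. (\<lambda>n. \<sigma> n \<alpha>) \<longlonglongrightarrow> f \<alpha>" and M: "M_convex (supp f)"
  have s0: "supp f \<noteq> {}" using M by (simp add: M_convex_def)
  have \<sigma>s: "\<sigma> n \<in> poly_simplex d" and T: "Tq_representation d q J (rho (\<sigma> n))" for n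
    using \<sigma>[of n] J0 by (simp_all add: Gr_iff)
  have fs: "f \<in> poly_simplex d" by (rule poly_simplex_limit[OF \<sigma>s lim])
  have JD: "J \<subseteq> Delta d" "finite J"
    using T[of 0] finite_subset[OF _ finite_Delta] by (auto simp: Tq_representation_iff)
  have sub: "supp f \<subseteq> J"
  proof
    fix \<alpha> assume \<alpha>: "\<alpha> \<in> supp f"
    show "\<alpha> \<in> J"
    proof (rule ccontr)
      assume "\<alpha> \<notin> J"
      moreover have "supp (\<sigma> n) = J" for n using T[of n] by (simp add: Tq_representation_iff)
      ultimately have "\<sigma> n \<alpha> = 0" for n by (auto simp: supp_def)
      then have "f \<alpha> = 0" using lim[of \<alpha>] by (simp add: LIMSEQ_const_iff)
      with \<alpha> show False by (simp add: supp_def)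
    qed
  qed
  have "Tq_representation d q (supp f) (rho f)"
    unfolding Tq_representation_iff
  proof (intro conjI allI impI)
    show "0 \<le> rho f \<alpha>" for \<alpha> using poly_simplexD(1)[OF fs] fact_vec_pos[of \<alpha>] by (simp add: rho_def)
    show "supp (rho f) = supp f" "supp f \<subseteq> Delta d" using sub JD by auto
    fix s \<alpha> i j assume "admissible d (supp f) s \<alpha> i j"
    then have "admissible d J s \<alpha> i j" by (rule admissible_subset[OF sub s0 JD(2)])
    then have tc: "triangle_condition q s (plucker_terms (rho (\<sigma> n)) \<alpha> s i j)" for n
      using T[of n] by (simp add: Tq_representation_iff)
    have pn: "0 \<le> plucker_terms (rho (\<sigma> n)) \<alpha> s i j k" for n k
      using T[of n] by (simp add: Tq_representation_iff plucker_terms_def)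
    have plim: "(\<lambda>n. plucker_terms (rho (\<sigma> n)) \<alpha> s i j k) \<longlonglongrightarrow> plucker_terms (rho f) \<alpha> s i j k" for k
      unfolding plucker_terms_def rho_def by (intro tendsto_intros lim)
    \<comment> \<open>Terms may vanish in the limit; continuity of \<open>powr\<close> at base 0
      relies on the exponent \<open>1 / q\<close> being positive.\<close>
    have powlim: "(\<lambda>n. plucker_terms (rho (\<sigma> n)) \<alpha> s i j k powr (1 / q)) \<longlonglongrightarrow> plucker_terms (rho f) \<alpha> s i j k powr (1 / q)" for k
      by (rule tendsto_powr'[OF plim tendsto_const]) (use q pn in auto)
    show "triangle_condition q s (plucker_terms (rho f) \<alpha> s i j)"
      unfolding triangle_condition_def
    proof
      fix k assume k: "k \<in> {0..s}"
      show "plucker_terms (rho f) \<alpha> s i j k powr (1 / q) \<le> (\<Sum>m\<in>{0..s} - {k}. plucker_terms (rho f) \<alpha> s i j m powr (1 / q))"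
      proof (rule LIMSEQ_le[OF powlim tendsto_sum[OF powlim]])
        show "\<exists>N. \<forall>n\<ge>N. plucker_terms (rho (\<sigma> n)) \<alpha> s i j k powr (1 / q) \<le> (\<Sum>m\<in>{0..s} - {k}. plucker_terms (rho (\<sigma> n)) \<alpha> s i j m powr (1 / q))"
          using tc k unfolding triangle_condition_def by blast
      qed
    qed
  qed
  then show "f \<in> Gr d q (supp f)" using fs by (simp add: Gr_iff[OF s0])
next
  fix J :: "(nat^'n::{finite,linorder}) set" assume J0: "J \<noteq> {}" and J: "J \<subseteq> Delta d"
  show "\<exists>C. \<forall>f\<in>Gr d q J. exchange_bound J C f"
    by (rule exchange_bound_of_rho[of _ d J "2 powr q"])
      (use Tq_exchange_bound[OF _ q] in \<open>auto simp: Gr_iff[OF J0]\<close>)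
next
  fix J :: "(nat^'n::{finite,linorder}) set" and v
  assume J: "M_convex J" "J \<subseteq> Delta d" "M_convex_fun J v"
  let ?f = "normalize_poly d (\<lambda>\<alpha>. if \<alpha> \<in> J then exp (- v \<alpha>) / fact_vec \<alpha> else 0)"
  have J0: "J \<noteq> {}" using J(1) by (simp add: M_convex_def)
  note N = normalized_exp[OF J0 J(2), of v]
  obtain c where c: "c > 0" "rho ?f = tropical_weight J v c" using N(3) by blast
  have "Tq_representation d q J (rho ?f)"
    unfolding Tq_representation_iff
  proof (intro conjI allI impI)
    show nn: "0 \<le> rho ?f \<alpha>" for \<alpha> using c by (simp add: tropical_weight_def)
    show "supp (rho ?f) = J" "J \<subseteq> Delta d" using N(2) J(2) by simp_all
    fix s \<alpha> i j assume "admissible d J s \<alpha> i j"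
    then have s: "1 \<le> s" by (simp add: admissible_def)
    show "triangle_condition q s (plucker_terms (rho ?f) \<alpha> s i j)"
    proof (rule triangle_condition_of_max[OF q])
      show "0 \<le> plucker_terms (rho ?f) \<alpha> s i j k" for k unfolding plucker_terms_def by (intro mult_nonneg_nonneg nn)
      show "\<exists>m\<le>s. m \<noteq> k \<and> plucker_terms (rho ?f) \<alpha> s i j k \<le> plucker_terms (rho ?f) \<alpha> s i j m" if "k \<le> s" for k
        unfolding c(2) by (rule tropical_weight_max_twice[OF J(3) c(1) that s])
    qed
  qed
  then show "?f \<in> Gr d q J" using N(1) by (simp add: Gr_iff[OF J0])
qed

theorem theorem6p49:
  fixes J :: "(nat^'n::{finite,linorder}) set"
    and d :: nat
    and U :: "(nat^'n::{finite,linorder}) set \<Rightarrow> 'n polyn set"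
    and X :: "'n polyn set"
  assumes "J \<subseteq> Delta d" and "M_convex J"
    and "U = PL d \<or> (\<exists>q>0. U = Gr d q)"
    and "X = mtopology_of (poly_metric d) closure_of (U J)"
  shows "(\<forall>x\<in>X. \<exists>K\<in>hausdorff_quotient d X. x \<in> K) \<and>
         hausdorff_quotient d X = (\<Union>\<P>\<in>{\<P>. regular_polymatroid_subdivision J \<P>}. Y d U X \<P>) \<and>
         (\<forall>\<P>. regular_polymatroid_subdivision J \<P> \<longrightarrow> Y d U X \<P> \<noteq> {})"
proof -
  have "strata d U" using assms(3) strata_PL strata_Gr by blast
  then interpret strata_at d U J X
    by (intro strata_at.intro strata_at_axioms.intro assms)
  show ?thesis by (rule quotient_theorem)
qed

end
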